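(* Let $n\ge3$, $x\in\mathbf{B}^n$ and $\ell\in\partial\mathbf{B}^n$. Let $\tau\in[0,\pi/2]$ be the angle between the straight lines $\{\lambda\mathbf{n}_x:\lambda\in\mathbf{R}\}$ and $\{\mu\ell:\mu\in\mathbf{R}\}$. Let $C(x;\ell)$ be the optimal (smallest) coefficient in the estimate $$\left|\frac{\partial U(x)}{\partial\ell}\right|\le C(x;\ell)\,(1-|x|)^{-1}\sup_{y\in\mathbf{B}^n}|U(y)|,$$ where $U$ ranges over the real-valued bounded harmonic functions in $\mathbf{B}^n$. Then $C(x;\ell)$ may be expressed as follows. (i) If $0\le\tau<\pi/2$, then with $\gamma=\tan\tau$, $$C(x;\ell)=\frac{4\omega_{n-2}}{\omega_n}\,\frac{2^{n-1}}{(1+|x|)^{n-1}}\,\frac1{\sqrt{1+\gamma^2}}\int_0^1\frac{\mathcal{P}_{|x|}(\gamma t)+\mathcal{P}_{|x|}(-\gamma t)}{\sqrt{(1-t^2)^{4-n}}}\,dt,$$ where, for $0\le\rho\le1$, the function $\mathcal{P}_\rho$ of a real argument is defined by $$\mathcal{P}_\rho(z)=\int_0^{\frac{z+\sqrt{z^2+1-\alpha_\rho^2}}{1-\alpha_\rho}}\frac{(n-\beta_\rho+nzw-\beta_\rho w^2)\,w^{n-2}}{(1+w^2)^{\frac n2+1}(1+\kappa_\rho^2w^2)^{\frac n2-1}}\,dw,\qquad \kappa_\rho=\frac{1-\rho}{1+\rho}.$$ (ii) In the radial direction, $$C(x;\mathbf{n}_x)=\frac4{\sqrt\pi}\,\frac{\Gamma\left(\frac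 n2\right)}{\Gamma\left(\frac{n-1}2\right)}\,\frac{2^{n-1}}{(1+|x|)^{n-1}}\int_0^{w_{|x|}}\frac{\beta_{|x|}\,(w_{|x|}^2-w^2)\,w^{n-2}}{(1+w^2)^{\frac n2+1}(1+\kappa_{|x|}^2w^2)^{\frac n2-1}}\,dw,$$ where $w_\rho=\sqrt{\frac{n+(n-2)\rho}{n-(n-2)\rho}}$. (iii) If $\mathbf{t}_x$ is a tangential direction, i.e., any unit vector orthogonal to $\mathbf{n}_x$, then $$C(x;\mathbf{t}_x)=\frac{2n}\pi\,\frac{2^{n-1}}{(1+|x|)^{n-1}}\int_0^\infty\frac{w^{n-1}}{(1+w^2)^{\frac n2+1}(1+\kappa_{|x|}^2w^2)^{\frac n2-1}}\,dw.$$
   Context: $\mathbf{B}^n$ is the open unit ball of $\mathbf{R}^n$ and $\partial\mathbf{B}^n$ the unit sphere. $\partial U(x)/\partial\ell=\langle\nabla U(x),\ell\rangle$. For $x\neq0$, $\mathbf{n}_x=x/|x|$; for $x=0$, $\mathbf{n}_x$ may be taken to be any unit vector. The angle between the lines spanned by unit vectors $\ell_1,\ell_2$ is $\arccos|\langle\ell_1,\ell_2\rangle|$. $\omega_k=2\pi^{k/2}/\Gamma(k/2)$ is the area of the unit sphere in $\mathbf{R}^k$, with $\omega_1=2$. For $0\le\rho\le1$, $$\alpha_\rho=\frac{(n-2)\rho}{n},\qquad\beta_\rho=\frac{n-(n-2)\rho}2.$$ *)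

theory Defs
  imports "HOL-Analysis.Analysis"
begin

definition partial :: "'a::euclidean_space \<Rightarrow> ('a \<Rightarrow> real) \<Rightarrow> 'a \<Rightarrow> real" where
  "partial i f x = frechet_derivative f (at x) i"

definition grad :: "('a::euclidean_space \<Rightarrow> real) \<Rightarrow> 'a \<Rightarrow> 'a" where
  "grad f x = (\<Sum>i\<in>Basis. partial i f x *\<^sub>R i)"

definition C1_on :: "'a::euclidean_space set \<Rightarrow> ('a \<Rightarrow> real) \<Rightarrow> bool" where
  "C1_on S f \<longleftrightarrow> (\<forall>x\<in>S. f differentiable (at x)) \<and> (\<forall>i\<in>Basis. continuous_on S (partial i f))"

definition C2_on :: "'a::euclidean_space set \<Rightarrow> ('a \<Rightarrow> real) \<Rightarrow> bool" where
  "C2_on S f \<longleftrightarrow> C1_on S f \<and> (\<forall>i\<in>Basis. C1_on S (partial i f))"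

definition laplacian :: "('a::euclidean_space \<Rightarrow> real) \<Rightarrow> 'a \<Rightarrow> real" where
  "laplacian f x = (\<Sum>i\<in>Basis. partial i (partial i f) x)"

text \<open>Only used for open \<open>S\<close>; the values of \<open>f\<close> outside \<open>S\<close> are then irrelevant.\<close>

definition harmonic_on :: "'a::euclidean_space set \<Rightarrow> ('a \<Rightarrow> real) \<Rightarrow> bool" where
  "harmonic_on S f \<longleftrightarrow> C2_on S f \<and> (\<forall>x\<in>S. laplacian f x = 0)"

definition admissible_coeff :: "'a::euclidean_space \<Rightarrow> 'a \<Rightarrow> real \<Rightarrow> bool" where
  "admissible_coeff x l C \<longleftrightarrow>
     (\<forall>U. harmonic_on (ball 0 1) U \<and> bounded (U ` ball 0 1) \<longrightarrow>
        \<bar>grad U x \<bullet> l\<bar> \<le> C * inverse (1 - norm x) * (SUP y\<in>ball 0 1. \<bar>U y\<bar>))"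

text \<open>
  \<open>C\<close> is the smallest admissible coefficient. A relation is used instead of an infimum so that
  it also expresses that the smallest coefficient exists; such a \<open>C\<close> is unique.
\<close>

definition optimal_coeff :: "'a::euclidean_space \<Rightarrow> 'a \<Rightarrow> real \<Rightarrow> bool" where
  "optimal_coeff x l C \<longleftrightarrow>
     admissible_coeff x l C \<and> (\<forall>C'. admissible_coeff x l C' \<longrightarrow> C \<le> C')"

definition line_angle :: "'a::euclidean_space \<Rightarrow> 'a \<Rightarrow> real" where
  "line_angle u v = arccos \<bar>u \<bullet> v\<bar>"

text \<open>The area of the unit sphere in \<open>k\<close>-dimensional Euclidean space; for \<open>k = 1\<close> the value is 2.\<close>

definition omega :: "nat \<Rightarrow> real" where
  "omega k = 2 * pi powr (real k / 2) / Gamma (real k / 2)"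

definition alpha :: "nat \<Rightarrow> real \<Rightarrow> real" where
  "alpha n \<rho> = (real n - 2) * \<rho> / real n"

definition beta :: "nat \<Rightarrow> real \<Rightarrow> real" where
  "beta n \<rho> = (real n - (real n - 2) * \<rho>) / 2"

definition kappa :: "real \<Rightarrow> real" where
  "kappa \<rho> = (1 - \<rho>) / (1 + \<rho>)"

definition w_bound :: "nat \<Rightarrow> real \<Rightarrow> real" where
  "w_bound n \<rho> = sqrt ((real n + (real n - 2) * \<rho>) / (real n - (real n - 2) * \<rho>))"

definition denom :: "nat \<Rightarrow> real \<Rightarrow> real \<Rightarrow> real" where
  "denom n \<rho> w =
     (1 + w\<^sup>2) powr (real n / 2 + 1) * (1 + (kappa \<rho>)\<^sup>2 * w\<^sup>2) powr (real n / 2 - 1)"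

text \<open>For \<open>n \<ge> 3\<close> and \<open>0 \<le> \<rho> \<le> 1\<close> one has \<open>0 \<le> alpha n \<rho> < 1\<close>, so the upper limit is positive.\<close>

definition P_fun :: "nat \<Rightarrow> real \<Rightarrow> real \<Rightarrow> real" where
  "P_fun n \<rho> z =
     (LBINT w:{0..(z + sqrt (z\<^sup>2 + 1 - (alpha n \<rho>)\<^sup>2)) / (1 - alpha n \<rho>)}.
        (real n - beta n \<rho> + real n * z * w - beta n \<rho> * w\<^sup>2) * w ^ (n - 2) / denom n \<rho> w)"

end

theory Submission
  imports Defs
begin

text \<open>
  Write \<open>\<sigma>\<close> for the uniform probability measure on the sphere and \<open>P\<close> for the Poisson kernel of the ball.
  Differentiating the Poisson representation of \<open>z \<mapsto> U (r z)\<close> and letting \<open>r \<rightarrow> 1\<close> bounds the derivative of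
  \<open>U\<close> at \<open>x\<close> in direction \<open>l\<close> by \<open>\<integral> \<bar>\<partial>\<^sub>l P x\<bar> d\<sigma>\<close> times the supremum of \<open>\<bar>U\<bar>\<close>; the Poisson integral of the
  sign of \<open>\<partial>\<^sub>l P x\<close> attains this bound. Since \<open>P x\<close> has total mass 1, \<open>\<partial>\<^sub>l P x\<close> has mean zero, so the integral
  is twice that of the positive part, which is what truncates the integral in \<open>P_fun\<close> at the positive
  root of a quadratic.

  The kernel \<open>\<partial>\<^sub>l P x\<close> depends on \<open>y\<close> only through its components along two orthonormal vectors. Their
  joint distribution under \<open>\<sigma>\<close> comes from integrating over the ball in polar coordinates twice, and the
  half-angle substitution \<open>w = tan (\<theta> / 2) / \<kappa>\<close> turns the integral into the stated one.
\<close>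

subsection \<open>Integrals depending on a parameter\<close>

text \<open>A bounded harmonic function need not extend continuously to the sphere; its dilates do,
  and they keep the same bound. The representation rests on uniqueness: the Poisson integral of
  continuous data is harmonic and attains the data, so the difference vanishes by the maximum
  principle.

  \<sigma> is the radial projection of normalised Lebesgue measure on the ball, which reduces its
  rotation invariance and its two-component law to Lebesgue integrals.

  The components are parametrised by c = y . u and t = (y . e) / sqrt (1 - c^2), whose joint density
  factors. The variable t stays outside and the inner integral over c becomes \<open>P_fun\<close>
  at a multiple of t. The constant \<kappa> comes from |y - x|^2 = (1 - \<rho>)^2 (1 + w^2) / (1 +
  \<kappa>^2 w^2): it leaves only powers of these two factors and a numerator quadratic in w.

  The explicit integrals are taken in the extended nonnegative reals. There \<open>ennreal\<close>
  sends negative numbers to 0, so the positive part is built in, and exchanging integrals asks only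
  for measurability.\<close>

locale compact_weighted_measure = finite_measure M
  for M :: "'b::euclidean_space measure" +
  fixes K :: "'b set" and g :: "'b \<Rightarrow> real" and B :: real
  assumes sets_M: "sets M = sets (restrict_space borel K)"
    and compact_K: "compact K"
    and meas_g: "g \<in> borel_measurable M"
    and bound_g: "\<And>y. y \<in> K \<Longrightarrow> \<bar>g y\<bar> \<le> B"
begin

lemma space_M: "space M = K"
  using sets_eq_imp_space_eq[OF sets_M] by (simp add: space_restrict_space)

lemma measurable_continuous:
  fixes f :: "'b \<Rightarrow> 'c::{second_countable_topology, metric_space}"
  assumes "continuous_on K f"
  shows "f \<in> borel_measurable M"
  using borel_measurable_continuous_on_restrict[OF assms] measurable_cong_sets[OF sets_M refl] by blast

lemma integrable_weighted:
  fixes f :: "'b \<Rightarrow> 'c::euclidean_space"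
  assumes "continuous_on K f"
  shows "integrable M (\<lambda>y. g y *\<^sub>R f y)"
proof -
  have "bounded (f ` K)"
    using compact_continuous_image[OF assms compact_K] compact_imp_bounded by blast
  then obtain C where C: "\<And>y. y \<in> K \<Longrightarrow> norm (f y) \<le> C"
    unfolding bounded_iff by blast
  note [measurable] = measurable_continuous[OF assms] meas_g
  show ?thesis
  \<comment> \<open>No sign is assumed of \<open>B\<close>: it can be negative when \<open>K\<close>
    is empty, hence the absolute value.\<close>
  proof (rule integrable_const_bound[where B = "\<bar>B\<bar> * C"])
    show "AE y in M. norm (g y *\<^sub>R f y) \<le> \<bar>B\<bar> * C"
    proof (rule AE_I2)
      fix y assume "y \<in> space M"
      then have "y \<in> K" by (simp add: space_M)
      then show "norm (g y *\<^sub>R f y) \<le> \<bar>B\<bar> * C"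
        using bound_g[of y] C[of y] by (auto intro!: mult_mono)
    qed
  qed measurable
qed

lemma norm_integral_weighted_le:
  fixes f :: "'b \<Rightarrow> 'c::euclidean_space"
  assumes "continuous_on K f" and "\<And>y. y \<in> K \<Longrightarrow> norm (f y) \<le> e"
  shows "norm (\<integral>y. g y *\<^sub>R f y \<partial>M) \<le> (\<bar>B\<bar> * measure M K) * e"
proof -
  have "norm (\<integral>y. g y *\<^sub>R f y \<partial>M) \<le> (\<integral>y. \<bar>B\<bar> * e \<partial>M)"
  proof (rule order_trans[OF integral_norm_bound integral_mono])
    show "integrable M (\<lambda>y. norm (g y *\<^sub>R f y))"
      by (rule integrable_norm[OF integrable_weighted[OF assms(1)]])
    show "norm (g y *\<^sub>R f y) \<le> \<bar>B\<bar> * e" if "y \<in> space M" for y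
      using bound_g[of y] assms(2)[of y] that by (auto simp: space_M intro!: mult_mono)
  qed simp
  then show ?thesis by (simp add: space_M mult_ac)
qed

lemma continuous_on_slice:
  assumes "continuous_on (X \<times> K) (\<lambda>(x, y). k x y)" "x \<in> X"
  shows "continuous_on K (k x)"
proof -
  have "continuous_on K ((\<lambda>(x, y). k x y) \<circ> (\<lambda>y. (x, y)))"
    by (intro continuous_on_compose continuous_intros continuous_on_subset[OF assms(1)]) (use assms(2) in auto)
  then show ?thesis by (simp add: o_def)
qed

text \<open>Compactness of \<open>K\<close> makes the continuity of \<open>k\<close> in its first
  argument uniform in the second, so the integrands are uniformly close and the finite mass of the
  weighted measure does the rest.\<close>

lemma continuous_on_kernel_integral:
  fixes k :: "'a::euclidean_space \<Rightarrow> 'b \<Rightarrow> 'c::euclidean_space"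
  assumes cont: "continuous_on (X \<times> K) (\<lambda>(x, y). k x y)"
  shows "continuous_on X (\<lambda>x. \<integral>y. g y *\<^sub>R k x y \<partial>M)"
  unfolding continuous_on_iff
proof (intro ballI allI impI)
  fix x e :: "_" assume x: "x \<in> X" and e: "(0::real) < e"
  define L where "L = \<bar>B\<bar> * measure M K"
  have L: "L \<ge> 0" by (simp add: L_def)
  \<comment> \<open>The summand 1 keeps the quotient meaningful for \<open>L = 0\<close>; the factor
    2 yields a strict inequality at the end.\<close>
  define e' where "e' = e / (2 * (L + 1))"
  have e': "e' > 0" and Le: "L * e' < e"
  proof -
    show "e' > 0" using e L by (simp add: e'_def)
    then have "L * e' \<le> (L + 1) * e'" by (simp add: algebra_simps)
    also have "\<dots> = e / 2" using L by (simp add: e'_def field_simps)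
    finally show "L * e' < e" using e by simp
  qed
  obtain X0 where X0: "x \<in> X0" "open X0"
    and d: "\<forall>z\<in>X0 \<inter> X. \<forall>t\<in>K. dist (case (z, t) of (x, y) \<Rightarrow> k x y) (case (x, t) of (x, y) \<Rightarrow> k x y) \<le> e'"
    using continuous_on_prod_compactE[OF cont compact_K x e'] by metis
  obtain r where r: "r > 0" "ball x r \<subseteq> X0"
    using X0 open_contains_ball by blast
  show "\<exists>d>0. \<forall>x'\<in>X. dist x' x < d \<longrightarrow> dist (\<integral>y. g y *\<^sub>R k x' y \<partial>M) (\<integral>y. g y *\<^sub>R k x y \<partial>M) < e"
  proof (intro exI[of _ r] conjI ballI impI)
    fix z assume z: "z \<in> X" "dist z x < r"
    then have zX: "z \<in> X0 \<inter> X" using r(2) by (auto simp: dist_commute)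
    have c: "continuous_on K (k z)" "continuous_on K (k x)"
      using continuous_on_slice[OF cont] z x by auto
    have "(\<integral>y. g y *\<^sub>R k z y \<partial>M) - (\<integral>y. g y *\<^sub>R k x y \<partial>M) = (\<integral>y. g y *\<^sub>R (k z y - k x y) \<partial>M)"
      using integrable_weighted[OF c(1)] integrable_weighted[OF c(2)]
      by (simp add: scaleR_diff_right)
    also have "norm \<dots> \<le> L * e'"
      unfolding L_def
      by (rule norm_integral_weighted_le) (use c d zX in \<open>auto intro!: continuous_intros simp: dist_norm\<close>)
    finally show "dist (\<integral>y. g y *\<^sub>R k z y \<partial>M) (\<integral>y. g y *\<^sub>R k x y \<partial>M) < e"
      using Le by (simp add: dist_norm)
  qed (use r in auto)
qed

text \<open>Near \<open>x\<close> the gradients \<open>k' u y\<close> differ from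
  \<open>k' x y\<close> by at most \<open>e'\<close>, uniformly in \<open>y\<close>. The mean value
  inequality then bounds the linearisation error by \<open>e' * norm (z - x)\<close> for all
  \<open>y\<close> at once, and this bound is integrated.\<close>

lemma has_derivative_kernel_integral:
  fixes k :: "'a::euclidean_space \<Rightarrow> 'b \<Rightarrow> real" and k' :: "'a \<Rightarrow> 'b \<Rightarrow> 'a"
  assumes X: "open X" and x: "x \<in> X"
    and cont: "continuous_on (X \<times> K) (\<lambda>(x, y). k x y)"
    and cont': "continuous_on (X \<times> K) (\<lambda>(x, y). k' x y)"
    and deriv: "\<And>x y. x \<in> X \<Longrightarrow> y \<in> K \<Longrightarrow> ((\<lambda>x. k x y) has_derivative (\<lambda>h. k' x y \<bullet> h)) (at x)"
  shows "((\<lambda>x. \<integral>y. g y *\<^sub>R k x y \<partial>M) has_derivative (\<lambda>h. (\<integral>y. g y *\<^sub>R k' x y \<partial>M) \<bullet> h)) (at x)"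
  unfolding has_derivative_at_alt
proof (intro conjI allI impI bounded_linear_inner_right)
  fix e :: real assume e: "0 < e"
  define L where "L = \<bar>B\<bar> * measure M K"
  have L: "L \<ge> 0" by (simp add: L_def)
  define e' where "e' = e / (L + 1)"
  have e': "e' > 0" and Le: "L * e' \<le> e"
  proof -
    show "e' > 0" using e L by (simp add: e'_def)
    then have "L * e' \<le> (L + 1) * e'" by (simp add: algebra_simps)
    also have "\<dots> = e" using L by (simp add: e'_def field_simps)
    finally show "L * e' \<le> e" .
  qed
  obtain X0 where X0: "x \<in> X0" "open X0"
    and d: "\<forall>z\<in>X0 \<inter> X. \<forall>t\<in>K. dist (case (z, t) of (x, y) \<Rightarrow> k' x y) (case (x, t) of (x, y) \<Rightarrow> k' x y) \<le> e'"
    using continuous_on_prod_compactE[OF cont' compact_K x e'] by metis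
  obtain r where r: "r > 0" "ball x r \<subseteq> X0 \<inter> X"
    using X0 X x open_contains_ball[of "X0 \<inter> X"] by blast
  show "\<exists>d>0. \<forall>z. norm (z - x) < d \<longrightarrow>
       norm ((\<integral>y. g y *\<^sub>R k z y \<partial>M) - (\<integral>y. g y *\<^sub>R k x y \<partial>M) - (\<integral>y. g y *\<^sub>R k' x y \<partial>M) \<bullet> (z - x))
       \<le> e * norm (z - x)"
  proof (intro exI[of _ r] conjI allI impI)
    fix z assume z: "norm (z - x) < r"
    then have zb: "z \<in> ball x r" by (simp add: dist_norm norm_minus_commute)
    then have zX: "z \<in> X" using r by auto
    have c: "continuous_on K (k z)" "continuous_on K (k x)" "continuous_on K (k' x)"
      using continuous_on_slice[OF cont] continuous_on_slice[OF cont'] zX x by auto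
    note int = integrable_weighted[OF c(1)] integrable_weighted[OF c(2)] integrable_weighted[OF c(3)]
    have "(\<integral>y. g y *\<^sub>R k z y \<partial>M) - (\<integral>y. g y *\<^sub>R k x y \<partial>M) - (\<integral>y. g y *\<^sub>R k' x y \<partial>M) \<bullet> (z - x)
        = (\<integral>y. g y *\<^sub>R (k z y - k x y - k' x y \<bullet> (z - x)) \<partial>M)"
    proof -
      have "(\<integral>y. g y *\<^sub>R k' x y \<partial>M) \<bullet> (z - x) = (\<integral>y. g y *\<^sub>R (k' x y \<bullet> (z - x)) \<partial>M)"
        using integral_inner_left[OF int(3), of "z - x"] by simp
      moreover have "integrable M (\<lambda>y. g y *\<^sub>R (k' x y \<bullet> (z - x)))"
        by (rule integrable_weighted) (intro continuous_intros c)
      ultimately show ?thesis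
        using int(1,2) by (simp add: right_diff_distrib)
    qed
    also have "norm \<dots> \<le> L * (norm (z - x) * e')"
      unfolding L_def
    proof (rule norm_integral_weighted_le)
      show "continuous_on K (\<lambda>y. k z y - k x y - k' x y \<bullet> (z - x))"
        by (intro continuous_intros c)
      fix y assume y: "y \<in> K"
      show "norm (k z y - k x y - k' x y \<bullet> (z - x)) \<le> norm (z - x) * e'"
      proof (rule differentiable_bound_linearization[where S = "ball x r" and f' = "\<lambda>u h. k' u y \<bullet> h"])
        show "x + t *\<^sub>R (z - x) \<in> ball x r" if "t \<in> {0..1}" for t
        proof -
          have "norm (t *\<^sub>R (z - x)) \<le> norm (z - x)" using that by (simp add: mult_left_le_one_le)
          then show ?thesis using z by (simp add: dist_norm)
        qed
        show "((\<lambda>x. k x y) has_derivative (\<bullet>) (k' u y)) (at u within ball x r)" if "u \<in> ball x r" for u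
          by (rule has_derivative_at_withinI[OF deriv[OF _ y]]) (use that r in auto)
        show "onorm ((\<bullet>) (k' u y) - (\<bullet>) (k' x y)) \<le> e'" if "u \<in> ball x r" for u
        proof (rule onorm_le)
          fix h
          have "u \<in> X0 \<inter> X" using that r(2) by blast
          then have "norm (k' u y - k' x y) \<le> e'" using d y by (auto simp: dist_norm)
          then show "norm (((\<bullet>) (k' u y) - (\<bullet>) (k' x y)) h) \<le> e' * norm h"
            using Cauchy_Schwarz_ineq2[of "k' u y - k' x y" h] mult_right_mono[of "norm (k' u y - k' x y)" e' "norm h"]
            by (auto simp: inner_diff_left)
        qed
      qed (use r in auto)
    qed
    also have "\<dots> \<le> e * norm (z - x)"
      using mult_right_mono[OF Le, of "norm (z - x)"] by (simp add: mult_ac)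
    finally show "norm ((\<integral>y. g y *\<^sub>R k z y \<partial>M) - (\<integral>y. g y *\<^sub>R k x y \<partial>M) - (\<integral>y. g y *\<^sub>R k' x y \<partial>M) \<bullet> (z - x))
       \<le> e * norm (z - x)" .
  qed (use r in auto)
qed

end

subsection \<open>The uniform measure on the sphere\<close>

lemma ennreal_mult_right_cancel:
  fixes a b c :: ennreal
  assumes "a * c = b * c" "c \<noteq> 0" "c \<noteq> top"
  shows "a = b"
  using assms mult_divide_eq_ennreal by metis

text \<open>The image measure is again translation invariant, because \<open>T\<close> is linear and
  onto, and it agrees with Lebesgue measure on the unit ball. The uniqueness argument for Haar
  measure then identifies the two.\<close>

lemma lborel_distr_orthogonal:
  fixes T :: "'a::euclidean_space \<Rightarrow> 'a"
  assumes T: "orthogonal_transformation T"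
  shows "distr lborel borel T = (lborel :: 'a measure)"
proof -
  have lin: "linear T" using T by (simp add: orthogonal_transformation_linear)
  have Tm [measurable]: "T \<in> borel_measurable borel"
    by (intro borel_measurable_continuous_onI linear_continuous_on)
       (use lin linear_conv_bounded_linear in blast)
  define \<mu> where "\<mu> = distr lborel borel T"
  have sets_mu [simp, measurable_cong]: "sets \<mu> = sets borel" by (simp add: \<mu>_def)
  have space_mu [simp]: "space \<mu> = UNIV" by (simp add: \<mu>_def)
  have mu_ball: "emeasure \<mu> (ball 0 1) = emeasure lborel (ball (0::'a) 1)"
  proof -
    have "T -` ball 0 1 = ball 0 1"
      using orthogonal_transformation_norm[OF T] by (auto simp: dist_norm)
    then show ?thesis by (simp add: \<mu>_def emeasure_distr)
  qed
  have trans_leb: "(\<integral>\<^sup>+y. f (y + a) \<partial>lborel) = (\<integral>\<^sup>+y. f y \<partial>lborel)"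
    if [measurable]: "f \<in> borel_measurable borel" for f :: "'a \<Rightarrow> ennreal" and a
    using lborel_affine[of 1 a] nn_integral_distr[of "\<lambda>x. a + x" lborel borel f]
    by (simp add: density_1 add.commute)
  have trans_mu: "(\<integral>\<^sup>+y. f (y + a) \<partial>\<mu>) = (\<integral>\<^sup>+y. f y \<partial>\<mu>)"
    if [measurable]: "f \<in> borel_measurable borel" for f :: "'a \<Rightarrow> ennreal" and a
  proof -
    obtain b where b: "a = T b"
      using orthogonal_transformation_surj[OF T] by (metis surj_def)
    have "(\<integral>\<^sup>+y. f (y + a) \<partial>\<mu>) = (\<integral>\<^sup>+y. f (T (y + b)) \<partial>lborel)"
      by (simp add: \<mu>_def nn_integral_distr b linear_add[OF lin])
    also have "\<dots> = (\<integral>\<^sup>+y. f (T y) \<partial>lborel)"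
      by (rule trans_leb[of "\<lambda>y. f (T y)"]) simp
    finally show ?thesis by (simp add: \<mu>_def nn_integral_distr)
  qed
  \<comment> \<open>\<open>T\<close> preserves centred balls, so they have finite image measure and
    exhaust the space; Fubini needs this.\<close>
  have sf_mu: "sigma_finite_measure \<mu>"
  proof
    have "emeasure \<mu> (ball 0 (real n)) \<noteq> \<infinity>" for n
    proof -
      have "T -` ball 0 (real n) = ball 0 (real n)"
        using orthogonal_transformation_norm[OF T] by (auto simp: dist_norm)
      then show ?thesis
        using emeasure_lborel_ball_finite[of "0::'a" "real n"] by (simp add: \<mu>_def emeasure_distr)
    qed
    moreover have "(\<Union>n. ball (0::'a) (real n)) = UNIV"
      using reals_Archimedean2 by auto
    ultimately show "\<exists>A. countable A \<and> A \<subseteq> sets \<mu> \<and> \<Union> A = space \<mu> \<and> (\<forall>a\<in>A. emeasure \<mu> a \<noteq> \<infinity>)"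
      by (intro exI[of _ "range (\<lambda>n. ball 0 (real n))"]) auto
  qed
  interpret pair_sigma_finite \<mu> "lborel :: 'a measure"
    by (rule pair_sigma_finite.intro[OF sf_mu sigma_finite_lborel])
  have "emeasure \<mu> A = emeasure lborel A" if A [measurable]: "A \<in> sets borel" for A
  proof -
    let ?f = "indicator A :: 'a \<Rightarrow> ennreal"
    define g :: "'a \<Rightarrow> ennreal" where "g = indicator (ball 0 1)"
    have [measurable]: "g \<in> borel_measurable borel"
      unfolding g_def by (rule borel_measurable_indicator) simp
    have inner: "(\<integral>\<^sup>+y. ?f x * g (y + - x) \<partial>lborel) = ?f x * emeasure lborel (ball (0::'a) 1)" for x
    proof -
      have "(\<integral>\<^sup>+y. ?f x * g (y + - x) \<partial>lborel) = ?f x * (\<integral>\<^sup>+y. g (y + - x) \<partial>lborel)"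
        by (rule nn_integral_cmult) measurable
      also have "(\<integral>\<^sup>+y. g (y + - x) \<partial>lborel) = (\<integral>\<^sup>+y. g y \<partial>lborel)"
        by (rule trans_leb) measurable
      finally show ?thesis by (simp add: g_def)
    qed
    \<comment> \<open>The double integral of \<open>?f x * g (y - x)\<close> is evaluated in both
      orders. Shifting \<open>y\<close> first gives the left side; shifting \<open>x\<close> by
      \<open>y\<close> under \<mu> and then integrating over \<open>y\<close> gives the measure of
      \<open>A\<close> times the \<mu>-mass of the ball, since \<open>g\<close> is even.\<close>
    have "emeasure \<mu> A * emeasure lborel (ball (0::'a) 1) = (\<integral>\<^sup>+x. ?f x * emeasure lborel (ball (0::'a) 1) \<partial>\<mu>)"
      by (simp add: nn_integral_multc)
    also have "\<dots> = (\<integral>\<^sup>+x. \<integral>\<^sup>+y. ?f x * g (y + - x) \<partial>lborel \<partial>\<mu>)"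
      by (simp only: inner)
    also have "\<dots> = (\<integral>\<^sup>+y. \<integral>\<^sup>+x. ?f x * g (y + - x) \<partial>\<mu> \<partial>lborel)"
      by (rule Fubini'[symmetric]) measurable
    also have "\<dots> = (\<integral>\<^sup>+y. \<integral>\<^sup>+x. ?f (x + y) * g (- x) \<partial>\<mu> \<partial>lborel)"
    proof (rule nn_integral_cong)
      fix y :: 'a
      show "(\<integral>\<^sup>+x. ?f x * g (y + - x) \<partial>\<mu>) = (\<integral>\<^sup>+x. ?f (x + y) * g (- x) \<partial>\<mu>)"
        using trans_mu[of "\<lambda>x. ?f x * g (y + - x)" y] by simp
    qed
    also have "\<dots> = (\<integral>\<^sup>+x. \<integral>\<^sup>+y. ?f (x + y) * g (- x) \<partial>lborel \<partial>\<mu>)"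
      by (rule Fubini') measurable
    also have "\<dots> = (\<integral>\<^sup>+x. emeasure lborel A * g (- x) \<partial>\<mu>)"
    proof (rule nn_integral_cong)
      fix x :: 'a
      show "(\<integral>\<^sup>+y. ?f (x + y) * g (- x) \<partial>lborel) = emeasure lborel A * g (- x)"
        using trans_leb[of ?f x] by (simp add: nn_integral_multc add.commute)
    qed
    also have "\<dots> = emeasure lborel A * (\<integral>\<^sup>+x. g (- x) \<partial>\<mu>)"
      by (simp add: nn_integral_cmult)
    also have "(\<integral>\<^sup>+x. g (- x) \<partial>\<mu>) = (\<integral>\<^sup>+x. g x \<partial>\<mu>)"
      by (intro nn_integral_cong) (simp add: g_def indicator_def)
    also have "\<dots> = emeasure lborel (ball (0::'a) 1)" by (simp add: g_def mu_ball)
    finally have "emeasure \<mu> A * emeasure lborel (ball (0::'a) 1) = emeasure lborel A * emeasure lborel (ball (0::'a) 1)" .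
    moreover have "emeasure lborel (ball (0::'a) 1) \<noteq> 0" "emeasure lborel (ball (0::'a) 1) \<noteq> \<infinity>"
      by (auto simp: emeasure_ball less_imp_neq[OF unit_ball_vol_pos, symmetric])
    ultimately show ?thesis
      by (auto intro: ennreal_mult_right_cancel)
  qed
  then show ?thesis
    by (intro measure_eqI) (simp_all flip: \<mu>_def)
qed

lemma orthogonal_transformation_swap:
  fixes a b :: "'a::euclidean_space"
  assumes "norm a = norm b"
  obtains T where "orthogonal_transformation T" "T a = b" "\<And>c. c \<bullet> a = 0 \<Longrightarrow> c \<bullet> b = 0 \<Longrightarrow> T c = c"
proof -
  define v where "v = a - b"
  \<comment> \<open>The Householder reflection in the hyperplane orthogonal to \<open>a - b\<close>;
    for \<open>a = b\<close> it degenerates to the identity.\<close>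
  define T where "T x = x - (2 * (v \<bullet> x) / (v \<bullet> v)) *\<^sub>R v" for x
  have "T x \<bullet> T y = x \<bullet> y" for x y
    by (cases "v = 0") (auto simp: T_def inner_diff_left inner_diff_right inner_commute field_simps)
  moreover have "linear T"
    by (rule linearI) (auto simp: T_def inner_add_right add_divide_distrib algebra_simps)
  ultimately have "orthogonal_transformation T" by (simp add: orthogonal_transformation_def)
  moreover have "T a = b"
  proof (cases "v = 0")
    case False
    have "v \<bullet> v = 2 * (v \<bullet> a)"
      using assms by (simp add: v_def inner_diff_left inner_diff_right inner_commute norm_eq_sqrt_inner)
    moreover have "v \<bullet> v \<noteq> 0" using False by simp
    ultimately have "2 * (v \<bullet> a) / (v \<bullet> v) = 1" by (metis divide_self)
    then show ?thesis by (simp only: T_def) (simp add: v_def)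
  qed (simp add: T_def v_def)
  moreover have "T c = c" if "c \<bullet> a = 0" "c \<bullet> b = 0" for c
  proof -
    have "v \<bullet> c = 0" using that by (simp add: v_def inner_diff_left inner_commute[of c])
    then show ?thesis by (simp add: T_def)
  qed
  ultimately show thesis using that by blast
qed

text \<open>Two reflections suffice: the first takes \<open>u\<close> to \<open>a\<close>; the
  second takes the image of \<open>e\<close> to \<open>b\<close> and fixes \<open>a\<close>, which
  is orthogonal to both of these.\<close>

lemma orthogonal_transformation_pair:
  fixes u e a b :: "'a::euclidean_space"
  assumes "norm u = 1" "norm e = 1" "u \<bullet> e = 0" "norm a = 1" "norm b = 1" "a \<bullet> b = 0"
  obtains T where "orthogonal_transformation T" "T u = a" "T e = b"
proof -
  obtain S where S: "orthogonal_transformation S" "S u = a"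
    using orthogonal_transformation_swap[of u a] assms by metis
  have ae: "a \<bullet> S e = 0"
    using S assms by (metis orthogonal_transformation_def)
  have "norm (S e) = norm b"
    using S assms by (simp add: orthogonal_transformation_norm)
  then obtain R where R: "orthogonal_transformation R" "R (S e) = b" "R a = a"
    using orthogonal_transformation_swap[of "S e" b] ae assms(6) by metis
  show thesis
    by (rule that[of "R \<circ> S"]) (use S R in \<open>auto intro: orthogonal_transformation_compose\<close>)
qed

text \<open>The exceptional value at the origin only serves to make the projection map into the sphere everywhere.\<close>

definition sphere_measure :: "'a::euclidean_space measure" where
  "sphere_measure = distr (uniform_measure lborel (ball 0 1)) (restrict_space borel (sphere 0 1))
     (\<lambda>y. if y = 0 then SOME b. b \<in> Basis else sgn y)"

lemma measurable_sphere_projection: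
  "(\<lambda>y. if y = 0 then SOME b. b \<in> Basis else sgn y)
     \<in> borel \<rightarrow>\<^sub>M restrict_space borel (sphere 0 (1::real) :: 'a::euclidean_space set)"
proof (rule measurable_restrict_space2)
  have "(SOME b::'a. b \<in> Basis) \<in> Basis" by (rule someI_ex) (use nonempty_Basis in blast)
  then show "(\<lambda>y::'a. if y = 0 then SOME b. b \<in> Basis else sgn y) \<in> space borel \<rightarrow> sphere 0 1"
    by (auto simp: norm_sgn)
qed (simp add: sgn_div_norm)

lemma sets_sphere_measure [measurable_cong, simp]:
  "sets sphere_measure = sets (restrict_space borel (sphere 0 1))"
  by (simp add: sphere_measure_def)

lemma space_sphere_measure [simp]: "space sphere_measure = sphere 0 1"
  by (simp add: sphere_measure_def space_restrict_space)

lemma emeasure_unit_ball_nonzero: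
  "emeasure lborel (ball (0::'a::euclidean_space) 1) \<noteq> 0" "emeasure lborel (ball (0::'a) 1) \<noteq> \<infinity>"
  by (auto simp: emeasure_ball less_imp_neq[OF unit_ball_vol_pos, symmetric])

lemma emeasure_sphere_measure_space: "emeasure sphere_measure (sphere 0 1 :: 'a::euclidean_space set) = 1"
proof -
  define h :: "'a \<Rightarrow> 'a" where "h = (\<lambda>y. if y = 0 then SOME b. b \<in> Basis else sgn y)"
  have h: "h \<in> borel \<rightarrow>\<^sub>M restrict_space borel (sphere 0 1)"
    unfolding h_def by (rule measurable_sphere_projection)
  have "h -` sphere 0 1 = UNIV"
    using measurable_space[OF h] by (auto simp: space_restrict_space)
  moreover have "h \<in> uniform_measure lborel (ball 0 1) \<rightarrow>\<^sub>M restrict_space borel (sphere 0 1)"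
    using h by (subst measurable_cong_sets[OF _ refl]) auto
  moreover have "sphere (0::'a) 1 \<in> sets (restrict_space borel (sphere 0 1))"
    using sets.top[of "restrict_space borel (sphere (0::'a) 1)"] by (simp add: space_restrict_space)
  ultimately show ?thesis
    using emeasure_uniform_measure_1[of lborel "ball (0::'a) 1"] emeasure_unit_ball_nonzero[where 'a = 'a]
    unfolding sphere_measure_def h_def[symmetric] by (simp add: emeasure_distr)
qed

lemma finite_measure_sphere_measure: "finite_measure (sphere_measure :: 'a::euclidean_space measure)"
  by (rule finite_measureI) (simp add: emeasure_sphere_measure_space)

lemma measure_sphere_measure_space: "measure sphere_measure (sphere 0 1 :: 'a::euclidean_space set) = 1"
  by (simp add: measure_def emeasure_sphere_measure_space)

text \<open>The exceptional value of the projection disappears because the origin is a null set. The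
  volume is multiplied out so that later comparisons avoid division of extended reals.\<close>

lemma nn_integral_sphere_measure:
  fixes f :: "'a::euclidean_space \<Rightarrow> ennreal"
  assumes f: "f \<in> borel_measurable borel"
  shows "(\<integral>\<^sup>+y. f y \<partial>sphere_measure) * ennreal (unit_ball_vol DIM('a)) =
    (\<integral>\<^sup>+y. f (sgn y) * indicator (ball 0 1) y \<partial>lborel)"
proof -
  note [measurable] = f
  define h :: "'a \<Rightarrow> 'a" where "h = (\<lambda>y. if y = 0 then SOME b. b \<in> Basis else sgn y)"
  have h [measurable]: "h \<in> borel \<rightarrow>\<^sub>M restrict_space borel (sphere 0 1)"
    unfolding h_def by (rule measurable_sphere_projection)
  have hb [measurable]: "h \<in> borel_measurable borel"
    using h by (simp add: measurable_restrict_space2_iff)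
  have sm: "sphere_measure = distr (uniform_measure lborel (ball 0 1)) (restrict_space borel (sphere 0 1)) h"
    by (simp add: sphere_measure_def h_def)
  have vol: "ennreal (unit_ball_vol DIM('a)) = emeasure lborel (ball (0::'a) 1)"
    by (simp add: emeasure_ball)
  have "(\<integral>\<^sup>+y. f y \<partial>sphere_measure) = (\<integral>\<^sup>+y. f (h y) \<partial>uniform_measure lborel (ball 0 1))"
    unfolding sm by (rule nn_integral_distr) (auto intro: measurable_restrict_space1)
  also have "\<dots> = (\<integral>\<^sup>+y. f (h y) * indicator (ball 0 1) y \<partial>lborel) / emeasure lborel (ball (0::'a) 1)"
    by (rule nn_integral_uniform_measure) auto
  also have "(\<integral>\<^sup>+y. f (h y) * indicator (ball 0 1) y \<partial>lborel) = (\<integral>\<^sup>+y. f (sgn y) * indicator (ball 0 1) y \<partial>lborel)"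
    by (intro nn_integral_cong_AE eventually_mono[OF AE_lborel_singleton[of 0]]) (simp add: h_def)
  finally show ?thesis
    using emeasure_unit_ball_nonzero[where 'a = 'a] unfolding vol
    by (simp add: ennreal_divide_times ennreal_divide_self less_top)
qed

text \<open>Orthogonal maps commute with \<open>sgn\<close> and preserve the ball, so the claim is
  inherited from Lebesgue measure.\<close>

lemma sphere_measure_orthogonal:
  fixes T :: "'a::euclidean_space \<Rightarrow> 'a"
  assumes T: "orthogonal_transformation T" and f: "f \<in> borel_measurable borel"
  shows "(\<integral>\<^sup>+y. f (T y) \<partial>sphere_measure) = (\<integral>\<^sup>+y. f y \<partial>sphere_measure)"
proof -
  note [measurable] = f
  have lin: "linear T" using T by (simp add: orthogonal_transformation_linear)
  have Tm [measurable]: "T \<in> borel_measurable borel"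
    by (intro borel_measurable_continuous_onI linear_continuous_on)
       (use lin linear_conv_bounded_linear in blast)
  have Ts: "T (sgn y) = sgn (T y)" for y
    using orthogonal_transformation_norm[OF T, of y] by (simp add: sgn_div_norm linear_scale[OF lin])
  have [measurable]: "(indicator (ball 0 1) :: 'a \<Rightarrow> ennreal) \<in> borel_measurable borel"
    by (rule borel_measurable_indicator) simp
  have m: "(\<lambda>y. f (sgn y) * indicator (ball 0 1) y) \<in> borel_measurable borel"
    unfolding sgn_div_norm by measurable
  have "(\<integral>\<^sup>+y. f (T y) \<partial>sphere_measure) * ennreal (unit_ball_vol DIM('a))
      = (\<integral>\<^sup>+y. f (sgn (T y)) * indicator (ball 0 1) (T y) \<partial>lborel)"
    using orthogonal_transformation_norm[OF T]
    by (subst nn_integral_sphere_measure) (auto simp: Ts indicator_def intro!: nn_integral_cong)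
  also have "\<dots> = (\<integral>\<^sup>+y. f (sgn y) * indicator (ball 0 1) y \<partial>distr lborel borel T)"
    using m by (simp add: nn_integral_distr)
  also have "\<dots> = (\<integral>\<^sup>+y. f y \<partial>sphere_measure) * ennreal (unit_ball_vol DIM('a))"
    by (simp add: lborel_distr_orthogonal[OF T] nn_integral_sphere_measure[OF f])
  finally show ?thesis
    by (rule ennreal_mult_right_cancel)
       (use unit_ball_vol_pos[of "real DIM('a)"] in \<open>auto simp: ennreal_eq_0_iff not_le simp del: unit_ball_vol_pos\<close>)
qed

subsection \<open>The Poisson kernel\<close>

lemma partial_eqI:
  assumes "(f has_derivative f') (at x)"
  shows "partial i f x = f' i"
  using frechet_derivative_at[OF assms] by (simp add: partial_def)

lemma C1_onI:
  assumes S: "open S" and d: "\<And>x. x \<in> S \<Longrightarrow> (f has_derivative (\<lambda>h. G x \<bullet> h)) (at x)"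
    and c: "continuous_on S G"
  shows "C1_on S f"
  unfolding C1_on_def
proof (intro conjI ballI)
  show "f differentiable at x" if "x \<in> S" for x
    using d[OF that] by (auto simp: differentiable_def)
  show "continuous_on S (partial i f)" for i
    by (rule continuous_on_eq[where f = "\<lambda>x. G x \<bullet> i"]) (use c partial_eqI[OF d] in \<open>auto intro!: continuous_intros\<close>)
qed

text \<open>\<open>partial i f\<close> is a total function, while derivative formulas are available
  only on \<open>S\<close>. Openness of \<open>S\<close> allows such a formula to be differentiated
  again in place of \<open>partial i f\<close>.\<close>

lemma C1_on_cong:
  assumes S: "open S" and eq: "\<And>x. x \<in> S \<Longrightarrow> f x = g x" and f: "C1_on S f"
  shows "C1_on S g" and "x \<in> S \<Longrightarrow> partial i g x = partial i f x"
proof -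
  have d: "(g has_derivative frechet_derivative f (at x)) (at x)" if "x \<in> S" for x
  proof (rule has_derivative_transform_within_open[OF _ S that])
    show "(f has_derivative frechet_derivative f (at x)) (at x)"
      using f that by (simp add: C1_on_def frechet_derivative_works)
  qed (use eq in auto)
  have p: "partial i g x = partial i f x" if "x \<in> S" for x i
    using partial_eqI[OF d[OF that]] by (simp add: partial_def)
  show "C1_on S g"
    unfolding C1_on_def
  proof (intro conjI ballI)
    show "g differentiable at x" if "x \<in> S" for x using d[OF that] by (auto simp: differentiable_def)
    show "continuous_on S (partial i g)" if "i \<in> Basis" for i
      by (rule continuous_on_eq[where f = "partial i f"]) (use f that p in \<open>auto simp: C1_on_def\<close>)
  qed
  show "x \<in> S \<Longrightarrow> partial i g x = partial i f x" by (rule p)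
qed

lemma harmonic_onI:
  fixes f :: "'a::euclidean_space \<Rightarrow> real"
  assumes S: "open S" and d: "\<And>x. x \<in> S \<Longrightarrow> (f has_derivative (\<lambda>h. G x \<bullet> h)) (at x)"
    and d2: "\<And>x i. x \<in> S \<Longrightarrow> i \<in> Basis \<Longrightarrow> ((\<lambda>x. G x \<bullet> i) has_derivative (\<lambda>h. H i x \<bullet> h)) (at x)"
    and c: "\<And>i. i \<in> Basis \<Longrightarrow> continuous_on S (H i)"
    and z: "\<And>x. x \<in> S \<Longrightarrow> (\<Sum>i\<in>Basis. H i x \<bullet> i) = 0"
  shows "harmonic_on S f"
proof -
  have cG: "continuous_on S G"
  proof (subst continuous_on_componentwise, intro ballI)
    fix i :: 'a assume i: "i \<in> Basis"
    show "continuous_on S (\<lambda>x. G x \<bullet> i)"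
      using d2[OF _ i] S by (intro continuous_at_imp_continuous_on ballI has_derivative_continuous)
  qed
  have G1: "C1_on S (\<lambda>x. G x \<bullet> i)" if "i \<in> Basis" for i
    by (rule C1_onI[OF S d2[OF _ that] c[OF that]])
  have eq: "G x \<bullet> i = partial i f x" if "x \<in> S" for x i
    using partial_eqI[OF d[OF that]] by simp
  have "C2_on S f"
    unfolding C2_on_def using C1_onI[OF S d cG] C1_on_cong(1)[OF S eq G1] by blast
  moreover have "laplacian f x = 0" if x: "x \<in> S" for x
  proof -
    have "partial i (partial i f) x = H i x \<bullet> i" if "i \<in> Basis" for i
      using C1_on_cong(2)[OF S eq G1[OF that] x, of i] partial_eqI[OF d2[OF x that], of i] by simp
    then show ?thesis using z[OF x] by (simp add: laplacian_def)
  qed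
  ultimately show ?thesis by (simp add: harmonic_on_def)
qed

text \<open>The kernel (1 - |x|^2) / |y - x|^n, normalised for a probability measure. Writing the
  distance as a real power of an inner product gives derivatives of the same form.\<close>

definition poisson :: "'a::euclidean_space \<Rightarrow> 'a \<Rightarrow> real" where
  "poisson x y = (1 - x \<bullet> x) * ((y - x) \<bullet> (y - x)) powr (- real DIM('a) / 2)"

definition poisson_grad :: "'a::euclidean_space \<Rightarrow> 'a \<Rightarrow> 'a" where
  "poisson_grad x y = (- 2 * ((y - x) \<bullet> (y - x)) powr (- real DIM('a) / 2)) *\<^sub>R x +
     (real DIM('a) * (1 - x \<bullet> x) * ((y - x) \<bullet> (y - x)) powr (- real DIM('a) / 2 - 1)) *\<^sub>R (y - x)"

text \<open>Row \<open>i\<close> of the Hessian in \<open>x\<close>, that is, the gradient of the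
  \<open>i\<close>-th component of \<open>poisson_grad\<close>.\<close>

definition poisson_hess :: "'a::euclidean_space \<Rightarrow> 'a \<Rightarrow> 'a \<Rightarrow> 'a" where
  "poisson_hess i x y = (let n = real DIM('a); N = (y - x) \<bullet> (y - x) in
     (- 2 * N powr (- n / 2) - n * (1 - x \<bullet> x) * N powr (- n / 2 - 1)) *\<^sub>R i
     - (2 * n * ((y - x) \<bullet> i) * N powr (- n / 2 - 1)) *\<^sub>R x
     + (n * (n + 2) * (1 - x \<bullet> x) * ((y - x) \<bullet> i) * N powr (- n / 2 - 2)
        - 2 * n * (x \<bullet> i) * N powr (- n / 2 - 1)) *\<^sub>R (y - x))"

lemma has_derivative_powr_dist:
  fixes x y :: "'a::euclidean_space"
  assumes "x \<noteq> y"
  shows "((\<lambda>x. ((y - x) \<bullet> (y - x)) powr a) has_derivative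
      (\<lambda>h. - 2 * a * ((y - x) \<bullet> (y - x)) powr (a - 1) * ((y - x) \<bullet> h))) (at x)"
proof -
  have N: "(y - x) \<bullet> (y - x) > 0" using assms by simp
  have "((\<lambda>x. ((y - x) \<bullet> (y - x)) powr a) has_derivative
      (\<lambda>h. ((y - x) \<bullet> (y - x)) powr a * (0 * ln ((y - x) \<bullet> (y - x)) + (- ((y - x) \<bullet> h + h \<bullet> (y - x))) * a / ((y - x) \<bullet> (y - x))))) (at x)"
    by (rule has_derivative_powr) (use N in \<open>auto intro!: derivative_eq_intros simp: algebra_simps inner_commute\<close>)
  moreover have "((y - x) \<bullet> (y - x)) powr a * (0 * ln ((y - x) \<bullet> (y - x)) + (- ((y - x) \<bullet> h + h \<bullet> (y - x))) * a / ((y - x) \<bullet> (y - x)))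
     = - 2 * a * ((y - x) \<bullet> (y - x)) powr (a - 1) * ((y - x) \<bullet> h)" for h
    using N unfolding powr_diff by (simp add: inner_commute[of h])
  ultimately show ?thesis by simp
qed

lemma poisson_has_derivative:
  fixes x y :: "'a::euclidean_space"
  assumes "x \<noteq> y"
  shows "((\<lambda>x. poisson x y) has_derivative (\<lambda>h. poisson_grad x y \<bullet> h)) (at x)"
proof -
  define a where "a = - real DIM('a) / 2"
  define p where "p x = ((y - x) \<bullet> (y - x)) powr a" for x
  define q where "q = ((y - x) \<bullet> (y - x)) powr (a - 1)"
  have p: "(p has_derivative (\<lambda>h. - 2 * a * q * ((y - x) \<bullet> h))) (at x)"
    unfolding p_def q_def by (rule has_derivative_powr_dist[OF assms])
  have "((\<lambda>x. (1 - x \<bullet> x) * p x) has_derivative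
     (\<lambda>h. ((- 2 * p x) *\<^sub>R x + (- 2 * a * (1 - x \<bullet> x) * q) *\<^sub>R (y - x)) \<bullet> h)) (at x)"
    by (rule derivative_eq_intros refl p)+
       (simp add: fun_eq_iff inner_add_left inner_commute algebra_simps)
  moreover have "- 2 * a = real DIM('a)" by (simp add: a_def)
  ultimately show ?thesis
    by (simp add: poisson_def poisson_grad_def p_def q_def a_def)
qed

lemma poisson_grad_has_derivative:
  fixes x y :: "'a::euclidean_space"
  assumes "x \<noteq> y"
  shows "((\<lambda>x. poisson_grad x y \<bullet> i) has_derivative (\<lambda>h. poisson_hess i x y \<bullet> h)) (at x)"
proof -
  define n where "n = real DIM('a)"
  define p where "p x = ((y - x) \<bullet> (y - x)) powr (- n / 2)" for x
  define q where "q x = ((y - x) \<bullet> (y - x)) powr (- n / 2 - 1)" for x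
  define v where "v = y - x"
  define r where "r = ((y - x) \<bullet> (y - x)) powr (- n / 2 - 2)"
  have p: "(p has_derivative (\<lambda>h. n * q x * ((y - x) \<bullet> h))) (at x)"
    using has_derivative_powr_dist[OF assms, of "- n / 2"] by (simp add: p_def[abs_def] q_def)
  have e: "- n / 2 - 1 - 1 = - n / 2 - 2" by simp
  have "- 2 * (- n / 2 - 1) = n + 2" by simp
  then have q: "(q has_derivative (\<lambda>h. (n + 2) * r * ((y - x) \<bullet> h))) (at x)"
    using has_derivative_powr_dist[OF assms, of "- n / 2 - 1"] unfolding q_def[abs_def] r_def e by (simp add: add.commute)
  have "((\<lambda>x. (- 2 * p x) * (x \<bullet> i) + (n * (1 - x \<bullet> x) * q x) * ((y - x) \<bullet> i)) has_derivative
     (\<lambda>h. ((- 2 * p x - n * (1 - x \<bullet> x) * q x) *\<^sub>R i - (2 * n * ((y - x) \<bullet> i) * q x) *\<^sub>R x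
     + (n * (n + 2) * (1 - x \<bullet> x) * ((y - x) \<bullet> i) * r - 2 * n * (x \<bullet> i) * q x) *\<^sub>R (y - x)) \<bullet> h)) (at x)"
    apply (rule derivative_eq_intros refl p q)+
    apply (rule ext)
    unfolding v_def[symmetric] inner_add_left inner_diff_left[of "_ *\<^sub>R _" "_ *\<^sub>R _"] inner_scaleR_left
    subgoal for h
      by (simp add: inner_commute[of h] algebra_simps)
    done
  then show ?thesis
    unfolding poisson_grad_def poisson_hess_def Let_def n_def[symmetric] p_def q_def r_def
    by (simp only: inner_add_left inner_scaleR_left)
qed

text \<open>Up to the factor \<open>2 * n * N * P\<close> the trace is 1 - |x|^2 - |y - x|^2 - 2 x .
  (y - x) = 1 - |y|^2, which vanishes on the sphere.\<close>

lemma poisson_hess_trace: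
  fixes x y :: "'a::euclidean_space"
  assumes "x \<noteq> y" "norm y = 1"
  shows "(\<Sum>i\<in>Basis. poisson_hess i x y \<bullet> i) = 0"
proof -
  define n where "n = real DIM('a)"
  define N where "N = (y - x) \<bullet> (y - x)"
  \<comment> \<open>The lowest power that occurs; the other two are \<open>N * P\<close> and
    \<open>N * N * P\<close>, so the identity becomes polynomial.\<close>
  define P where "P = N powr (- n / 2 - 2)"
  have N: "N > 0" using assms by (simp add: N_def)
  have y1: "y \<bullet> y = 1" using assms by (simp add: dot_square_norm)
  have "1 + (- n / 2 - 2) = - n / 2 - 1" "2 + (- n / 2 - 2) = - n / 2" by simp_all
  then have P1: "N powr (- n / 2 - 1) = N * P" and P2: "N powr (- n / 2) = N * N * P"
    using N powr_add[of N 1 "- n / 2 - 2"] powr_add[of N 2 "- n / 2 - 2"]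
    by (simp_all only: P_def powr_one powr_numeral power2_eq_square)
  have s: "(\<Sum>i\<in>Basis. (a \<bullet> i) * (b \<bullet> i)) = a \<bullet> b" for a b :: 'a
    by (rule euclidean_inner[symmetric])
  have "(\<Sum>i\<in>Basis. poisson_hess i x y \<bullet> i) = (\<Sum>i\<in>Basis. (- 2 * (N * N * P) - n * (1 - x \<bullet> x) * (N * P))
     - (2 * n * (N * P)) * (((y - x) \<bullet> i) * (x \<bullet> i))
     + (n * (n + 2) * (1 - x \<bullet> x) * P) * (((y - x) \<bullet> i) * ((y - x) \<bullet> i))
     - (2 * n * (N * P)) * ((x \<bullet> i) * ((y - x) \<bullet> i)))"
  proof (intro sum.cong refl)
    fix i :: 'a assume i: "i \<in> Basis"
    define v where "v = y - x"
    have lin: "(a *\<^sub>R i - b *\<^sub>R x + c *\<^sub>R v) \<bullet> i = a * (i \<bullet> i) - b * (x \<bullet> i) + c * (v \<bullet> i)" for a b c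
      by (simp only: inner_add_left inner_diff_left inner_scaleR_left)
    have vv: "v \<bullet> v = N" by (simp add: v_def N_def)
    show "poisson_hess i x y \<bullet> i = (- 2 * (N * N * P) - n * (1 - x \<bullet> x) * (N * P))
     - (2 * n * (N * P)) * (((y - x) \<bullet> i) * (x \<bullet> i))
     + (n * (n + 2) * (1 - x \<bullet> x) * P) * (((y - x) \<bullet> i) * ((y - x) \<bullet> i))
     - (2 * n * (N * P)) * ((x \<bullet> i) * ((y - x) \<bullet> i))"
      unfolding poisson_hess_def Let_def v_def[symmetric] vv n_def[symmetric] P1 P2 P_def[symmetric] lin
      using i by (simp add: algebra_simps)
  qed
  also have "\<dots> = n * (- 2 * (N * N * P) - n * (1 - x \<bullet> x) * (N * P))
     - (2 * n * (N * P)) * ((y - x) \<bullet> x) + (n * (n + 2) * (1 - x \<bullet> x) * P) * N - (2 * n * (N * P)) * (x \<bullet> (y - x))"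
    by (simp only: sum.distrib sum_subtractf sum_distrib_left[symmetric] s N_def sum_constant n_def)
      (simp add: algebra_simps)
  also have "\<dots> = 2 * n * N * P * (1 - x \<bullet> x - N - 2 * (x \<bullet> (y - x)))"
    by (simp add: inner_commute algebra_simps)
  also have "1 - x \<bullet> x - N - 2 * (x \<bullet> (y - x)) = 0"
    unfolding N_def by (simp add: inner_diff_left inner_diff_right y1 inner_commute[of y x])
  finally show ?thesis by simp
qed

lemma sphere_ball_ne: "x \<in> ball 0 1 \<Longrightarrow> y \<in> sphere 0 1 \<Longrightarrow> x \<noteq> (y::'a::euclidean_space)"
  by auto

lemma continuous_on_poisson_kernels:
  shows "continuous_on (ball 0 1 \<times> sphere 0 1) (\<lambda>(x, y). poisson x (y::'a::euclidean_space))"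
    and "continuous_on (ball 0 1 \<times> sphere 0 1) (\<lambda>(x, y). poisson_grad x (y::'a))"
    and "continuous_on (ball 0 1 \<times> sphere 0 1) (\<lambda>(x, y). poisson_hess i x (y::'a))"
  unfolding poisson_def poisson_grad_def poisson_hess_def Let_def split_beta'
  by (intro continuous_intros; use sphere_ball_ne in force)+

section \<open>Poisson integrals of bounded data\<close>

definition poisson_integral :: "('a::euclidean_space \<Rightarrow> real) \<Rightarrow> 'a \<Rightarrow> real" where
  "poisson_integral g x = (\<integral>y. g y * poisson x y \<partial>sphere_measure)"

lemma compact_weighted_sphere:
  fixes g :: "'a::euclidean_space \<Rightarrow> real"
  assumes "g \<in> borel_measurable sphere_measure" "\<And>y. norm y = 1 \<Longrightarrow> \<bar>g y\<bar> \<le> B"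
  shows "compact_weighted_measure sphere_measure (sphere 0 1) g B"
  by (intro compact_weighted_measure.intro compact_weighted_measure_axioms.intro finite_measure_sphere_measure)
     (use assms in auto)

lemma poisson_integral_has_derivative:
  fixes g :: "'a::euclidean_space \<Rightarrow> real"
  assumes "g \<in> borel_measurable sphere_measure" "\<And>y. norm y = 1 \<Longrightarrow> \<bar>g y\<bar> \<le> B" and "x \<in> ball 0 1"
  shows "(poisson_integral g has_derivative (\<lambda>h. (\<integral>y. g y *\<^sub>R poisson_grad x y \<partial>sphere_measure) \<bullet> h)) (at x)"
proof -
  interpret compact_weighted_measure sphere_measure "sphere 0 1" g B
    by (rule compact_weighted_sphere[OF assms(1,2)])
  show ?thesis
    using has_derivative_kernel_integral[OF open_ball assms(3) continuous_on_poisson_kernels(1,2) poisson_has_derivative[OF sphere_ball_ne]]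
    by (simp add: poisson_integral_def[abs_def])
qed

text \<open>The data are only bounded and measurable because the extremal function has the
  discontinuous sign of the kernel as its data. Harmonicity is inherited from the kernel by
  differentiating twice under the integral.\<close>

proposition poisson_integral_harmonic:
  fixes g :: "'a::euclidean_space \<Rightarrow> real"
  assumes "g \<in> borel_measurable sphere_measure" "\<And>y. norm y = 1 \<Longrightarrow> \<bar>g y\<bar> \<le> B"
  shows "harmonic_on (ball 0 1) (poisson_integral g)"
proof -
  interpret compact_weighted_measure sphere_measure "sphere 0 1" g B
    by (rule compact_weighted_sphere[OF assms])
  show ?thesis
  proof (rule harmonic_onI[OF open_ball poisson_integral_has_derivative[OF assms]])
    fix x i :: 'a assume x: "x \<in> ball 0 1"
    have cg: "continuous_on (ball 0 1 \<times> sphere 0 1) (\<lambda>(x, y). poisson_grad x (y::'a) \<bullet> i)"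
      using continuous_on_poisson_kernels(2) unfolding split_beta' by (intro continuous_intros)
    have "((\<lambda>x. \<integral>y. g y *\<^sub>R (poisson_grad x y \<bullet> i) \<partial>sphere_measure) has_derivative
       (\<lambda>h. (\<integral>y. g y *\<^sub>R poisson_hess i x y \<partial>sphere_measure) \<bullet> h)) (at x)"
      by (rule has_derivative_kernel_integral[OF open_ball x cg continuous_on_poisson_kernels(3) poisson_grad_has_derivative[OF sphere_ball_ne]])
    then show "((\<lambda>x. (\<integral>y. g y *\<^sub>R poisson_grad x y \<partial>sphere_measure) \<bullet> i) has_derivative
       (\<lambda>h. (\<integral>y. g y *\<^sub>R poisson_hess i x y \<partial>sphere_measure) \<bullet> h)) (at x)"
    proof (rule has_derivative_transform_within_open[OF _ open_ball x])
      fix z :: 'a assume z: "z \<in> ball 0 1"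
      show "(\<integral>y. g y *\<^sub>R (poisson_grad z y \<bullet> i) \<partial>sphere_measure) = (\<integral>y. g y *\<^sub>R poisson_grad z y \<partial>sphere_measure) \<bullet> i"
        using integral_inner_left[OF integrable_weighted[OF continuous_on_slice[OF continuous_on_poisson_kernels(2) z]], of i] by simp
    qed
  next
    fix i :: 'a
    show "continuous_on (ball 0 1) (\<lambda>x. \<integral>y. g y *\<^sub>R poisson_hess i x y \<partial>sphere_measure)"
      by (rule continuous_on_kernel_integral[OF continuous_on_poisson_kernels(3)])
  next
    fix x :: 'a assume x: "x \<in> ball 0 1"
    have int: "integrable sphere_measure (\<lambda>y. g y *\<^sub>R poisson_hess i x y)" for i
      by (rule integrable_weighted[OF continuous_on_slice[OF continuous_on_poisson_kernels(3) x]])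
    have "(\<Sum>i\<in>Basis. (\<integral>y. g y *\<^sub>R poisson_hess i x y \<partial>sphere_measure) \<bullet> i) =
      (\<integral>y. (\<Sum>i\<in>Basis. (g y *\<^sub>R poisson_hess i x y) \<bullet> i) \<partial>sphere_measure)"
      using int by (subst Bochner_Integration.integral_sum) (auto simp del: inner_scaleR_left)
    also have "\<dots> = (\<integral>y. g y * (\<Sum>i\<in>Basis. poisson_hess i x y \<bullet> i) \<partial>sphere_measure)"
      by (simp add: sum_distrib_left)
    also have "\<dots> = (\<integral>y. 0 \<partial>(sphere_measure :: 'a measure))"
    proof (intro Bochner_Integration.integral_cong refl)
      fix y :: 'a assume "y \<in> space sphere_measure"
      then have "y \<in> sphere 0 1" by simp
      then show "g y * (\<Sum>i\<in>Basis. poisson_hess i x y \<bullet> i) = 0"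
        using poisson_hess_trace[OF sphere_ball_ne[OF x]] by simp
    qed
    finally show "(\<Sum>i\<in>Basis. (\<integral>y. g y *\<^sub>R poisson_hess i x y \<partial>sphere_measure) \<bullet> i) = 0" by simp
  qed
qed

subsection \<open>The maximum principle\<close>

text \<open>If \<open>D\<close> were positive, \<phi>' would be positive just to the right of its
  zero at 0, and the mean value theorem would give a value above the maximum.\<close>

lemma second_derivative_nonpos_at_max:
  fixes \<phi> \<phi>' :: "real \<Rightarrow> real"
  assumes d: "d > 0" and \<phi>: "\<And>t. \<bar>t\<bar> < d \<Longrightarrow> (\<phi> has_real_derivative \<phi>' t) (at t)"
    and D: "(\<phi>' has_real_derivative D) (at 0)" and max: "\<And>t. \<bar>t\<bar> < d \<Longrightarrow> \<phi> t \<le> \<phi> 0"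
  shows "D \<le> 0"
proof (rule ccontr)
  assume "\<not> D \<le> 0"
  then obtain e where e: "e > 0" "\<And>h. h > 0 \<Longrightarrow> h < e \<Longrightarrow> \<phi>' 0 < \<phi>' h"
    using DERIV_pos_inc_right[OF D] by auto
  have z: "\<phi>' 0 = 0"
    by (rule DERIV_local_max[OF \<phi> d]) (use d max in \<open>auto simp: abs_minus_commute\<close>)
  define h where "h = min d e / 2"
  have h: "0 < h" "h < d" "h < e" using d e(1) by (auto simp: h_def)
  obtain t where t: "0 < t" "t < h" "\<phi> h - \<phi> 0 = (h - 0) * \<phi>' t"
    using MVT2[of 0 h \<phi> \<phi>'] h \<phi> by auto
  have "\<phi>' t > 0" using e(2)[of t] t h z by auto
  then have "\<phi> h > \<phi> 0" using t h by (simp add: algebra_simps)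
  then show False using max[of h] h by auto
qed

section \<open>Calculus of harmonic functions\<close>

lemma frechet_derivative_eq_grad:
  fixes f :: "'a::euclidean_space \<Rightarrow> real"
  assumes "f differentiable (at x)"
  shows "frechet_derivative f (at x) h = grad f x \<bullet> h"
proof -
  have lin: "linear (frechet_derivative f (at x))"
    using assms by (simp add: linear_frechet_derivative)
  have "frechet_derivative f (at x) h = frechet_derivative f (at x) (\<Sum>i\<in>Basis. (h \<bullet> i) *\<^sub>R i)"
    by (simp add: euclidean_representation)
  also have "\<dots> = (\<Sum>i\<in>Basis. (h \<bullet> i) * frechet_derivative f (at x) i)"
    by (simp add: linear_sum[OF lin] linear_scale[OF lin])
  also have "\<dots> = grad f x \<bullet> h"
    by (simp add: grad_def partial_def inner_sum_left inner_commute[of h] mult.commute)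
  finally show ?thesis .
qed

lemma grad_inner_Basis: "i \<in> Basis \<Longrightarrow> grad f x \<bullet> i = partial i f x"
  by (simp add: grad_def)

lemma C1_onD:
  assumes "C1_on S f"
  shows "x \<in> S \<Longrightarrow> (f has_derivative (\<lambda>h. grad f x \<bullet> h)) (at x)" and "continuous_on S (grad f)"
proof -
  assume "x \<in> S"
  then have "f differentiable (at x)" using assms by (simp add: C1_on_def)
  then show "(f has_derivative (\<lambda>h. grad f x \<bullet> h)) (at x)"
    using frechet_derivative_eq_grad[of f x] frechet_derivative_works[of f "at x"] by presburger
next
  show "continuous_on S (grad f)"
    unfolding grad_def[abs_def] using assms by (intro continuous_intros) (auto simp: C1_on_def)
qed

lemma grad_eqI: "(f has_derivative (\<lambda>h. G \<bullet> h)) (at x) \<Longrightarrow> grad f x = G"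
  unfolding grad_def by (simp add: partial_eqI euclidean_representation)

lemma harmonic_onD:
  assumes "harmonic_on S f" and "x \<in> S"
  shows "(f has_derivative (\<lambda>h. grad f x \<bullet> h)) (at x)"
    and "i \<in> Basis \<Longrightarrow> (partial i f has_derivative (\<lambda>h. grad (partial i f) x \<bullet> h)) (at x)"
    and "(\<Sum>i\<in>Basis. grad (partial i f) x \<bullet> i) = 0"
  using assms C1_onD(1)[of S _ x] by (auto simp: harmonic_on_def C2_on_def laplacian_def grad_inner_Basis)

lemma harmonic_on_continuous_grad:
  assumes "harmonic_on S f"
  shows "continuous_on S (grad f)" and "i \<in> Basis \<Longrightarrow> continuous_on S (grad (partial i f))"
  using assms by (auto simp: harmonic_on_def C2_on_def intro!: C1_onD(2))

lemma harmonic_on_imp_continuous_on: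
  assumes "harmonic_on S f"
  shows "continuous_on S f"
  by (meson assms continuous_at_imp_continuous_on harmonic_onD(1) has_derivative_continuous)

lemma harmonic_on_diff:
  fixes f g :: "'a::euclidean_space \<Rightarrow> real"
  assumes S: "open S" and f: "harmonic_on S f" and g: "harmonic_on S g"
  shows "harmonic_on S (\<lambda>x. f x - g x)"
proof (rule harmonic_onI[OF S])
  show "((\<lambda>x. f x - g x) has_derivative (\<lambda>h. (grad f x - grad g x) \<bullet> h)) (at x)" if "x \<in> S" for x
    unfolding inner_diff_left by (intro has_derivative_diff harmonic_onD(1)[OF f that] harmonic_onD(1)[OF g that])
  show "((\<lambda>x. (grad f x - grad g x) \<bullet> i) has_derivative (\<lambda>h. (grad (partial i f) x - grad (partial i g) x) \<bullet> h)) (at x)"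
    if "x \<in> S" "i \<in> Basis" for x i
    unfolding inner_diff_left using that
    by (simp only: grad_inner_Basis) (intro has_derivative_diff harmonic_onD(2)[OF f that] harmonic_onD(2)[OF g that])
  show "continuous_on S (\<lambda>x. grad (partial i f) x - grad (partial i g) x)" if "i \<in> Basis" for i
    by (intro continuous_intros harmonic_on_continuous_grad(2) f g that)
  show "(\<Sum>i\<in>Basis. (grad (partial i f) x - grad (partial i g) x) \<bullet> i) = 0" if "x \<in> S" for x
    using harmonic_onD(3)[OF f that] harmonic_onD(3)[OF g that] by (simp add: inner_diff_left sum_subtractf)
qed

text \<open>Used with \<open>0 < r < 1\<close> and \<open>T\<close> the ball of radius
  \<open>1 / r\<close>: the dilate is then harmonic on a neighbourhood of the closed unit ball and
  so has continuous boundary values.\<close>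

lemma harmonic_on_scale_argument:
  fixes f :: "'a::euclidean_space \<Rightarrow> real"
  assumes S: "open S" and T: "open T" and f: "harmonic_on S f" and ST: "\<And>x. x \<in> T \<Longrightarrow> r *\<^sub>R x \<in> S"
  shows "harmonic_on T (\<lambda>x. f (r *\<^sub>R x))"
    and "x \<in> T \<Longrightarrow> grad (\<lambda>x. f (r *\<^sub>R x)) x = r *\<^sub>R grad f (r *\<^sub>R x)"
proof -
  have chain: "((\<lambda>x. k (r *\<^sub>R x)) has_derivative (\<lambda>h. (r *\<^sub>R G) \<bullet> h)) (at x)"
    if "(k has_derivative (\<lambda>h. G \<bullet> h)) (at (r *\<^sub>R x))" for k :: "'a \<Rightarrow> real" and G x
  proof -
    have "((\<lambda>x. r *\<^sub>R x) has_derivative (\<lambda>h. r *\<^sub>R h)) (at x)" by (auto intro!: derivative_eq_intros)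
    from has_derivative_compose[OF this that] show ?thesis by simp
  qed
  have d1: "((\<lambda>x. f (r *\<^sub>R x)) has_derivative (\<lambda>h. (r *\<^sub>R grad f (r *\<^sub>R x)) \<bullet> h)) (at x)" if "x \<in> T" for x
    by (rule chain[OF harmonic_onD(1)[OF f ST[OF that]]])
  show "x \<in> T \<Longrightarrow> grad (\<lambda>x. f (r *\<^sub>R x)) x = r *\<^sub>R grad f (r *\<^sub>R x)"
    by (rule grad_eqI[OF d1])
  show "harmonic_on T (\<lambda>x. f (r *\<^sub>R x))"
  proof (rule harmonic_onI[OF T d1])
    show "((\<lambda>x. (r *\<^sub>R grad f (r *\<^sub>R x)) \<bullet> i) has_derivative (\<lambda>h. (r *\<^sub>R r *\<^sub>R grad (partial i f) (r *\<^sub>R x)) \<bullet> h)) (at x)"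
      if "x \<in> T" "i \<in> Basis" for x i
      using has_derivative_mult_right[OF chain[OF harmonic_onD(2)[OF f ST[OF that(1)] that(2)]], of r] that(2)
      by (simp add: grad_inner_Basis mult.assoc)
    show "continuous_on T (\<lambda>x. r *\<^sub>R r *\<^sub>R grad (partial i f) (r *\<^sub>R x))" if "i \<in> Basis" for i
      by (intro continuous_intros continuous_on_compose2[OF harmonic_on_continuous_grad(2)[OF f that]]) (use ST in auto)
    show "(\<Sum>i\<in>Basis. (r *\<^sub>R r *\<^sub>R grad (partial i f) (r *\<^sub>R x)) \<bullet> i) = 0" if "x \<in> T" for x
      using harmonic_onD(3)[OF f ST[OF that]] by (simp add: sum_distrib_left[symmetric])
  qed
qed

lemma harmonic_on_subset:
  assumes "harmonic_on S f" "T \<subseteq> S"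
  shows "harmonic_on T f"
  using assms unfolding harmonic_on_def C2_on_def C1_on_def by (blast intro: continuous_on_subset)

text \<open>Adding \<open>d * (y \<bullet> y)\<close> makes the Laplacian strictly positive, which
  excludes an interior maximum; then \<open>d\<close> is made small.\<close>

proposition harmonic_maximum_principle:
  fixes f :: "'a::euclidean_space \<Rightarrow> real"
  assumes cont: "continuous_on (cball 0 r) f" and harm: "harmonic_on (ball 0 r) f"
    and bd: "\<And>y. norm y = r \<Longrightarrow> f y \<le> c" and x: "norm x \<le> r"
  shows "f x \<le> c"
proof (rule field_le_epsilon)
  fix e :: real assume e: "e > 0"
  have r: "r \<ge> 0" using x norm_ge_zero order_trans by blast
  \<comment> \<open>Chosen so that the perturbation is at most \<open>e\<close> on the ball; the
    summand 1 covers radius 0.\<close>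
  define d where "d = e / (r\<^sup>2 + 1)"
  have d: "d > 0" "d * r\<^sup>2 \<le> e" using e by (auto simp: d_def field_simps add_pos_nonneg)
  define g where "g y = f y + d * (y \<bullet> y)" for y
  have "continuous_on (cball 0 r) g" unfolding g_def by (intro continuous_intros cont)
  then obtain z where z: "z \<in> cball 0 r" "\<And>y. y \<in> cball 0 r \<Longrightarrow> g y \<le> g z"
    using continuous_attains_sup[of "cball 0 r" g] r by auto
  have "norm z = r"
  proof (rule ccontr)
    assume "norm z \<noteq> r"
    then have zb: "z \<in> ball 0 r" using z(1) by simp
    define \<delta> where "\<delta> = r - norm z"
    have \<delta>: "\<delta> > 0" using zb by (simp add: \<delta>_def)
    have in_ball: "z + t *\<^sub>R i \<in> ball 0 r" if "\<bar>t\<bar> < \<delta>" "i \<in> Basis" for t i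
      using that norm_triangle_ineq[of z "t *\<^sub>R i"] by (simp add: \<delta>_def)
    \<comment> \<open>The second derivative of \<open>g\<close> along each basis vector is
      nonpositive at \<open>z\<close>. Summed over the basis, the harmonic part drops out and
      \<open>2 * d\<close> times the dimension remains, a contradiction.\<close>
    have "grad (partial i f) z \<bullet> i + 2 * d \<le> 0" if i: "i \<in> Basis" for i
    proof (rule second_derivative_nonpos_at_max[OF \<delta>])
      define \<phi> where "\<phi> t = g (z + t *\<^sub>R i)" for t
      define \<phi>' where "\<phi>' t = partial i f (z + t *\<^sub>R i) + 2 * d * ((z + t *\<^sub>R i) \<bullet> i)" for t
      have line: "((\<lambda>t. z + t *\<^sub>R i) has_derivative (\<lambda>h. h *\<^sub>R i)) (at t)" for t
        by (auto intro!: derivative_eq_intros)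
      have fl: "((\<lambda>t. k (z + t *\<^sub>R i)) has_real_derivative G \<bullet> i) (at t)"
        if "(k has_derivative (\<lambda>h. G \<bullet> h)) (at (z + t *\<^sub>R i))" for k :: "'a \<Rightarrow> real" and G t
        using has_derivative_compose[OF line that] by (simp add: has_field_derivative_def mult_commute_abs)
      show "(\<phi> has_real_derivative \<phi>' t) (at t)" if "\<bar>t\<bar> < \<delta>" for t
      proof -
        have "((\<lambda>t. f (z + t *\<^sub>R i)) has_real_derivative partial i f (z + t *\<^sub>R i)) (at t)"
          using fl[OF harmonic_onD(1)[OF harm in_ball[OF that i]]] i by (simp add: grad_inner_Basis)
        moreover have "((\<lambda>t. d * ((z + t *\<^sub>R i) \<bullet> (z + t *\<^sub>R i))) has_real_derivative 2 * d * ((z + t *\<^sub>R i) \<bullet> i)) (at t)"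
        proof -
          have "((\<lambda>x. d * (x \<bullet> x)) has_derivative (\<lambda>h. ((2 * d) *\<^sub>R y) \<bullet> h)) (at y)" for y :: 'a
            by (rule derivative_eq_intros refl)+ (simp add: inner_commute fun_eq_iff)
          from fl[OF this] show ?thesis by simp
        qed
        ultimately show ?thesis unfolding \<phi>_def[abs_def] \<phi>'_def g_def by (rule DERIV_add)
      qed
      show "(\<phi>' has_real_derivative (grad (partial i f) z \<bullet> i + 2 * d)) (at 0)"
      proof -
        have "((\<lambda>t. partial i f (z + t *\<^sub>R i)) has_real_derivative grad (partial i f) z \<bullet> i) (at 0)"
          by (rule fl) (use harmonic_onD(2)[OF harm zb i] in simp)
        moreover have "((\<lambda>t. 2 * d * ((z + t *\<^sub>R i) \<bullet> i)) has_real_derivative 2 * d) (at 0)"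
        proof -
          have "((\<lambda>x. 2 * d * (x \<bullet> i)) has_derivative (\<lambda>h. ((2 * d) *\<^sub>R i) \<bullet> h)) (at y)" for y :: 'a
            by (rule derivative_eq_intros refl)+ (simp add: inner_commute fun_eq_iff)
          from fl[OF this] show ?thesis using i by (simp add: inner_Basis)
        qed
        ultimately show ?thesis unfolding \<phi>'_def by (rule DERIV_add)
      qed
      show "\<phi> t \<le> \<phi> 0" if "\<bar>t\<bar> < \<delta>" for t
        using z(2)[of "z + t *\<^sub>R i"] in_ball[OF that i] by (simp add: \<phi>_def)
    qed
    then have "(\<Sum>i\<in>Basis. grad (partial i f) z \<bullet> i + 2 * d) \<le> 0" by (rule sum_nonpos)
    then have "real DIM('a) * (2 * d) \<le> 0"
      using harmonic_onD(3)[OF harm zb] by (simp add: sum.distrib)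
    then show False using d(1) by (simp add: mult_le_0_iff)
  qed
  then have "g z \<le> c + d * r\<^sup>2" using bd[of z] by (simp add: g_def dot_square_norm)
  moreover have "f x \<le> g x" using d by (simp add: g_def)
  moreover have "g x \<le> g z" using z(2) x by simp
  ultimately show "f x \<le> c + e" using d(2) by linarith
qed

corollary harmonic_zero_boundary:
  fixes f :: "'a::euclidean_space \<Rightarrow> real"
  assumes cont: "continuous_on (cball 0 r) f" and harm: "harmonic_on (ball 0 r) f"
    and bd: "\<And>y. norm y = r \<Longrightarrow> f y = c" and x: "norm x \<le> r"
  shows "f x = c"
proof (rule antisym)
  show "f x \<le> c" by (rule harmonic_maximum_principle[OF cont harm _ x]) (simp add: bd)
  have "harmonic_on (ball 0 r) (\<lambda>y::'a. 0)"
    by (rule harmonic_onI[where G = "\<lambda>_. 0" and H = "\<lambda>_ _. 0"]) auto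
  from harmonic_on_diff[OF open_ball this harm] have "harmonic_on (ball 0 r) (\<lambda>y. - f y)" by simp
  then have "- f x \<le> - c"
    by (rule harmonic_maximum_principle[OF continuous_on_minus[OF cont] _ _ x]) (simp add: bd)
  then show "c \<le> f x" by simp
qed

subsection \<open>The Poisson representation\<close>

lemma measurable_sphere_measure:
  "f \<in> borel_measurable borel \<Longrightarrow> f \<in> borel_measurable sphere_measure"
  using measurable_restrict_space1 measurable_cong_sets[OF sets_sphere_measure refl] by blast

lemma poisson_measurable [measurable]:
  "poisson x \<in> borel_measurable borel" "poisson_grad x \<in> borel_measurable borel"
  unfolding poisson_def[abs_def] poisson_grad_def[abs_def] by measurable

lemma poisson_nonneg: "x \<in> ball 0 1 \<Longrightarrow> 0 \<le> poisson x y"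
  by (auto simp: poisson_def dot_square_norm power_le_one)

lemma integrable_poisson:
  fixes g :: "'a::euclidean_space \<Rightarrow> real"
  assumes "g \<in> borel_measurable sphere_measure" "\<And>y. norm y = 1 \<Longrightarrow> \<bar>g y\<bar> \<le> B" "x \<in> ball 0 1"
  shows "integrable sphere_measure (\<lambda>y. g y * poisson x y)"
    and "integrable sphere_measure (\<lambda>y. g y *\<^sub>R poisson_grad x y)"
proof -
  interpret compact_weighted_measure sphere_measure "sphere 0 1" g B
    by (rule compact_weighted_sphere[OF assms(1,2)])
  show "integrable sphere_measure (\<lambda>y. g y * poisson x y)"
    using integrable_weighted[OF continuous_on_slice[OF continuous_on_poisson_kernels(1) assms(3)]] by simp
  show "integrable sphere_measure (\<lambda>y. g y *\<^sub>R poisson_grad x y)"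
    by (rule integrable_weighted[OF continuous_on_slice[OF continuous_on_poisson_kernels(2) assms(3)]])
qed

text \<open>As a function of \<open>x\<close> the mass is harmonic, and rotation invariance makes it
  constant on each centred sphere. The maximum principle equates it with its value at the centre,
  where the kernel is 1.\<close>

lemma poisson_mass:
  fixes x :: "'a::euclidean_space"
  assumes x: "x \<in> ball 0 1"
  shows "(\<integral>y. poisson x y \<partial>sphere_measure) = 1"
proof -
  let ?\<Phi> = "\<lambda>x::'a. \<integral>y. poisson x y \<partial>sphere_measure"
  have pi: "poisson_integral (\<lambda>_. 1) = ?\<Phi>" by (simp add: poisson_integral_def[abs_def])
  have harm: "harmonic_on (ball 0 1) ?\<Phi>"
    by (subst pi[symmetric], rule poisson_integral_harmonic[where B = 1]) auto
  have rot: "?\<Phi> (T z) = ?\<Phi> z" if T: "orthogonal_transformation T" and z: "z \<in> ball 0 1" for T z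
  proof -
    have Tz: "T z \<in> ball 0 1" using z T by (simp add: orthogonal_transformation_norm)
    have P: "poisson (T z) (T y) = poisson z y" for y
    proof -
      have "T y - T z = T (y - z)"
        using T by (simp add: linear_diff orthogonal_transformation_linear)
      then show ?thesis using T by (simp add: poisson_def orthogonal_transformation_def)
    qed
    have "(\<integral>\<^sup>+y. ennreal (poisson (T z) y) \<partial>sphere_measure) = (\<integral>\<^sup>+y. ennreal (poisson z y) \<partial>sphere_measure)"
      using sphere_measure_orthogonal[OF T, of "\<lambda>y. ennreal (poisson (T z) y)"] by (simp add: P)
    then show ?thesis
      using z Tz by (subst (1 2) integral_eq_nn_integral) (auto intro!: measurable_sphere_measure simp: poisson_nonneg)
  qed
  have "?\<Phi> 0 = (\<integral>y. 1 \<partial>(sphere_measure :: 'a measure))"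
    by (intro Bochner_Integration.integral_cong refl) (simp add: poisson_def dot_square_norm)
  also have "\<dots> = 1" using measure_sphere_measure_space[where 'a = 'a] by simp
  finally have z: "?\<Phi> 0 = 1" .
  have sub: "cball 0 (norm x) \<subseteq> ball (0::'a) 1" using x by auto
  have "?\<Phi> 0 = ?\<Phi> x"
  proof (rule harmonic_zero_boundary[where r = "norm x" and f = ?\<Phi> and x = 0])
    show "continuous_on (cball 0 (norm x)) ?\<Phi>"
      by (rule continuous_on_subset[OF harmonic_on_imp_continuous_on[OF harm] sub])
    show "harmonic_on (ball 0 (norm x)) ?\<Phi>"
      by (rule harmonic_on_subset[OF harm]) (use sub in auto)
    fix y :: 'a assume y: "norm y = norm x"
    obtain T where "orthogonal_transformation T" "T x = y"
      using orthogonal_transformation_swap[of x y] y by metis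
    then show "?\<Phi> y = ?\<Phi> x" using rot x by metis
  qed simp
  with z show ?thesis by simp
qed

lemma continuous_on_sphere_imp_bounded_measurable:
  fixes g :: "'a::euclidean_space \<Rightarrow> real"
  assumes "continuous_on (sphere 0 1) g"
  shows "g \<in> borel_measurable sphere_measure" and "\<exists>B. \<forall>y. norm y = 1 \<longrightarrow> \<bar>g y\<bar> \<le> B"
proof -
  show "g \<in> borel_measurable sphere_measure"
    using borel_measurable_continuous_on_restrict[OF assms] measurable_cong_sets[OF sets_sphere_measure refl] by blast
  have "bounded (g ` sphere 0 1)"
    using compact_continuous_image[OF assms compact_sphere] compact_imp_bounded by blast
  then obtain B where "\<forall>y\<in>g ` sphere 0 1. norm y \<le> B" unfolding bounded_iff by blast
  then show "\<exists>B. \<forall>y. norm y = 1 \<longrightarrow> \<bar>g y\<bar> \<le> B" by (intro exI[of _ B]) auto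
qed

text \<open>The kernel is an approximate identity: it is nonnegative with mass 1, and away from
  \<xi> it is uniformly small because 1 - |x|^2 is at most twice the distance from \<open>x\<close>
  to \<xi>.\<close>

lemma poisson_integral_boundary:
  fixes g :: "'a::euclidean_space \<Rightarrow> real"
  assumes g: "continuous_on (sphere 0 1) g" and \<xi>: "norm \<xi> = 1" and e: "e > 0"
  shows "\<exists>d>0. \<forall>x\<in>ball 0 1. dist x \<xi> < d \<longrightarrow> \<bar>poisson_integral g x - g \<xi>\<bar> < e"
proof -
  note gm = continuous_on_sphere_imp_bounded_measurable(1)[OF g]
  obtain B where B: "\<And>y. norm y = 1 \<Longrightarrow> \<bar>g y\<bar> \<le> B"
    using continuous_on_sphere_imp_bounded_measurable(2)[OF g] by blast
  have B0: "B \<ge> 0" using B[OF \<xi>] by linarith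
  obtain d0 where d0: "d0 > 0" "\<And>y. norm y = 1 \<Longrightarrow> dist y \<xi> < d0 \<Longrightarrow> \<bar>g y - g \<xi>\<bar> < e / 2"
    using g[unfolded continuous_on_iff, rule_format, of \<xi> "e / 2"] \<xi> e by (auto simp: dist_real_def)
  \<comment> \<open>An upper bound for |y - x|^(-n) when |y - x| is at least
    \<open>d0 / 2\<close>.\<close>
  define D where "D = ((d0 / 2)\<^sup>2) powr (- real DIM('a) / 2)"
  have D: "D > 0" using d0 by (simp add: D_def)
  \<comment> \<open>The first entry keeps far points \<open>y\<close> at distance
    \<open>d0 / 2\<close> from \<open>x\<close>; the second makes the far contribution
    \<open>2 * B * (2 * d * D)\<close> less than \<open>e / 2\<close>.\<close>
  define d where "d = min (d0 / 2) (e / (8 * (B + 1) * D))"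
  have d: "d > 0" using d0 e B0 D by (simp add: d_def)
  show ?thesis
  proof (intro exI[of _ d] conjI ballI impI)
    fix x :: 'a assume x: "x \<in> ball 0 1" and xd: "dist x \<xi> < d"
    have x1: "norm x < 1" using x by simp
    let ?M = "sphere_measure :: 'a measure"
    have ip: "integrable ?M (poisson x)" using integrable_poisson(1)[of "\<lambda>_. 1" 1 x] x by simp
    have "1 - x \<bullet> x \<le> 2 * d"
    proof -
      have "1 - norm x \<le> dist x \<xi>" using norm_triangle_ineq2[of \<xi> x] \<xi> by (simp add: dist_norm norm_minus_commute)
      moreover have "1 - x \<bullet> x = (1 - norm x) * (1 + norm x)"
        by (simp add: dot_square_norm algebra_simps power2_eq_square)
      moreover have "(1 - norm x) * (1 + norm x) \<le> (1 - norm x) * 2"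
        using x1 by (intro mult_left_mono) auto
      ultimately have "1 - x \<bullet> x \<le> (1 - norm x) * 2" and "1 - norm x \<le> d" using xd by auto
      then show ?thesis by (simp add: order_trans[OF _ mult_right_mono] mult.commute[of 2])
    qed
    have far: "poisson x y \<le> 2 * d * D" if y: "norm y = 1" "\<not> dist y \<xi> < d0" for y
    proof -
      have "d0 / 2 \<le> norm (y - x)"
        using y(2) xd dist_triangle[of y \<xi> x] d_def by (simp add: dist_norm norm_minus_commute)
      then have "(d0 / 2)\<^sup>2 \<le> (y - x) \<bullet> (y - x)"
        using d0(1) by (simp add: dot_square_norm power_mono)
      then have "((y - x) \<bullet> (y - x)) powr (- real DIM('a) / 2) \<le> D"
        unfolding D_def using d0(1) by (intro powr_mono2') auto
      then show ?thesis
        unfolding poisson_def using \<open>1 - x \<bullet> x \<le> 2 * d\<close> x1 d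
        by (intro mult_mono) (auto simp: dot_square_norm power_le_one)
    qed
    have pw: "\<bar>(g y - g \<xi>) * poisson x y\<bar> \<le> e / 2 * poisson x y + 2 * B * (2 * d * D)" if y: "norm y = 1" for y
    proof (cases "dist y \<xi> < d0")
      case True
      have "\<bar>g y - g \<xi>\<bar> * poisson x y \<le> e / 2 * poisson x y"
        using d0(2)[OF y True] poisson_nonneg[OF x, of y] by (intro mult_right_mono) auto
      moreover have "0 \<le> 2 * B * (2 * d * D)" using B0 d D by simp
      ultimately show ?thesis unfolding abs_mult abs_of_nonneg[OF poisson_nonneg[OF x]] by linarith
    next
      case False
      have "\<bar>g y - g \<xi>\<bar> * poisson x y \<le> (2 * B) * (2 * d * D)"
        using far[OF y False] B[OF y] B[OF \<xi>] poisson_nonneg[OF x, of y] B0 by (intro mult_mono) auto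
      moreover have "0 \<le> e / 2 * poisson x y" using poisson_nonneg[OF x, of y] e by simp
      ultimately show ?thesis unfolding abs_mult abs_of_nonneg[OF poisson_nonneg[OF x]] by linarith
    qed
    have "poisson_integral g x - g \<xi> = (\<integral>y. (g y - g \<xi>) * poisson x y \<partial>?M)"
      using integrable_poisson(1)[OF gm B x] ip poisson_mass[OF x]
      by (simp add: poisson_integral_def left_diff_distrib)
    also have "\<bar>\<dots>\<bar> \<le> (\<integral>y. \<bar>(g y - g \<xi>) * poisson x y\<bar> \<partial>?M)"
      by (rule integral_abs_bound)
    also have "\<dots> \<le> (\<integral>y. e / 2 * poisson x y + 2 * B * (2 * d * D) \<partial>?M)"
    proof (rule integral_mono)
      interpret finite_measure ?M by (rule finite_measure_sphere_measure)
      show "integrable ?M (\<lambda>y. \<bar>(g y - g \<xi>) * poisson x y\<bar>)"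
        using integrable_poisson(1)[OF gm B x] ip by (intro integrable_abs) (simp add: left_diff_distrib)
      show "integrable ?M (\<lambda>y. e / 2 * poisson x y + 2 * B * (2 * d * D))" using ip by simp
    qed (use pw in simp)
    also have "\<dots> = e / 2 + 2 * B * (2 * d * D)"
    proof -
      interpret finite_measure ?M by (rule finite_measure_sphere_measure)
      show ?thesis using ip poisson_mass[OF x] measure_sphere_measure_space[where 'a = 'a] by simp
    qed
    also have "\<dots> < e"
    proof -
      have "d \<le> e / (8 * (B + 1) * D)" and "8 * (B + 1) * D > 0"
        using B0 D by (simp_all add: d_def)
      then have "d * (8 * (B + 1) * D) \<le> e" by (simp only: pos_le_divide_eq)
      moreover have "d * D > 0" using d D by simp
      ultimately show ?thesis by (simp add: algebra_simps)
    qed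
    finally show "\<bar>poisson_integral g x - g \<xi>\<bar> < e" .
  qed fact
qed

text \<open>The difference of both sides is harmonic inside and tends to 0 at every boundary point,
  because the Poisson integral and \<open>f\<close> have the same limit there.\<close>

proposition poisson_representation:
  fixes f :: "'a::euclidean_space \<Rightarrow> real"
  assumes cont: "continuous_on (cball 0 1) f" and harm: "harmonic_on (ball 0 1) f" and x: "x \<in> ball 0 1"
  shows "f x = poisson_integral f x"
proof -
  have cs: "continuous_on (sphere 0 1) f" by (rule continuous_on_subset[OF cont]) auto
  note fm = continuous_on_sphere_imp_bounded_measurable(1)[OF cs]
  obtain B where B: "\<And>y. norm y = 1 \<Longrightarrow> \<bar>f y\<bar> \<le> B"
    using continuous_on_sphere_imp_bounded_measurable(2)[OF cs] by blast
  have hp: "harmonic_on (ball 0 1) (poisson_integral f)" by (rule poisson_integral_harmonic[OF fm B])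
  \<comment> \<open>On the sphere itself the factor 1 - |x|^2 makes
    \<open>poisson_integral f\<close> zero rather than equal to \<open>f\<close>, so the difference
    is redefined there by its limit 0.\<close>
  define h where "h z = (if z \<in> ball 0 1 then f z - poisson_integral f z else 0)" for z
  have "h x = 0"
  proof (rule harmonic_zero_boundary[where r = 1 and f = h])
    have eq: "f z - poisson_integral f z = h z" if "z \<in> ball 0 1" for z using that by (simp add: h_def)
    have hd: "harmonic_on (ball 0 1) (\<lambda>z. f z - poisson_integral f z)"
      by (rule harmonic_on_diff[OF open_ball harm hp])
    show hh: "harmonic_on (ball 0 1) h"
    proof (rule harmonic_onI[OF open_ball, where G = "grad (\<lambda>z. f z - poisson_integral f z)"
          and H = "\<lambda>i. grad (partial i (\<lambda>z. f z - poisson_integral f z))"])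
      show "(h has_derivative (\<lambda>k. grad (\<lambda>z. f z - poisson_integral f z) y \<bullet> k)) (at y)" if "y \<in> ball 0 1" for y
        by (rule has_derivative_transform_within_open[OF harmonic_onD(1)[OF hd that] open_ball that eq])
      show "((\<lambda>y. grad (\<lambda>z. f z - poisson_integral f z) y \<bullet> i) has_derivative
          (\<lambda>k. grad (partial i (\<lambda>z. f z - poisson_integral f z)) y \<bullet> k)) (at y)"
        if "y \<in> ball 0 1" "i \<in> Basis" for y i
        using harmonic_onD(2)[OF hd that] that(2) by (simp add: grad_inner_Basis)
    qed (use harmonic_onD(3)[OF hd] harmonic_on_continuous_grad(2)[OF hd] in auto)
    show "continuous_on (cball 0 1) h"
      unfolding continuous_on_eq_continuous_within
    proof
      fix z :: 'a assume z: "z \<in> cball 0 1"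
      show "continuous (at z within cball 0 1) h"
      proof (cases "z \<in> ball 0 1")
        case True
        then have "continuous (at z) h" by (rule has_derivative_continuous[OF harmonic_onD(1)[OF hh]])
        then show ?thesis by (rule continuous_at_imp_continuous_at_within)
      next
        case False
        then have z1: "norm z = 1" using z by simp
        show ?thesis
          unfolding continuous_within_eps_delta
        proof (intro allI impI)
          fix e :: real assume e: "e > 0"
          obtain d1 where d1: "d1 > 0" "\<And>y. y \<in> cball 0 1 \<Longrightarrow> dist y z < d1 \<Longrightarrow> \<bar>f y - f z\<bar> < e / 2"
            using cont[unfolded continuous_on_iff, rule_format, of z "e / 2"] z e by (auto simp: dist_real_def)
          obtain d2 where d2: "d2 > 0" "\<And>y. y \<in> ball 0 1 \<Longrightarrow> dist y z < d2 \<Longrightarrow> \<bar>poisson_integral f y - f z\<bar> < e / 2"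
            using poisson_integral_boundary[OF cs z1, of "e / 2"] e by (auto simp: dist_real_def)
          show "\<exists>d>0. \<forall>y\<in>cball 0 1. dist y z < d \<longrightarrow> dist (h y) (h z) < e"
          proof (intro exI[of _ "min d1 d2"] conjI ballI impI)
            fix y :: 'a assume y: "y \<in> cball 0 1" "dist y z < min d1 d2"
            show "dist (h y) (h z) < e"
            proof (cases "y \<in> ball 0 1")
              case True
              have "\<bar>f y - f z\<bar> < e / 2" "\<bar>poisson_integral f y - f z\<bar> < e / 2"
                using d1(2)[OF y(1)] d2(2)[OF True] y(2) by auto
              then have "\<bar>f y - poisson_integral f y\<bar> < e" by linarith
              then show ?thesis using True False by (simp add: h_def dist_real_def)
            qed (use False e in \<open>simp add: h_def\<close>)
          qed (use d1 d2 in auto)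
        qed
      qed
    qed
  qed (use x in \<open>auto simp: h_def\<close>)
  then show ?thesis using x by (simp add: h_def)
qed

section \<open>The optimal coefficient as an integral of the kernel\<close>

lemma harmonic_const: "harmonic_on S (\<lambda>x::'a::euclidean_space. c)" if "open S"
  by (rule harmonic_onI[OF that, where G = "\<lambda>_. 0" and H = "\<lambda>_ _. 0"]) auto

lemma integrable_poisson_grad_inner:
  fixes x :: "'a::euclidean_space"
  assumes x: "x \<in> ball 0 1"
  shows "integrable sphere_measure (\<lambda>y. poisson_grad x y \<bullet> l)"
  using integrable_poisson(2)[of "\<lambda>_. 1" 1, OF _ _ x] by (auto intro!: integrable_inner_left)

lemma poisson_grad_mean_zero:
  fixes x :: "'a::euclidean_space"
  assumes x: "x \<in> ball 0 1"
  shows "(\<integral>y. poisson_grad x y \<bullet> l \<partial>sphere_measure) = 0"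
proof -
  have "(poisson_integral (\<lambda>_. 1) has_derivative (\<lambda>h. (\<integral>y. 1 *\<^sub>R poisson_grad x y \<partial>sphere_measure) \<bullet> h)) (at x)"
    by (rule poisson_integral_has_derivative[where B = 1]) (use x in auto)
  moreover have "(poisson_integral (\<lambda>_. 1) has_derivative (\<lambda>h. 0)) (at x)"
    by (rule has_derivative_transform_within_open[OF has_derivative_const open_ball x, of 1])
       (simp add: poisson_integral_def poisson_mass)
  ultimately have "(\<lambda>h. (\<integral>y. 1 *\<^sub>R poisson_grad x y \<partial>sphere_measure) \<bullet> h) = (\<lambda>h. 0)"
    by (rule has_derivative_unique)
  then have "(\<integral>y. poisson_grad x y \<partial>sphere_measure) \<bullet> l = 0" by (simp add: fun_eq_iff)
  moreover have "integrable sphere_measure (poisson_grad x)"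
    using integrable_poisson(2)[of "\<lambda>_. 1" 1, OF _ _ x] by auto
  then have "(\<integral>y. poisson_grad x y \<bullet> l \<partial>sphere_measure) = (\<integral>y. poisson_grad x y \<partial>sphere_measure) \<bullet> l"
    by (intro integral_inner_left)
  ultimately show ?thesis by simp
qed

proposition optimal_coeff_poisson:
  fixes x l :: "'a::euclidean_space"
  assumes x: "x \<in> ball 0 1"
  shows "optimal_coeff x l ((1 - norm x) * (\<integral>y. \<bar>poisson_grad x y \<bullet> l\<bar> \<partial>sphere_measure))"
proof -
  let ?M = "sphere_measure :: 'a measure"
  define K where "K = (\<integral>y. \<bar>poisson_grad x y \<bullet> l\<bar> \<partial>?M)"
  have K0: "K \<ge> 0" unfolding K_def by simp
  have x1: "1 - norm x > 0" using x by simp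
  note ig = integrable_poisson_grad_inner[OF x, of l]
  have weighted: "(\<integral>y. g y *\<^sub>R poisson_grad x y \<partial>?M) \<bullet> l = (\<integral>y. g y * (poisson_grad x y \<bullet> l) \<partial>?M)"
    "integrable ?M (\<lambda>y. g y * (poisson_grad x y \<bullet> l))"
    if "g \<in> borel_measurable ?M" "\<And>y. norm y = 1 \<Longrightarrow> \<bar>g y\<bar> \<le> B" for g B
    using integral_inner_left[OF integrable_poisson(2)[OF that x], of l]
      integrable_inner_left[OF integrable_poisson(2)[OF that x], of l] by simp_all
  have "admissible_coeff x l ((1 - norm x) * K)"
    unfolding admissible_coeff_def
  proof (intro allI impI, elim conjE)
    fix U :: "'a \<Rightarrow> real" assume U: "harmonic_on (ball 0 1) U" and bU: "bounded (U ` ball 0 1)"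
    define S where "S = (SUP y\<in>ball 0 1. \<bar>U y\<bar>)"
    have US: "\<bar>U y\<bar> \<le> S" if "y \<in> ball 0 1" for y
      unfolding S_def
    proof (rule cSUP_upper[OF that])
      show "bdd_above ((\<lambda>y. \<bar>U y\<bar>) ` ball 0 1)"
        using bU unfolding bounded_iff by (auto intro: bdd_aboveI2)
    qed
    have S0: "S \<ge> 0" using US[of 0] by simp
    have bnd: "\<bar>r * (grad U (r *\<^sub>R x) \<bullet> l)\<bar> \<le> S * K" if r: "0 < r" "r < 1" for r
    proof -
      define V where "V z = U (r *\<^sub>R z)" for z
      have rT: "r *\<^sub>R z \<in> ball 0 1" if "z \<in> ball 0 (1 / r)" for z :: 'a
        using that r by (simp add: field_simps)
      have hV: "harmonic_on (ball 0 (1 / r)) V"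
        unfolding V_def by (rule harmonic_on_scale_argument(1)[OF open_ball open_ball U rT])
      have "1 < 1 / r" using r by simp
      then have sub: "cball 0 1 \<subseteq> ball (0::'a) (1 / r)" by auto
      have cV: "continuous_on (cball 0 1) V"
        by (rule continuous_on_subset[OF harmonic_on_imp_continuous_on[OF hV] sub])
      have hV1: "harmonic_on (ball 0 1) V" by (rule harmonic_on_subset[OF hV]) (use sub in auto)
      have VS: "\<bar>V y\<bar> \<le> S" if "norm y = 1" for y using that r by (auto simp: V_def intro!: US)
      have mV: "V \<in> borel_measurable ?M"
        by (rule continuous_on_sphere_imp_bounded_measurable(1)[OF continuous_on_subset[OF cV]]) auto
      have "(V has_derivative (\<lambda>h. (\<integral>y. V y *\<^sub>R poisson_grad x y \<partial>?M) \<bullet> h)) (at x)"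
        by (rule has_derivative_transform_within_open[OF poisson_integral_has_derivative[OF mV VS x] open_ball x])
           (use poisson_representation[OF cV hV1] in auto)
      then have "grad V x = (\<integral>y. V y *\<^sub>R poisson_grad x y \<partial>?M)" by (rule grad_eqI)
      moreover have xT: "x \<in> ball 0 (1 / r)" using x sub ball_subset_cball by blast
      have "grad V x = r *\<^sub>R grad U (r *\<^sub>R x)"
        unfolding V_def by (rule harmonic_on_scale_argument(2)[OF open_ball open_ball[of 0 "1 / r"] U rT]) (use xT in auto)
      ultimately have "r * (grad U (r *\<^sub>R x) \<bullet> l) = (\<integral>y. V y * (poisson_grad x y \<bullet> l) \<partial>?M)"
        using weighted(1)[OF mV VS] by (metis inner_scaleR_left)
      also have "\<bar>\<dots>\<bar> \<le> (\<integral>y. \<bar>V y * (poisson_grad x y \<bullet> l)\<bar> \<partial>?M)" by (rule integral_abs_bound)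
      also have "\<dots> \<le> (\<integral>y. S * \<bar>poisson_grad x y \<bullet> l\<bar> \<partial>?M)"
      proof (rule integral_mono[OF integrable_abs[OF weighted(2)[OF mV VS]]])
        show "integrable ?M (\<lambda>y. S * \<bar>poisson_grad x y \<bullet> l\<bar>)" using ig by simp
        show "\<bar>V y * (poisson_grad x y \<bullet> l)\<bar> \<le> S * \<bar>poisson_grad x y \<bullet> l\<bar>" if "y \<in> space ?M" for y
          using VS[of y] that by (simp add: abs_mult mult_right_mono)
      qed
      also have "\<dots> = S * K" by (simp add: K_def)
      finally show ?thesis .
    qed
    \<comment> \<open>Continuity of the gradient inside the ball carries the bound from the dilates
      to \<open>U\<close> itself.\<close>
    have "((\<lambda>r. \<bar>r * (grad U (r *\<^sub>R x) \<bullet> l)\<bar>) \<longlongrightarrow> \<bar>1 * (grad U x \<bullet> l)\<bar>) (at_left 1)"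
    proof (intro tendsto_intros)
      have "isCont (grad U) x"
        using harmonic_on_continuous_grad(1)[OF U] x continuous_on_eq_continuous_at[OF open_ball] by blast
      moreover have "((\<lambda>r. r *\<^sub>R x) \<longlongrightarrow> 1 *\<^sub>R x) (at_left 1)" by (intro tendsto_intros)
      ultimately show "((\<lambda>r. grad U (r *\<^sub>R x)) \<longlongrightarrow> grad U x) (at_left 1)"
        by (metis isCont_tendsto_compose scaleR_one)
    qed
    moreover have "\<forall>\<^sub>F r in at_left 1. \<bar>r * (grad U (r *\<^sub>R x) \<bullet> l)\<bar> \<le> S * K"
      by (rule eventually_mono[OF eventually_at_left_real[OF zero_less_one]]) (use bnd in simp)
    ultimately have "\<bar>1 * (grad U x \<bullet> l)\<bar> \<le> S * K"
      by (rule tendsto_upperbound) simp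
    moreover have e: "(1 - norm x) * K * inverse (1 - norm x) = K" using x1 by simp
    ultimately show "\<bar>grad U x \<bullet> l\<bar> \<le> (1 - norm x) * K * inverse (1 - norm x) * (SUP y\<in>ball 0 1. \<bar>U y\<bar>)"
      unfolding e S_def[symmetric] by (simp add: mult.commute)
  qed
  moreover have "(1 - norm x) * K \<le> C'" if C': "admissible_coeff x l C'" for C'
  proof -
    have adm: "\<bar>grad U x \<bullet> l\<bar> \<le> C' * inverse (1 - norm x) * (SUP y\<in>ball 0 1. \<bar>U y\<bar>)"
      if "harmonic_on (ball 0 1) U" "bounded (U ` ball 0 1)" for U
      using C' that unfolding admissible_coeff_def by blast
    \<comment> \<open>Testing with the constant function 1, whose supremum is 1, shows that the
      factor is nonnegative. This is what permits replacing the supremum of the extremal function by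
      its upper bound 1 below.\<close>
    have "0 \<le> C' * inverse (1 - norm x)"
      using adm[of "\<lambda>_. 1"] harmonic_const[OF open_ball] by (fastforce simp: image_constant_conv)
    then have Ci: "0 \<le> C' * inverse (1 - norm x)" .
    define s where "s y = sgn (poisson_grad x y \<bullet> l)" for y
    have s1: "\<bar>s y\<bar> \<le> 1" for y by (simp add: s_def sgn_real_def)
    have sm: "s \<in> borel_measurable ?M"
      by (rule measurable_sphere_measure) (simp add: s_def[abs_def] sgn_real_def)
    define U where "U = poisson_integral s"
    have hU: "harmonic_on (ball 0 1) U" unfolding U_def by (rule poisson_integral_harmonic[OF sm s1])
    have U1: "\<bar>U z\<bar> \<le> 1" if z: "z \<in> ball 0 1" for z
    proof -
      have ip: "integrable ?M (poisson z)" using integrable_poisson(1)[of "\<lambda>_. 1" 1 z] z by simp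
      have "\<bar>U z\<bar> \<le> (\<integral>y. \<bar>s y * poisson z y\<bar> \<partial>?M)"
        unfolding U_def poisson_integral_def by (rule integral_abs_bound)
      also have "\<dots> \<le> (\<integral>y. poisson z y \<partial>?M)"
      proof (rule integral_mono[OF integrable_abs[OF integrable_poisson(1)[OF sm s1 z]] ip])
        show "\<bar>s y * poisson z y\<bar> \<le> poisson z y" for y
          using mult_right_mono[OF s1 poisson_nonneg[OF z], of y y] poisson_nonneg[OF z, of y] by (simp add: abs_mult)
      qed
      also have "\<dots> = 1" by (rule poisson_mass[OF z])
      finally show ?thesis .
    qed
    have "grad U x \<bullet> l = (\<integral>y. s y * (poisson_grad x y \<bullet> l) \<partial>?M)"
      using grad_eqI[OF poisson_integral_has_derivative[OF sm s1 x]] weighted(1)[OF sm s1] by (simp add: U_def)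
    also have "\<dots> = K" by (simp add: K_def s_def mult.commute[of "sgn _"] abs_sgn)
    finally have gK: "grad U x \<bullet> l = K" .
    have "bounded (U ` ball 0 1)" unfolding bounded_iff using U1 by (intro exI[of _ 1]) auto
    from adm[OF hU this] have "K \<le> C' * inverse (1 - norm x) * (SUP y\<in>ball 0 1. \<bar>U y\<bar>)"
      using K0 by (simp add: gK)
    also have "\<dots> \<le> C' * inverse (1 - norm x) * 1"
      by (rule mult_left_mono[OF cSUP_least Ci]) (use U1 in auto)
    finally show ?thesis using x1 by (simp add: field_simps)
  qed
  ultimately show ?thesis unfolding optimal_coeff_def K_def by blast
qed

text \<open>The extended integral of \<open>ennreal (poisson_grad x y \<bullet> l)\<close> is that
  of the positive part, since negative values are sent to 0. From here on only this truncated
  integral is computed.\<close>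

corollary optimal_coeff_poisson_pos:
  fixes x l :: "'a::euclidean_space"
  assumes x: "x \<in> ball 0 1"
  shows "optimal_coeff x l ((1 - norm x) * (2 * enn2real (\<integral>\<^sup>+y. ennreal (poisson_grad x y \<bullet> l) \<partial>sphere_measure)))"
proof -
  let ?M = "sphere_measure :: 'a measure"
  have eq: "\<bar>t\<bar> = 2 * max 0 t - t" for t :: real by simp
  note ig = integrable_poisson_grad_inner[OF x, of l]
  have ip: "integrable ?M (\<lambda>y. max 0 (poisson_grad x y \<bullet> l))" using ig by (intro integrable_max) auto
  have "(\<integral>y. \<bar>poisson_grad x y \<bullet> l\<bar> \<partial>?M) = 2 * (\<integral>y. max 0 (poisson_grad x y \<bullet> l) \<partial>?M)"
    unfolding eq using ig ip poisson_grad_mean_zero[OF x, of l] by simp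
  also have "(\<integral>y. max 0 (poisson_grad x y \<bullet> l) \<partial>?M) = enn2real (\<integral>\<^sup>+y. ennreal (max 0 (poisson_grad x y \<bullet> l)) \<partial>?M)"
    using ip by (intro integral_eq_nn_integral) auto
  also have "(\<integral>\<^sup>+y. ennreal (max 0 (poisson_grad x y \<bullet> l)) \<partial>?M) = (\<integral>\<^sup>+y. ennreal (poisson_grad x y \<bullet> l) \<partial>?M)"
    by (intro nn_integral_cong) (simp add: max_def ennreal_neg)
  finally show ?thesis using optimal_coeff_poisson[OF x, of l] by simp
qed

subsection \<open>Spherical coordinates in two directions\<close>

text \<open>Substitution on each compact interval, followed by monotone convergence. The unions
  cover half-lines, the whole line and images that miss an endpoint, as the three substitutions
  below require.\<close>

lemma nn_integral_substitution_exhausting: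
  fixes f :: "real \<Rightarrow> ennreal" and g g' a' b' :: "_ \<Rightarrow> real"
  assumes f [measurable]: "f \<in> borel_measurable borel"
    and g [measurable]: "g \<in> borel_measurable borel" and g' [measurable]: "g' \<in> borel_measurable borel"
    and deriv: "\<And>x N. x \<in> {a N..b N} \<Longrightarrow> (g has_real_derivative g' x) (at x)"
    and cont: "\<And>N::nat. continuous_on {a N..b N} g'"
    and nonneg: "\<And>x N. x \<in> {a N..b N} \<Longrightarrow> 0 \<le> g' x"
    and ab: "\<And>N. a N \<le> b N" and dec: "decseq a" and inc: "incseq b"
  shows "(\<integral>\<^sup>+x. f x * indicator (\<Union>N. {g (a N)..g (b N)}) x \<partial>lborel) =
         (\<integral>\<^sup>+x. f (g x) * ennreal (g' x) * indicator (\<Union>N. {a N..b N}) x \<partial>lborel)"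
proof -
  have gmono: "g x \<le> g y" if "x \<in> {a N..b N}" "y \<in> {a N..b N}" "x \<le> y" for x y N
    by (rule DERIV_nonneg_imp_nondecreasing[OF that(3)]) (use that deriv nonneg in \<open>meson atLeastAtMost_iff order_trans\<close>)
  have step: "(\<integral>\<^sup>+x. f x * indicator {g (a N)..g (b N)} x \<partial>lborel) =
         (\<integral>\<^sup>+x. f (g x) * ennreal (g' x) * indicator {a N..b N} x \<partial>lborel)" for N
  proof -
    \<comment> \<open>Equality of these two measures extends the formula from indicator functions to
      every measurable extended-valued \<open>f\<close>.\<close>
    define \<mu> where "\<mu> = distr (density lborel (\<lambda>x. ennreal (g' x) * indicator {a N..b N} x)) borel g"
    define \<nu> where "\<nu> = density lborel (indicator {g (a N)..g (b N)} :: real \<Rightarrow> ennreal)"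
    have "\<mu> = \<nu>"
    proof (rule measure_eqI)
      fix A assume "A \<in> sets \<mu>"
      then have A [measurable]: "A \<in> sets borel" by (simp add: \<mu>_def)
      have "emeasure \<mu> A = (\<integral>\<^sup>+x. ennreal (g' x) * indicator {a N..b N} x * indicator (g -` A) x \<partial>lborel)"
        unfolding \<mu>_def using measurable_sets_borel[OF g A]
        by (simp add: emeasure_distr emeasure_density)
      also have "\<dots> = (\<integral>\<^sup>+x. ennreal (indicator A (g x) * g' x * indicator {a N..b N} x) \<partial>lborel)"
        by (intro nn_integral_cong) (auto simp: indicator_def)
      also have "\<dots> = (\<integral>\<^sup>+x. ennreal (indicator A x * indicator {g (a N)..g (b N)} x) \<partial>lborel)"
        by (rule nn_integral_substitution[symmetric])
           (use deriv cont nonneg ab in \<open>auto simp: set_borel_measurable_def\<close>)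
      also have "\<dots> = (\<integral>\<^sup>+x. indicator {g (a N)..g (b N)} x * indicator A x \<partial>lborel)"
        by (intro nn_integral_cong) (auto simp: indicator_def)
      also have "\<dots> = emeasure \<nu> A"
        by (simp add: \<nu>_def emeasure_density)
      finally show "emeasure \<mu> A = emeasure \<nu> A" .
    qed (simp add: \<mu>_def \<nu>_def)
    have "(\<integral>\<^sup>+x. f x * indicator {g (a N)..g (b N)} x \<partial>lborel) = (\<integral>\<^sup>+x. f x \<partial>\<nu>)"
      by (simp add: \<nu>_def nn_integral_density mult.commute)
    also have "\<dots> = (\<integral>\<^sup>+x. f x \<partial>\<mu>)" by (simp add: \<open>\<mu> = \<nu>\<close>)
    also have "\<dots> = (\<integral>\<^sup>+x. f (g x) * ennreal (g' x) * indicator {a N..b N} x \<partial>lborel)"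
      by (simp add: \<mu>_def nn_integral_distr nn_integral_density mult_ac)
    finally show ?thesis .
  qed
  have incI: "incseq (\<lambda>N. {a N..b N})"
    using dec inc by (auto simp: incseq_def decseq_def intro: order_trans)
  have incJ: "incseq (\<lambda>N. {g (a N)..g (b N)})"
  proof (rule incseq_SucI)
    fix N
    have "a (Suc N) \<le> a N" "b N \<le> b (Suc N)" using dec inc by (auto simp: decseq_Suc_iff incseq_Suc_iff)
    then have "g (a (Suc N)) \<le> g (a N)" "g (b N) \<le> g (b (Suc N))"
      using ab[of N] by (auto intro!: gmono[of _ "Suc N"])
    then show "{g (a N)..g (b N)} \<subseteq> {g (a (Suc N))..g (b (Suc N))}" by auto
  qed
  have ind_SUP: "(indicator (\<Union>N. I N) x :: ennreal) = (SUP N. indicator (I N) x)"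
    for I :: "nat \<Rightarrow> real set" and x
  proof (cases "x \<in> (\<Union>N. I N)")
    case True
    then obtain N where "x \<in> I N" by auto
    then have "(SUP N. indicator (I N) x :: ennreal) \<ge> 1"
      by (intro SUP_upper2[of N]) auto
    moreover have "(SUP N. indicator (I N) x :: ennreal) \<le> 1" by (auto intro!: SUP_least simp: indicator_def)
    ultimately have "(SUP N. indicator (I N) x :: ennreal) = 1" by (intro antisym)
    then show ?thesis using True by simp
  qed (simp add: indicator_def)
  have lim: "(\<integral>\<^sup>+x. h x * indicator (\<Union>N. I N) x \<partial>lborel) = (SUP N. \<integral>\<^sup>+x. h x * indicator (I N) x \<partial>lborel)"
    if [measurable]: "h \<in> borel_measurable borel" "\<And>N. I N \<in> sets borel" and "incseq I"
    for h :: "real \<Rightarrow> ennreal" and I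
  proof -
    have "(\<integral>\<^sup>+x. h x * indicator (\<Union>N. I N) x \<partial>lborel) = (\<integral>\<^sup>+x. (SUP N. h x * indicator (I N) x) \<partial>lborel)"
      by (simp only: ind_SUP SUP_mult_left_ennreal)
    also have "\<dots> = (SUP N. \<integral>\<^sup>+x. h x * indicator (I N) x \<partial>lborel)"
    proof (rule nn_integral_monotone_convergence_SUP)
      show "incseq (\<lambda>N x. h x * indicator (I N) x)"
        using \<open>incseq I\<close> unfolding incseq_def le_fun_def
        by (auto intro!: mult_left_mono simp: indicator_def)
    qed simp
    finally show ?thesis .
  qed
  show ?thesis
    by (subst (1 2) lim) (use incI incJ in \<open>auto simp: step\<close>)
qed

text \<open>Polar coordinates b = s t, q = s sqrt (1 - t^2) in the half-plane q > 0, with t the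
  cosine of the angle. The Jacobian s / sqrt (1 - t^2) times q^k gives the two weights. The change
  of variables is composed of one-dimensional substitutions, with v = b / q as intermediate
  variable.\<close>

lemma nn_integral_polar_step:
  fixes F :: "real \<Rightarrow> real \<Rightarrow> ennreal" and k :: nat
  assumes F: "(\<lambda>p. F (fst p) (snd p)) \<in> borel_measurable (borel \<Otimes>\<^sub>M borel)"
  shows "(\<integral>\<^sup>+q. \<integral>\<^sup>+b. F b (sqrt (b\<^sup>2 + q\<^sup>2)) * ennreal (q ^ k * indicator {0<..} q) \<partial>lborel \<partial>lborel) =
     (\<integral>\<^sup>+s. \<integral>\<^sup>+t. F (s * t) s * ennreal (s ^ (k + 1) * indicator {0<..} s) *
         ennreal ((1 - t\<^sup>2) powr ((real k - 1) / 2) * indicator {-1<..<1} t) \<partial>lborel \<partial>lborel)"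
proof -
  have Fm [measurable (raw)]: "(\<lambda>x. F (a x) (b x)) \<in> borel_measurable N"
    if [measurable]: "a \<in> borel_measurable N" "b \<in> borel_measurable N" for a b and N :: "'z measure"
    using measurable_compose[OF measurable_Pair[OF that] F] by simp
  let ?h = "\<lambda>t s. F (s * t) s * ennreal (s ^ (k + 1) * indicator {0<..} s) * ennreal ((1 - t\<^sup>2) powr ((real k - 1) / 2) * indicator {-1<..<1} t)"
  let ?f = "\<lambda>v s. F (s * (v / sqrt (1 + v\<^sup>2))) s * ennreal (s ^ (k + 1) * indicator {0<..} s) * ennreal (1 / sqrt (1 + v\<^sup>2) ^ (k + 2))"
  \<comment> \<open>At fixed \<open>q > 0\<close>, substitute \<open>b = q * v\<close>.\<close>
  have "(\<integral>\<^sup>+q. \<integral>\<^sup>+b. F b (sqrt (b\<^sup>2 + q\<^sup>2)) * ennreal (q ^ k * indicator {0<..} q) \<partial>lborel \<partial>lborel) =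
    (\<integral>\<^sup>+q. \<integral>\<^sup>+v. F (q * v) (q * sqrt (1 + v\<^sup>2)) * ennreal (q ^ (k + 1) * indicator {0<..} q) \<partial>lborel \<partial>lborel)"
  proof (rule nn_integral_cong)
    fix q :: real
    show "(\<integral>\<^sup>+b. F b (sqrt (b\<^sup>2 + q\<^sup>2)) * ennreal (q ^ k * indicator {0<..} q) \<partial>lborel) =
      (\<integral>\<^sup>+v. F (q * v) (q * sqrt (1 + v\<^sup>2)) * ennreal (q ^ (k + 1) * indicator {0<..} q) \<partial>lborel)"
    proof (cases "q > 0")
      case True
      have "sqrt ((q * v)\<^sup>2 + q\<^sup>2) = q * sqrt (1 + v\<^sup>2)" for v
      proof -
        have "(q * v)\<^sup>2 + q\<^sup>2 = q\<^sup>2 * (1 + v\<^sup>2)" by (simp add: algebra_simps power2_eq_square)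
        then show ?thesis using True by (simp add: real_sqrt_mult)
      qed
      moreover have "ennreal \<bar>q\<bar> * (X * ennreal (q ^ k * indicator {0<..} q)) =
          X * ennreal (q ^ (k + 1) * indicator {0<..} q)" for X
        using True by (simp add: ennreal_mult mult_ac)
      ultimately show ?thesis
        using True by (subst nn_integral_real_affine[where c = q and t = 0]) (simp_all add: nn_integral_cmult[symmetric])
    qed simp
  qed
  also have "\<dots> = (\<integral>\<^sup>+v. \<integral>\<^sup>+q. F (q * v) (q * sqrt (1 + v\<^sup>2)) * ennreal (q ^ (k + 1) * indicator {0<..} q) \<partial>lborel \<partial>lborel)"
    by (rule lborel_pair.Fubini') measurable
  \<comment> \<open>At fixed \<open>v\<close>, substitute
    \<open>s = q * sqrt (1 + v\<^sup>2)\<close>.\<close>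
  also have "\<dots> = (\<integral>\<^sup>+v. \<integral>\<^sup>+s. ?f v s \<partial>lborel \<partial>lborel)"
  proof (rule nn_integral_cong)
    fix v :: real
    define r where "r = sqrt (1 + v\<^sup>2)"
    have r: "r > 0" by (simp add: r_def add_pos_nonneg)
    have "ennreal \<bar>1 / r\<bar> * (X * ennreal ((s / r) ^ (k + 1) * indicator {0<..} (s / r))) =
       X * ennreal (s ^ (k + 1) * indicator {0<..} s) * ennreal (1 / r ^ (k + 2))" for X s
    proof (cases "s > 0")
      case True
      have "ennreal \<bar>1 / r\<bar> * (X * ennreal ((s / r) ^ (k + 1))) = X * ennreal ((1 / r) * (s / r) ^ (k + 1))"
        using r True by (subst ennreal_mult) (auto simp: mult_ac)
      also have "(1 / r) * (s / r) ^ (k + 1) = s ^ (k + 1) * (1 / r ^ (k + 2))"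
        using r by (simp add: power_divide field_simps)
      also have "X * ennreal \<dots> = X * ennreal (s ^ (k + 1)) * ennreal (1 / r ^ (k + 2))"
        using r True by (subst ennreal_mult) (auto simp: mult_ac)
      finally show ?thesis using r True by simp
    qed (use r in \<open>simp add: zero_less_divide_iff\<close>)
    then show "(\<integral>\<^sup>+q. F (q * v) (q * sqrt (1 + v\<^sup>2)) * ennreal (q ^ (k + 1) * indicator {0<..} q) \<partial>lborel) =
       (\<integral>\<^sup>+s. ?f v s \<partial>lborel)"
      using r unfolding r_def[symmetric]
      by (subst nn_integral_real_affine[where c = "1 / r" and t = 0])
         (simp_all add: nn_integral_cmult[symmetric] del: power_Suc)
  qed
  also have "\<dots> = (\<integral>\<^sup>+s. \<integral>\<^sup>+v. ?f v s \<partial>lborel \<partial>lborel)"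
    by (rule lborel_pair.Fubini') measurable
  \<comment> \<open>At fixed \<open>s\<close>, substitute
    \<open>t = v / sqrt (1 + v\<^sup>2)\<close>, an increasing map of the real line onto the open
    interval from -1 to 1.\<close>
  also have "\<dots> = (\<integral>\<^sup>+s. \<integral>\<^sup>+t. ?h t s \<partial>lborel \<partial>lborel)"
  proof (rule nn_integral_cong)
    fix s :: real
    define g where "g v = v / sqrt (1 + v\<^sup>2)" for v :: real
    define g' where "g' v = 1 / sqrt (1 + v\<^sup>2) ^ 3" for v :: real
    define f where "f t = F (s * t) s * ennreal (s ^ (k + 1) * indicator {0<..} s) * ennreal ((1 - t\<^sup>2) powr ((real k - 1) / 2))" for t
    have pos: "1 + v\<^sup>2 > 0" for v :: real by (simp add: add_pos_nonneg)
    have g2: "1 - (g v)\<^sup>2 = 1 / (1 + v\<^sup>2)" for v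
      using pos[of v] by (simp add: g_def power_divide field_simps)
    have un: "(\<Union>N::nat. {g (- real N)..g (real N)}) = {-1<..<1}"
    proof (intro equalityI subsetI)
      fix t assume "t \<in> (\<Union>N::nat. {g (- real N)..g (real N)})"
      then obtain N :: nat where N: "g (- real N) \<le> t" "t \<le> g (real N)" by auto
      have "g (real N) < 1" "- 1 < g (- real N)"
        using pos[of "real N"] by (auto simp: g_def divide_less_eq less_divide_eq real_less_rsqrt)
      then show "t \<in> {-1<..<1}" using N by auto
    next
      fix t :: real assume t: "t \<in> {-1<..<1}"
      then have t1: "t\<^sup>2 < 1" by (simp add: abs_square_less_1 abs_less_iff)
      obtain N :: nat where N: "\<bar>t\<bar> / sqrt (1 - t\<^sup>2) \<le> real N" using real_arch_simple by blast
      have "\<bar>t\<bar> \<le> g (real N)"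
      proof -
        have "t\<^sup>2 / (1 - t\<^sup>2) \<le> (real N)\<^sup>2"
          using power_mono[OF N, of 2] t1 by (simp add: power_divide)
        then have "t\<^sup>2 * (1 + (real N)\<^sup>2) \<le> (real N)\<^sup>2" using t1 by (simp add: field_simps)
        then have "t\<^sup>2 \<le> (real N)\<^sup>2 / (1 + (real N)\<^sup>2)" using pos[of "real N"] by (simp add: field_simps)
        also have "\<dots> = (g (real N))\<^sup>2" using pos[of "real N"] by (simp add: g_def power_divide)
        finally show ?thesis by (rule abs_le_square_iff[THEN iffD2, THEN order_trans]) (simp add: g_def)
      qed
      then have "t \<in> {g (- real N)..g (real N)}" by (auto simp: g_def abs_le_iff)
      then show "t \<in> (\<Union>N::nat. {g (- real N)..g (real N)})" by blast
    qed
    have un': "(\<Union>N::nat. {- real N..real N}) = UNIV"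
    proof (intro equalityI subsetI UNIV_I)
      fix x :: real
      obtain N :: nat where "\<bar>x\<bar> \<le> real N" using real_arch_simple by blast
      then have "x \<in> {- real N..real N}" by auto
      then show "x \<in> (\<Union>N::nat. {- real N..real N})" by blast
    qed
    have sub: "(\<integral>\<^sup>+x. f x * indicator (\<Union>N::nat. {g (- real N)..g (real N)}) x \<partial>lborel) =
         (\<integral>\<^sup>+x. f (g x) * ennreal (g' x) * indicator (\<Union>N::nat. {- real N..real N}) x \<partial>lborel)"
    proof (rule nn_integral_substitution_exhausting)
      show "(g has_real_derivative g' v) (at v)" for v
      proof -
        have s0: "sqrt (1 + v\<^sup>2) \<noteq> 0" using pos[of v] by simp
        show ?thesis unfolding g_def g'_def
          apply (rule derivative_eq_intros refl | use pos[of v] s0 in force)+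
          using pos[of v] s0 by (simp add: field_simps power3_eq_cube power2_eq_square)
      qed
      show "continuous_on {- real N..real N} g'" for N
        unfolding g'_def using pos by (intro continuous_intros) (auto simp: less_imp_neq[symmetric])
    qed (auto simp: f_def g_def g'_def decseq_def incseq_def)
    have "(\<integral>\<^sup>+v. ?f v s \<partial>lborel) = (\<integral>\<^sup>+v. f (g v) * ennreal (g' v) \<partial>lborel)"
    proof (rule nn_integral_cong)
      fix v :: real
      define r where "r = sqrt (1 + v\<^sup>2)"
      have r: "r > 0" "r\<^sup>2 = 1 + v\<^sup>2" using pos[of v] by (auto simp: r_def)
      \<comment> \<open>The weight in t contributes r^(1 - k) and the derivative of the substitution
        r^(-3), which together are the required r^(-(k + 2)).\<close>
      have "(1 / (1 + v\<^sup>2)) powr ((real k - 1) / 2) * (1 / r ^ 3) = 1 / r ^ (k + 2)"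
      proof -
        have "(1 / (1 + v\<^sup>2)) = r powr (- 2)" using r by (simp add: powr_minus powr_numeral divide_inverse)
        moreover have "(- 2) * ((real k - 1) / 2) = 1 - real k" by (simp add: field_simps)
        ultimately have "(1 / (1 + v\<^sup>2)) powr ((real k - 1) / 2) = r powr (1 - real k)" by (simp only: powr_powr)
        moreover have "1 / r ^ 3 = r powr (- 3)" using r by (simp add: powr_minus powr_numeral divide_inverse)
        moreover have "1 / r ^ (k + 2) = r powr (- real (k + 2))"
          using r(1) by (simp only: powr_minus powr_realpow divide_inverse mult_1)
        ultimately show ?thesis by (simp add: powr_add[symmetric])
      qed
      then have "ennreal ((1 / (1 + v\<^sup>2)) powr ((real k - 1) / 2)) * ennreal (1 / r ^ 3) = ennreal (1 / r ^ (k + 2))"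
        using r by (subst ennreal_mult[symmetric]) auto
      then show "?f v s = f (g v) * ennreal (g' v)"
        unfolding f_def g2 g'_def r_def[symmetric] unfolding g_def r_def[symmetric] by (simp only: mult.assoc)
    qed
    also have "\<dots> = (\<integral>\<^sup>+t. f t * indicator {-1<..<1} t \<partial>lborel)"
      using sub unfolding un un' by simp
    also have "\<dots> = (\<integral>\<^sup>+t. ?h t s \<partial>lborel)"
      by (intro nn_integral_cong) (auto simp: f_def indicator_def)
    finally show "(\<integral>\<^sup>+v. ?f v s \<partial>lborel) = (\<integral>\<^sup>+t. ?h t s \<partial>lborel)" .
  qed
  finally show ?thesis .
qed

text \<open>Both sides integrate \<open>f\<close> against measures with the same distribution
  function: a ball of radius r has volume V r^m, with derivative m V r^(m - 1). Half-lines determine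
  such measures.\<close>

lemma nn_integral_PiM_norm:
  fixes f :: "real \<Rightarrow> ennreal" and A :: "'i set"
  assumes A: "finite A" "card A = m" "m \<ge> 1" and f [measurable]: "f \<in> borel_measurable borel"
  shows "(\<integral>\<^sup>+x. f (sqrt (\<Sum>i\<in>A. (x i)\<^sup>2)) \<partial>Pi\<^sub>M A (\<lambda>_. lborel)) =
    (\<integral>\<^sup>+q. f q * ennreal (real m * unit_ball_vol m * q ^ (m - 1) * indicator {0<..} q) \<partial>lborel)"
proof -
  let ?P = "Pi\<^sub>M A (\<lambda>_. lborel :: real measure)"
  define V where "V = unit_ball_vol (real m)"
  have V: "V > 0" by (simp add: V_def)
  define N where "N x = sqrt (\<Sum>i\<in>A. (x i)\<^sup>2)" for x :: "'i \<Rightarrow> real"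
  have N [measurable]: "N \<in> borel_measurable ?P" unfolding N_def by measurable
  define \<mu> where "\<mu> = distr ?P borel N"
  define \<nu> where "\<nu> = density lborel (\<lambda>q. ennreal (real m * V * q ^ (m - 1) * indicator {0<..} q))"
  have mu_pos: "emeasure \<mu> {..r} = ennreal (V * r ^ m)" if "r > 0" for r
  proof -
    have "N -` {..r} \<inter> space ?P = {f. sqrt (\<Sum>i\<in>A. (f i)\<^sup>2) \<le> r} \<inter> space ?P"
      by (auto simp: N_def)
    then show ?thesis
      using emeasure_cball_aux[OF A(1) that] A(2) by (simp add: \<mu>_def emeasure_distr V_def)
  qed
  \<comment> \<open>The ball volume formula requires a positive radius, so nonpositive
    \<open>r\<close> is reached by comparison with small positive radii.\<close>
  have mu_nonpos: "emeasure \<mu> {..r} = 0" if "r \<le> 0" for r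
  proof -
    have "((\<lambda>e. ennreal (V * e ^ m)) \<longlongrightarrow> ennreal (V * 0 ^ m)) (at_right 0)"
      by (intro tendsto_ennrealI tendsto_intros)
    moreover have "\<forall>\<^sub>F e in at_right 0. emeasure \<mu> {..r} \<le> ennreal (V * e ^ m)"
      using that by (auto simp: eventually_at_right_field \<mu>_def simp flip: mu_pos intro!: exI[of _ 1] emeasure_mono)
    ultimately have "emeasure \<mu> {..r} \<le> ennreal (V * 0 ^ m)"
      by (rule tendsto_lowerbound) simp
    moreover have "(0::real) ^ m = 0" using A(3) by (simp add: power_0_left)
    ultimately show ?thesis by simp
  qed
  have nu: "emeasure \<nu> {..r} = (if r > 0 then ennreal (V * r ^ m) else 0)" for r
  proof (cases "r > 0")
    case True
    have "emeasure \<nu> {..r} = (\<integral>\<^sup>+q. ennreal (real m * V * q ^ (m - 1)) * indicator {0..r} q \<partial>lborel)"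
      unfolding \<nu>_def
      by (subst emeasure_density) (auto simp: indicator_def intro!: nn_integral_cong_AE eventually_mono[OF AE_lborel_singleton[of 0]])
    also have "\<dots> = ennreal (V * r ^ m - V * 0 ^ m)"
      by (rule nn_integral_FTC_Icc) (use True V in \<open>auto intro!: derivative_eq_intros\<close>)
    finally show ?thesis using True A(3) by (simp add: power_0_left)
  next
    case False
    have "emeasure \<nu> {..r} = (\<integral>\<^sup>+q. 0 \<partial>(lborel::real measure))"
      unfolding \<nu>_def using False
      by (subst emeasure_density, simp, simp, intro nn_integral_cong) (auto simp: indicator_def)
    then show ?thesis using False by simp
  qed
  have "\<mu> = \<nu>"
  proof (rule measure_eqI_generator_eq)
    show "Int_stable (range (atMost :: real \<Rightarrow> _))"
      by (auto simp: Int_stable_def)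
    show "range (\<lambda>n::nat. {..real n}) \<subseteq> range atMost" by auto
    show "(\<Union>n::nat. {..real n}) = UNIV" using real_arch_simple by blast
    show "emeasure \<mu> X = emeasure \<nu> X" if "X \<in> range atMost" for X
      using that by (auto simp: mu_pos mu_nonpos nu)
    show "emeasure \<mu> {..real n} \<noteq> \<infinity>" for n
      by (cases "real n > 0") (simp_all add: mu_pos mu_nonpos)
  qed (auto simp: \<mu>_def \<nu>_def borel_eq_atMost)
  have "(\<integral>\<^sup>+x. f (N x) \<partial>?P) = (\<integral>\<^sup>+q. f q \<partial>\<nu>)"
    by (simp add: \<open>\<mu> = \<nu>\<close>[symmetric] \<mu>_def nn_integral_distr)
  then show ?thesis
    by (simp add: \<nu>_def N_def V_def nn_integral_density mult.commute)
qed

text \<open>Lebesgue measure is a product over the basis. After the coordinates along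
  \<open>i\<close> and \<open>j\<close> are split off, the remaining \<open>m\<close> enter only
  through their Euclidean norm \<open>q\<close>.\<close>

lemma nn_integral_lborel_two_coordinates:
  fixes F :: "real \<Rightarrow> real \<Rightarrow> real \<Rightarrow> ennreal" and i j :: "'a::euclidean_space"
  assumes F: "(\<lambda>p. F (fst p) (fst (snd p)) (snd (snd p))) \<in> borel_measurable (borel \<Otimes>\<^sub>M borel \<Otimes>\<^sub>M borel)"
    and ij: "i \<in> Basis" "j \<in> Basis" "i \<noteq> j" and n: "DIM('a) = m + 2" "m \<ge> 1"
  shows "(\<integral>\<^sup>+y. F (y \<bullet> i) (y \<bullet> j) (norm y) \<partial>lborel) =
    (\<integral>\<^sup>+a. \<integral>\<^sup>+b. \<integral>\<^sup>+q. F a b (sqrt (a\<^sup>2 + (b\<^sup>2 + q\<^sup>2))) *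
        ennreal (real m * unit_ball_vol m * q ^ (m - 1) * indicator {0<..} q) \<partial>lborel \<partial>lborel \<partial>lborel)"
proof -
  have Fm [measurable (raw)]: "(\<lambda>x. F (a x) (b x) (c x)) \<in> borel_measurable N"
    if [measurable]: "a \<in> borel_measurable N" "b \<in> borel_measurable N" "c \<in> borel_measurable N"
    for a b c and N :: "'z measure"
    using measurable_compose[OF measurable_Pair[OF that(1) measurable_Pair[OF that(2,3)]] F] by simp
  interpret product_sigma_finite "\<lambda>_. lborel :: real measure"
    by standard
  define A where "A = Basis - {i, j}"
  have A: "finite A" "card A = m" "Basis = insert i (insert j A)" "i \<notin> insert j A" "j \<notin> A"
    using ij n by (auto simp: A_def card_Diff_subset)
  define S where "S f = (\<Sum>b\<in>A. (f b)\<^sup>2)" for f :: "'a \<Rightarrow> real"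
  have [measurable]: "S \<in> borel_measurable (Pi\<^sub>M A (\<lambda>_. lborel))" unfolding S_def by measurable
  define g where "g f = F (f i) (f j) (sqrt (\<Sum>b\<in>Basis. (f b)\<^sup>2))" for f :: "'a \<Rightarrow> real"
  have gm [measurable]: "g \<in> borel_measurable (Pi\<^sub>M (insert i (insert j A)) (\<lambda>_. lborel))"
    unfolding g_def A(3) by measurable
  have g_upd: "g ((x(j := b))(i := a)) = F a b (sqrt (a\<^sup>2 + (b\<^sup>2 + S x)))" for x a b
  proof -
    have "(\<Sum>c\<in>A. (((x(j := b))(i := a)) c)\<^sup>2) = S x"
      unfolding S_def using A(4,5) by (intro sum.cong) auto
    then show ?thesis using A(1,4,5) unfolding g_def A(3) using ij(3) by (simp add: ij(3)[symmetric])
  qed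
  have "(\<integral>\<^sup>+y. F (y \<bullet> i) (y \<bullet> j) (norm y) \<partial>lborel) = (\<integral>\<^sup>+f. g f \<partial>Pi\<^sub>M Basis (\<lambda>_. lborel))"
  proof -
    have eq: "F ((\<Sum>b\<in>Basis. f b *\<^sub>R b) \<bullet> i) ((\<Sum>b\<in>Basis. f b *\<^sub>R b) \<bullet> j) (norm (\<Sum>b\<in>Basis. f b *\<^sub>R b :: 'a)) = g f" for f
    proof -
      have "norm (\<Sum>b\<in>Basis. f b *\<^sub>R b :: 'a) = sqrt (\<Sum>b\<in>Basis. (f b)\<^sup>2)"
        by (subst norm_eq_sqrt_inner, subst euclidean_inner) (simp add: power2_eq_square)
      then show ?thesis using ij by (simp add: g_def)
    qed
    show ?thesis
      by (subst lborel_eq, subst nn_integral_distr) (simp_all add: eq)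
  qed
  also have "\<dots> = (\<integral>\<^sup>+a. \<integral>\<^sup>+x. g (x(i := a)) \<partial>Pi\<^sub>M (insert j A) (\<lambda>_. lborel) \<partial>lborel)"
    unfolding A(3) by (rule product_nn_integral_insert_rev[OF _ A(4) gm]) (use A(1) in simp)
  also have "\<dots> = (\<integral>\<^sup>+a. \<integral>\<^sup>+b. \<integral>\<^sup>+x. g ((x(j := b))(i := a)) \<partial>Pi\<^sub>M A (\<lambda>_. lborel) \<partial>lborel \<partial>lborel)"
  proof (intro nn_integral_cong product_nn_integral_insert_rev A)
    fix a :: real
    have "(\<lambda>x. x(i := a)) \<in> Pi\<^sub>M (insert j A) (\<lambda>_. lborel) \<rightarrow>\<^sub>M Pi\<^sub>M (insert i (insert j A)) (\<lambda>_. lborel)"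
      using measurable_fun_upd[where I = "insert i (insert j A)" and J = "insert j A" and i = i] by measurable
    then show "(\<lambda>x. g (x(i := a))) \<in> borel_measurable (Pi\<^sub>M (insert j A) (\<lambda>_. lborel))"
      by measurable
  qed
  \<comment> \<open>The sum of squares is written as the square of a norm so that
    \<open>nn_integral_PiM_norm\<close> applies.\<close>
  also have "\<dots> = (\<integral>\<^sup>+a. \<integral>\<^sup>+b. \<integral>\<^sup>+x. F a b (sqrt (a\<^sup>2 + (b\<^sup>2 + (sqrt (\<Sum>c\<in>A. (x c)\<^sup>2))\<^sup>2))) \<partial>Pi\<^sub>M A (\<lambda>_. lborel) \<partial>lborel \<partial>lborel)"
    unfolding g_upd by (simp add: S_def sum_nonneg)
  also have "\<dots> = (\<integral>\<^sup>+a. \<integral>\<^sup>+b. \<integral>\<^sup>+q. F a b (sqrt (a\<^sup>2 + (b\<^sup>2 + q\<^sup>2))) *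
        ennreal (real m * unit_ball_vol m * q ^ (m - 1) * indicator {0<..} q) \<partial>lborel \<partial>lborel \<partial>lborel)"
    by (intro nn_integral_cong nn_integral_PiM_norm A n(2)) measurable
  finally show ?thesis .
qed

lemma omega_eq_unit_ball_vol:
  assumes "k > 0"
  shows "omega k = real k * unit_ball_vol (real k)"
proof -
  have "real k / 2 \<notin> \<int>\<^sub>\<le>\<^sub>0" using assms by (auto dest: nonpos_Ints_nonpos)
  then have G: "Gamma (real k / 2 + 1) = real k / 2 * Gamma (real k / 2)" by (rule Gamma_plus1)
  show ?thesis unfolding omega_def unit_ball_vol_def G using assms by simp
qed

lemma omega_pos: "k > 0 \<Longrightarrow> omega k > 0"
  by (simp add: omega_eq_unit_ball_vol)

text \<open>Two polar steps: (b, q) becomes (s, t) with exponent m - 1, then (a, s) becomes (R, c)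
  with exponent m. The integrand does not depend on the radius, which contributes the integral of
  R^(m + 1) over the unit interval, namely 1 / (m + 2).\<close>

lemma nn_integral_lborel_two_directions:
  fixes \<phi> :: "real \<Rightarrow> real \<Rightarrow> ennreal" and i j :: "'a::euclidean_space"
  assumes \<phi>: "(\<lambda>p. \<phi> (fst p) (snd p)) \<in> borel_measurable (borel \<Otimes>\<^sub>M borel)"
    and ij: "i \<in> Basis" "j \<in> Basis" "i \<noteq> j" and n: "DIM('a) = m + 2" "m \<ge> 1"
  shows "(\<integral>\<^sup>+y. \<phi> (sgn y \<bullet> i) (sgn y \<bullet> j) * indicator (ball 0 1) y \<partial>lborel) =
    ennreal (omega m / real (m + 2)) *
    (\<integral>\<^sup>+t. (\<integral>\<^sup>+c. \<phi> c (sqrt (1 - c\<^sup>2) * t) * ennreal ((1 - c\<^sup>2) powr ((real m - 1) / 2) * indicator {-1<..<1} c) \<partial>lborel) *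
       ennreal ((1 - t\<^sup>2) powr ((real m - 2) / 2) * indicator {-1<..<1} t) \<partial>lborel)"
proof -
  have \<phi>m [measurable (raw)]: "(\<lambda>x. \<phi> (a x) (b x)) \<in> borel_measurable N"
    if [measurable]: "a \<in> borel_measurable N" "b \<in> borel_measurable N" for a b and N :: "'z measure"
    using measurable_compose[OF measurable_Pair[OF that] \<phi>] by simp
  \<comment> \<open>The integrand in terms of two coordinates and the norm \<open>R\<close>; the
    cutoff at 1 is the indicator of the ball.\<close>
  define F where "F a b R = \<phi> (a / R) (b / R) * indicator {..<1} R" for a b R :: real
  have Fm [measurable (raw)]: "(\<lambda>x. F (a x) (b x) (c x)) \<in> borel_measurable N"
    if [measurable]: "a \<in> borel_measurable N" "b \<in> borel_measurable N" "c \<in> borel_measurable N"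
    for a b c and N :: "'z measure"
    unfolding F_def by measurable
  define W where "W t = ennreal ((1 - t\<^sup>2) powr ((real m - 2) / 2) * indicator {-1<..<1} t)" for t :: real
  define W' where "W' t = ennreal ((1 - t\<^sup>2) powr ((real m - 1) / 2) * indicator {-1<..<1} t)" for t :: real
  have [measurable]: "W \<in> borel_measurable borel" "W' \<in> borel_measurable borel"
    unfolding W_def W'_def by measurable
  define C where "C = ennreal (omega m)"
  have C: "C = ennreal (real m * unit_ball_vol m)" using n by (simp add: C_def omega_eq_unit_ball_vol)
  have "(\<integral>\<^sup>+y. \<phi> (sgn y \<bullet> i) (sgn y \<bullet> j) * indicator (ball 0 1) y \<partial>lborel) =
     (\<integral>\<^sup>+y. F (y \<bullet> i) (y \<bullet> j) (norm y) \<partial>lborel)"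
    by (intro nn_integral_cong) (simp add: F_def sgn_div_norm indicator_def divide_inverse mult.commute)
  also have "\<dots> = (\<integral>\<^sup>+a. \<integral>\<^sup>+b. \<integral>\<^sup>+q. F a b (sqrt (a\<^sup>2 + (b\<^sup>2 + q\<^sup>2))) *
        ennreal (real m * unit_ball_vol m * q ^ (m - 1) * indicator {0<..} q) \<partial>lborel \<partial>lborel \<partial>lborel)"
    by (rule nn_integral_lborel_two_coordinates[OF _ ij n]) measurable
  also have "\<dots> = (\<integral>\<^sup>+a. \<integral>\<^sup>+b. \<integral>\<^sup>+q. C * (F a b (sqrt (a\<^sup>2 + (b\<^sup>2 + q\<^sup>2))) *
        ennreal (q ^ (m - 1) * indicator {0<..} q)) \<partial>lborel \<partial>lborel \<partial>lborel)"
  proof (intro nn_integral_cong)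
    fix a b q :: real
    have "ennreal (real m * unit_ball_vol m * q ^ (m - 1) * indicator {0<..} q) =
      C * ennreal (q ^ (m - 1) * indicator {0<..} q)"
      unfolding C by (subst ennreal_mult[symmetric]) (auto simp: indicator_def mult_ac)
    then show "F a b (sqrt (a\<^sup>2 + (b\<^sup>2 + q\<^sup>2))) *
        ennreal (real m * unit_ball_vol m * q ^ (m - 1) * indicator {0<..} q) =
        C * (F a b (sqrt (a\<^sup>2 + (b\<^sup>2 + q\<^sup>2))) * ennreal (q ^ (m - 1) * indicator {0<..} q))"
      by (simp add: mult_ac)
  qed
  also have "\<dots> = C * (\<integral>\<^sup>+a. \<integral>\<^sup>+b. \<integral>\<^sup>+q. F a b (sqrt (a\<^sup>2 + (b\<^sup>2 + q\<^sup>2))) *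
        ennreal (q ^ (m - 1) * indicator {0<..} q) \<partial>lborel \<partial>lborel \<partial>lborel)"
    by (simp add: nn_integral_cmult)
  also have "(\<integral>\<^sup>+a. \<integral>\<^sup>+b. \<integral>\<^sup>+q. F a b (sqrt (a\<^sup>2 + (b\<^sup>2 + q\<^sup>2))) *
        ennreal (q ^ (m - 1) * indicator {0<..} q) \<partial>lborel \<partial>lborel \<partial>lborel) =
    (\<integral>\<^sup>+a. \<integral>\<^sup>+s. \<integral>\<^sup>+t. F a (s * t) (sqrt (a\<^sup>2 + s\<^sup>2)) * ennreal (s ^ m * indicator {0<..} s) * W t
        \<partial>lborel \<partial>lborel \<partial>lborel)"
  proof (rule nn_integral_cong)
    fix a :: real
    have "(\<integral>\<^sup>+b. \<integral>\<^sup>+q. F a b (sqrt (a\<^sup>2 + (b\<^sup>2 + q\<^sup>2))) * ennreal (q ^ (m - 1) * indicator {0<..} q) \<partial>lborel \<partial>lborel)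
       = (\<integral>\<^sup>+q. \<integral>\<^sup>+b. F a b (sqrt (a\<^sup>2 + (b\<^sup>2 + q\<^sup>2))) * ennreal (q ^ (m - 1) * indicator {0<..} q) \<partial>lborel \<partial>lborel)"
      by (rule lborel_pair.Fubini') measurable
    also have "\<dots> = (\<integral>\<^sup>+q. \<integral>\<^sup>+b. F a b (sqrt (a\<^sup>2 + (sqrt (b\<^sup>2 + q\<^sup>2))\<^sup>2)) * ennreal (q ^ (m - 1) * indicator {0<..} q) \<partial>lborel \<partial>lborel)"
      by simp
    also have "\<dots> = (\<integral>\<^sup>+s. \<integral>\<^sup>+t. F a (s * t) (sqrt (a\<^sup>2 + s\<^sup>2)) * ennreal (s ^ (m - 1 + 1) * indicator {0<..} s) *
        ennreal ((1 - t\<^sup>2) powr ((real (m - 1) - 1) / 2) * indicator {-1<..<1} t) \<partial>lborel \<partial>lborel)"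
      by (rule nn_integral_polar_step[where F = "\<lambda>b s. F a b (sqrt (a\<^sup>2 + s\<^sup>2))"]) measurable
    finally show "(\<integral>\<^sup>+b. \<integral>\<^sup>+q. F a b (sqrt (a\<^sup>2 + (b\<^sup>2 + q\<^sup>2))) * ennreal (q ^ (m - 1) * indicator {0<..} q) \<partial>lborel \<partial>lborel)
       = (\<integral>\<^sup>+s. \<integral>\<^sup>+t. F a (s * t) (sqrt (a\<^sup>2 + s\<^sup>2)) * ennreal (s ^ m * indicator {0<..} s) * W t \<partial>lborel \<partial>lborel)"
      using n(2) by (simp add: W_def of_nat_diff)
  qed
  also have "\<dots> = (\<integral>\<^sup>+a. \<integral>\<^sup>+t. \<integral>\<^sup>+s. F a (s * t) (sqrt (a\<^sup>2 + s\<^sup>2)) * ennreal (s ^ m * indicator {0<..} s) * W t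
        \<partial>lborel \<partial>lborel \<partial>lborel)"
    by (intro nn_integral_cong lborel_pair.Fubini') measurable
  also have "\<dots> = (\<integral>\<^sup>+t. \<integral>\<^sup>+a. \<integral>\<^sup>+s. F a (s * t) (sqrt (a\<^sup>2 + s\<^sup>2)) * ennreal (s ^ m * indicator {0<..} s) * W t
        \<partial>lborel \<partial>lborel \<partial>lborel)"
    by (rule lborel_pair.Fubini') measurable
  also have "\<dots> = (\<integral>\<^sup>+t. \<integral>\<^sup>+s. \<integral>\<^sup>+a. F a (s * t) (sqrt (a\<^sup>2 + s\<^sup>2)) * ennreal (s ^ m * indicator {0<..} s) * W t
        \<partial>lborel \<partial>lborel \<partial>lborel)"
    by (intro nn_integral_cong lborel_pair.Fubini') measurable
  also have "\<dots> = (\<integral>\<^sup>+t. ennreal (1 / real (m + 2)) * ((\<integral>\<^sup>+c. \<phi> c (sqrt (1 - c\<^sup>2) * t) * W' c \<partial>lborel) * W t) \<partial>lborel)"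
  proof (rule nn_integral_cong)
    fix t :: real
    \<comment> \<open>For \<open>s > 0\<close> one has
      \<open>s = sqrt (R\<^sup>2 - a\<^sup>2)\<close>, which turns the integrand into a function of
      \<open>a\<close> and \<open>R\<close> as the polar step demands.\<close>
    let ?G = "\<lambda>a R. F a (sqrt (R\<^sup>2 - a\<^sup>2) * t) R"
    have "(\<integral>\<^sup>+s. \<integral>\<^sup>+a. F a (s * t) (sqrt (a\<^sup>2 + s\<^sup>2)) * ennreal (s ^ m * indicator {0<..} s) * W t \<partial>lborel \<partial>lborel)
      = (\<integral>\<^sup>+s. \<integral>\<^sup>+a. ?G a (sqrt (a\<^sup>2 + s\<^sup>2)) * ennreal (s ^ m * indicator {0<..} s) \<partial>lborel \<partial>lborel) * W t"
      by (subst nn_integral_multc[symmetric], measurable, intro nn_integral_cong,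
          subst nn_integral_multc[symmetric], measurable, intro nn_integral_cong) (auto simp: indicator_def)
    also have "(\<integral>\<^sup>+s. \<integral>\<^sup>+a. ?G a (sqrt (a\<^sup>2 + s\<^sup>2)) * ennreal (s ^ m * indicator {0<..} s) \<partial>lborel \<partial>lborel)
      = (\<integral>\<^sup>+R. \<integral>\<^sup>+c. ?G (R * c) R * ennreal (R ^ (m + 1) * indicator {0<..} R) * W' c \<partial>lborel \<partial>lborel)"
      unfolding W'_def by (rule nn_integral_polar_step) measurable
    also have "\<dots> = (\<integral>\<^sup>+R. \<integral>\<^sup>+c. \<phi> c (sqrt (1 - c\<^sup>2) * t) * W' c * ennreal (R ^ (m + 1) * indicator {0<..<1} R) \<partial>lborel \<partial>lborel)"
    proof (intro nn_integral_cong)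
      fix R c :: real
      have "?G (R * c) R = \<phi> c (sqrt (1 - c\<^sup>2) * t) * indicator {..<1} R" if "R > 0"
      proof -
        have "R\<^sup>2 - (R * c)\<^sup>2 = R\<^sup>2 * (1 - c\<^sup>2)" by (simp add: algebra_simps power_mult_distrib)
        then have "sqrt (R\<^sup>2 - (R * c)\<^sup>2) = R * sqrt (1 - c\<^sup>2)" using that by (simp add: real_sqrt_mult)
        then show ?thesis using that by (simp add: F_def)
      qed
      then show "?G (R * c) R * ennreal (R ^ (m + 1) * indicator {0<..} R) * W' c =
        \<phi> c (sqrt (1 - c\<^sup>2) * t) * W' c * ennreal (R ^ (m + 1) * indicator {0<..<1} R)"
        by (cases "R > 0") (auto simp: indicator_def mult_ac)
    qed
    also have "\<dots> = (\<integral>\<^sup>+c. \<phi> c (sqrt (1 - c\<^sup>2) * t) * W' c \<partial>lborel) * (\<integral>\<^sup>+R. ennreal (R ^ (m + 1) * indicator {0<..<1} R) \<partial>lborel)"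
      by (simp add: nn_integral_multc nn_integral_cmult)
    also have "(\<integral>\<^sup>+R. ennreal (R ^ (m + 1) * indicator {0<..<1} R) \<partial>lborel) = (\<integral>\<^sup>+R. ennreal (R ^ (m + 1)) * indicator {0..1} R \<partial>lborel)"
      by (intro nn_integral_cong_AE AE_I[of _ _ "{0, 1}"]) (auto simp: indicator_def emeasure_lborel_countable)
    also have "\<dots> = ennreal (1 ^ (m + 2) / real (m + 2) - 0 ^ (m + 2) / real (m + 2))"
    proof (rule nn_integral_FTC_Icc)
      show "((\<lambda>R. R ^ (m + 2) / real (m + 2)) has_real_derivative R ^ (m + 1)) (at R)" for R :: real
        using DERIV_cdivide[OF DERIV_pow[of "m + 2" R], of "real (m + 2)"] by (simp del: of_nat_add)
    qed auto
    finally show "(\<integral>\<^sup>+s. \<integral>\<^sup>+a. F a (s * t) (sqrt (a\<^sup>2 + s\<^sup>2)) * ennreal (s ^ m * indicator {0<..} s) * W t \<partial>lborel \<partial>lborel)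
      = ennreal (1 / real (m + 2)) * ((\<integral>\<^sup>+c. \<phi> c (sqrt (1 - c\<^sup>2) * t) * W' c \<partial>lborel) * W t)"
      by (simp add: mult_ac)
  qed
  also have "\<dots> = ennreal (1 / real (m + 2)) * (\<integral>\<^sup>+t. (\<integral>\<^sup>+c. \<phi> c (sqrt (1 - c\<^sup>2) * t) * W' c \<partial>lborel) * W t \<partial>lborel)"
    by (rule nn_integral_cmult) measurable
  finally show ?thesis
    unfolding W_def W'_def C_def mult.assoc[symmetric]
    using omega_pos[of m] n(2) by (subst (asm) ennreal_mult[symmetric]) (auto simp: mult_ac)
qed

text \<open>A rotation moves \<open>u\<close> and \<open>e\<close> to basis vectors. Dividing by the
  volume of the ball turns the constant into a quotient of sphere areas, because the area is the
  dimension times that volume.\<close>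

proposition nn_integral_sphere_two_directions:
  fixes \<phi> :: "real \<Rightarrow> real \<Rightarrow> ennreal" and u e :: "'a::euclidean_space"
  assumes \<phi>: "(\<lambda>p. \<phi> (fst p) (snd p)) \<in> borel_measurable (borel \<Otimes>\<^sub>M borel)"
    and ue: "norm u = 1" "norm e = 1" "u \<bullet> e = 0" and n: "DIM('a) = m + 2" "m \<ge> 1"
  shows "(\<integral>\<^sup>+y. \<phi> (y \<bullet> u) (y \<bullet> e) \<partial>sphere_measure) =
    ennreal (omega m / omega (m + 2)) *
    (\<integral>\<^sup>+t. (\<integral>\<^sup>+c. \<phi> c (sqrt (1 - c\<^sup>2) * t) * ennreal ((1 - c\<^sup>2) powr ((real m - 1) / 2) * indicator {-1<..<1} c) \<partial>lborel) *
       ennreal ((1 - t\<^sup>2) powr ((real m - 2) / 2) * indicator {-1<..<1} t) \<partial>lborel)" (is "?l = _ * ?I")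
proof -
  have \<phi>m [measurable (raw)]: "(\<lambda>x. \<phi> (a x) (b x)) \<in> borel_measurable N"
    if [measurable]: "a \<in> borel_measurable N" "b \<in> borel_measurable N" for a b and N :: "'z measure"
    using measurable_compose[OF measurable_Pair[OF that] \<phi>] by simp
  have "\<not> card (Basis :: 'a set) \<le> 1" using n by simp
  then obtain i j :: 'a where ij: "i \<in> Basis" "j \<in> Basis" "i \<noteq> j"
    by (metis card_le_Suc0_iff_eq finite_Basis One_nat_def)
  obtain T where T: "orthogonal_transformation T" "T i = u" "T j = e"
    using orthogonal_transformation_pair[of i j u e] ij ue by (auto simp: inner_not_same_Basis)
  let ?V = "ennreal (unit_ball_vol DIM('a))"
  have V: "?V \<noteq> 0" "?V \<noteq> top"
    using unit_ball_vol_pos[of "real DIM('a)"] by (auto simp: ennreal_eq_0_iff not_le simp del: unit_ball_vol_pos)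
  have "?l = (\<integral>\<^sup>+y. \<phi> (T y \<bullet> u) (T y \<bullet> e) \<partial>sphere_measure)"
    by (rule sphere_measure_orthogonal[OF T(1), symmetric]) measurable
  also have "\<dots> = (\<integral>\<^sup>+y. \<phi> (y \<bullet> i) (y \<bullet> j) \<partial>sphere_measure)"
    using T by (intro nn_integral_cong) (metis orthogonal_transformation_def)
  finally have "?l * ?V = (\<integral>\<^sup>+y. \<phi> (y \<bullet> i) (y \<bullet> j) \<partial>sphere_measure) * ?V" by simp
  also have "\<dots> = (\<integral>\<^sup>+y. \<phi> (sgn y \<bullet> i) (sgn y \<bullet> j) * indicator (ball 0 1) y \<partial>lborel)"
    by (rule nn_integral_sphere_measure) measurable
  also have "\<dots> = ennreal (omega m / real (m + 2)) * ?I"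
    by (rule nn_integral_lborel_two_directions[OF \<phi> ij n])
  also have "\<dots> = (ennreal (omega m / omega (m + 2)) * ?I) * ?V"
  proof -
    have "ennreal (omega m / real (m + 2)) = ennreal (omega m / omega (m + 2)) * ?V"
    proof (subst ennreal_mult[symmetric])
      have "unit_ball_vol (real (m + 2)) \<noteq> 0" using unit_ball_vol_pos[of "real (m + 2)"] by linarith
      then show "ennreal (omega m / real (m + 2)) = ennreal (omega m / omega (m + 2) * unit_ball_vol (real DIM('a)))"
        unfolding n(1) omega_eq_unit_ball_vol[of "m + 2", OF zero_less_numeral[THEN trans_less_add2]]
        by (simp del: of_nat_add)
    qed (use omega_pos[of m] omega_pos[of "m + 2"] n in auto)
    then show ?thesis by (simp add: mult_ac)
  qed
  finally show ?thesis using ennreal_mult_right_cancel[OF _ V] by blast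
qed

subsection \<open>The half-angle substitution\<close>

text \<open>The angle between lines does not distinguish \<open>l\<close> from \<open>- l\<close>;
  this allows a nonnegative inner product with the radial direction to be assumed.\<close>

lemma optimal_coeff_uminus: "optimal_coeff x (- l) C \<longleftrightarrow> optimal_coeff x l C"
  by (simp add: optimal_coeff_def admissible_coeff_def)

lemma unit_vector_decomposition:
  fixes u l :: "'a::euclidean_space"
  assumes u: "norm u = 1" and l: "norm l = 1" and n: "DIM('a) \<ge> 2"
  obtains e s where "norm e = 1" "u \<bullet> e = 0" "l = (u \<bullet> l) *\<^sub>R u + s *\<^sub>R e" "s \<ge> 0" "(u \<bullet> l)\<^sup>2 + s\<^sup>2 = 1"
proof -
  define v where "v = l - (u \<bullet> l) *\<^sub>R u"
  have uu: "u \<bullet> u = 1" and ll: "l \<bullet> l = 1" using u l by (simp_all add: dot_square_norm)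
  have uv: "u \<bullet> v = 0" by (simp add: v_def inner_diff_right uu)
  have s1: "(u \<bullet> l)\<^sup>2 + (norm v)\<^sup>2 = 1"
  proof -
    have "v \<bullet> v = 1 - (u \<bullet> l)\<^sup>2"
      by (simp add: v_def inner_diff_left inner_diff_right uu ll inner_commute[of l u] power2_eq_square)
    then show ?thesis by (simp add: dot_square_norm)
  qed
  show thesis
  proof (cases "v = 0")
    \<comment> \<open>When \<open>l\<close> is parallel to \<open>u\<close>, any unit vector
      orthogonal to \<open>u\<close> serves, with coefficient 0.\<close>
    case True
    obtain w where w: "w \<noteq> 0" "orthogonal u w" using orthogonal_to_vector_exists[OF n] by blast
    show thesis
      by (rule that[of "sgn w" 0]) (use w True s1 in \<open>auto simp: norm_sgn orthogonal_def sgn_div_norm v_def\<close>)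
  next
    case False
    show thesis
      by (rule that[of "sgn v" "norm v"]) (use False uv s1 in \<open>auto simp: norm_sgn sgn_div_norm v_def\<close>)
  qed
qed

lemma half_angle_pos:
  fixes k w :: real
  shows "1 + k\<^sup>2 * w\<^sup>2 > 0" "1 + w\<^sup>2 > 0"
  by (simp_all add: add_pos_nonneg)

text \<open>With c = cos \<theta> and k w = tan (\<theta> / 2), both cos \<theta> and sin \<theta>
  are rational in w. Passing the sine as a separate argument of \<open>F\<close> removes the square
  root.\<close>

lemma nn_integral_half_angle_substitution:
  fixes F :: "real \<Rightarrow> real \<Rightarrow> ennreal" and k :: real
  assumes F: "(\<lambda>p. F (fst p) (snd p)) \<in> borel_measurable (borel \<Otimes>\<^sub>M borel)" and k: "k > 0"
  shows "(\<integral>\<^sup>+c. F c (sqrt (1 - c\<^sup>2)) * indicator {-1<..<1} c \<partial>lborel) =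
    (\<integral>\<^sup>+w. F ((1 - k\<^sup>2 * w\<^sup>2) / (1 + k\<^sup>2 * w\<^sup>2)) (2 * k * w / (1 + k\<^sup>2 * w\<^sup>2)) *
       ennreal (4 * k\<^sup>2 * w / (1 + k\<^sup>2 * w\<^sup>2)\<^sup>2) * indicator {0..} w \<partial>lborel)"
proof -
  have Fm [measurable (raw)]: "(\<lambda>x. F (a x) (b x)) \<in> borel_measurable N"
    if [measurable]: "a \<in> borel_measurable N" "b \<in> borel_measurable N" for a b and N :: "'z measure"
    using measurable_compose[OF measurable_Pair[OF that] F] by simp
  note pos = half_angle_pos(1)[of k]
  \<comment> \<open>The negative of the cosine: the substitution rule wants an increasing map, and
    the cosine decreases in \<open>w\<close>. The sign is undone by reflecting the integration
    variable.\<close>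
  define g where "g w = (k\<^sup>2 * w\<^sup>2 - 1) / (1 + k\<^sup>2 * w\<^sup>2)" for w
  define g' where "g' w = 4 * k\<^sup>2 * w / (1 + k\<^sup>2 * w\<^sup>2)\<^sup>2" for w
  define f where "f c = F (- c) (sqrt (1 - c\<^sup>2))" for c
  have [measurable]: "f \<in> borel_measurable borel" "g \<in> borel_measurable borel" "g' \<in> borel_measurable borel"
    unfolding f_def[abs_def] g_def[abs_def] g'_def[abs_def] by measurable
  have g1: "g w = 1 - 2 / (1 + k\<^sup>2 * w\<^sup>2)" for w
    using pos[of w] by (simp add: g_def field_simps)
  have un: "(\<Union>N::nat. {g 0..g (real N)}) = {-1..<1}"
  proof (intro equalityI subsetI)
    fix c assume "c \<in> (\<Union>N::nat. {g 0..g (real N)})"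
    then obtain N :: nat where N: "g 0 \<le> c" "c \<le> g (real N)" by auto
    have "g (real N) < 1" using pos[of "real N"] by (simp add: g1)
    then show "c \<in> {-1..<1}" using N by (simp add: g_def)
  next
    fix c :: real assume c: "c \<in> {-1..<1}"
    obtain N :: nat where N: "2 / (1 - c) / k\<^sup>2 \<le> real N" using real_arch_simple by blast
    \<comment> \<open>This turns the linear bound supplied by the Archimedean property into the
      quadratic one needed for \<open>g\<close>.\<close>
    have "real N \<le> (real N)\<^sup>2" by (cases N) (auto simp: power2_eq_square)
    with N have "2 / (1 - c) / k\<^sup>2 \<le> (real N)\<^sup>2" by linarith
    then have "2 / (1 - c) \<le> (real N)\<^sup>2 * k\<^sup>2" using k by (subst (asm) pos_divide_le_eq) auto
    then have "2 / (1 - c) \<le> 1 + k\<^sup>2 * (real N)\<^sup>2" by (simp add: mult.commute)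
    then have "2 \<le> (1 + k\<^sup>2 * (real N)\<^sup>2) * (1 - c)" using c by (subst (asm) pos_divide_le_eq) auto
    then have "2 / (1 + k\<^sup>2 * (real N)\<^sup>2) \<le> 1 - c"
      using pos[of "real N"] by (subst pos_divide_le_eq) (auto simp: mult.commute)
    then have "c \<le> g (real N)" by (simp add: g1)
    moreover have "g 0 \<le> c" using c by (simp add: g_def)
    ultimately show "c \<in> (\<Union>N::nat. {g 0..g (real N)})" by auto
  qed
  have un': "(\<Union>N::nat. {0..real N}) = {0..}"
    using real_arch_simple by auto
  have sub: "(\<integral>\<^sup>+c. f c * indicator (\<Union>N::nat. {g 0..g (real N)}) c \<partial>lborel) =
         (\<integral>\<^sup>+w. f (g w) * ennreal (g' w) * indicator (\<Union>N::nat. {0..real N}) w \<partial>lborel)"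
  proof (rule nn_integral_substitution_exhausting)
    show "(g has_real_derivative g' w) (at w)" for w
    proof -
      have "((\<lambda>w. 1 - 2 / (1 + k\<^sup>2 * w\<^sup>2)) has_real_derivative g' w) (at w)"
        by (rule derivative_eq_intros refl | use pos[of w] in force)+
           (simp add: g'_def power2_eq_square)
      then show ?thesis by (simp add: g1[abs_def])
    qed
    show "continuous_on {0..real N} g'" for N
      unfolding g'_def using pos by (intro continuous_intros) (auto simp: less_imp_neq[symmetric])
  qed (auto simp: g'_def decseq_def incseq_def)
  have "(\<integral>\<^sup>+c. F c (sqrt (1 - c\<^sup>2)) * indicator {-1<..<1} c \<partial>lborel) =
    (\<integral>\<^sup>+c. f c * indicator {-1<..<1} c \<partial>lborel)"
    by (subst nn_integral_real_affine[where c = "-1" and t = 0])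
       (auto simp: f_def indicator_def intro!: nn_integral_cong)
  also have "\<dots> = (\<integral>\<^sup>+c. f c * indicator {-1..<1} c \<partial>lborel)"
    by (intro nn_integral_cong_AE AE_I[of _ _ "{-1}"]) (auto simp: indicator_def)
  also have "\<dots> = (\<integral>\<^sup>+w. f (g w) * ennreal (g' w) * indicator {0..} w \<partial>lborel)"
    using sub unfolding un un' .
  also have "\<dots> = (\<integral>\<^sup>+w. F ((1 - k\<^sup>2 * w\<^sup>2) / (1 + k\<^sup>2 * w\<^sup>2)) (2 * k * w / (1 + k\<^sup>2 * w\<^sup>2)) *
       ennreal (4 * k\<^sup>2 * w / (1 + k\<^sup>2 * w\<^sup>2)\<^sup>2) * indicator {0..} w \<partial>lborel)"
  proof (rule nn_integral_cong)
    fix w :: real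
    have "- g w = (1 - k\<^sup>2 * w\<^sup>2) / (1 + k\<^sup>2 * w\<^sup>2)" by (simp add: g_def minus_divide_left)
    moreover have "sqrt (1 - (g w)\<^sup>2) = 2 * k * w / (1 + k\<^sup>2 * w\<^sup>2)" if "w \<ge> 0"
    proof -
      have "1 - (g w)\<^sup>2 = (2 * k * w / (1 + k\<^sup>2 * w\<^sup>2))\<^sup>2"
        using pos[of w] by (simp add: g_def power_divide field_simps) (simp add: power2_eq_square algebra_simps)
      then show ?thesis using that k pos[of w] by simp
    qed
    ultimately show "f (g w) * ennreal (g' w) * indicator {0..} w = F ((1 - k\<^sup>2 * w\<^sup>2) / (1 + k\<^sup>2 * w\<^sup>2)) (2 * k * w / (1 + k\<^sup>2 * w\<^sup>2)) *
       ennreal (4 * k\<^sup>2 * w / (1 + k\<^sup>2 * w\<^sup>2)\<^sup>2) * indicator {0..} w"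
      by (auto simp: f_def g'_def indicator_def)
  qed
  finally show ?thesis .
qed

text \<open>
  The directional derivative of the Poisson kernel at \<open>\<rho> u\<close> in direction \<open>c u + s e\<close>, as a function of
  the components \<open>a\<close>, \<open>b\<close> of \<open>y\<close> along the orthonormal vectors \<open>u\<close>, \<open>e\<close>.
\<close>

definition radial_profile :: "nat \<Rightarrow> real \<Rightarrow> real \<Rightarrow> real \<Rightarrow> real \<Rightarrow> real \<Rightarrow> real" where
  "radial_profile n \<rho> c s a b =
     - 2 * (1 - 2 * \<rho> * a + \<rho>\<^sup>2) powr (- real n / 2) * (\<rho> * c) +
     real n * (1 - \<rho>\<^sup>2) * (1 - 2 * \<rho> * a + \<rho>\<^sup>2) powr (- real n / 2 - 1) * (c * a + s * b - \<rho> * c)"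

lemma poisson_grad_eq_radial_profile:
  fixes u e y :: "'a::euclidean_space"
  assumes "norm u = 1" "norm e = 1" "u \<bullet> e = 0" "norm y = 1"
  shows "poisson_grad (\<rho> *\<^sub>R u) y \<bullet> (c *\<^sub>R u + s *\<^sub>R e) = radial_profile DIM('a) \<rho> c s (y \<bullet> u) (y \<bullet> e)"
proof -
  have 1: "u \<bullet> u = 1" "y \<bullet> y = 1" using assms by (simp_all add: dot_square_norm)
  have N: "(y - \<rho> *\<^sub>R u) \<bullet> (y - \<rho> *\<^sub>R u) = 1 - 2 * \<rho> * (y \<bullet> u) + \<rho>\<^sup>2"
    by (simp add: inner_diff_left inner_diff_right 1 inner_commute[of u y] power2_eq_square algebra_simps)
  have l: "u \<bullet> (c *\<^sub>R u + s *\<^sub>R e) = c" "(y - \<rho> *\<^sub>R u) \<bullet> (c *\<^sub>R u + s *\<^sub>R e) = c * (y \<bullet> u) + s * (y \<bullet> e) - \<rho> * c"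
    using assms(3) by (simp_all add: inner_add_right inner_diff_left 1 algebra_simps)
  show ?thesis
    unfolding poisson_grad_def N radial_profile_def inner_add_left inner_scaleR_left l
    by (simp add: 1 power2_eq_square algebra_simps)
qed

lemma kappa_pos: "0 \<le> \<rho> \<Longrightarrow> \<rho> < 1 \<Longrightarrow> kappa \<rho> > 0"
  by (simp add: kappa_def)

text \<open>Three identities drive the computation: \<kappa> (1 + \<rho>) = 1 - \<rho>, the formula
  for |y - x|^2 in \<open>ND\<close>, and the reduction of the kernel's bracket to a quadratic in
  \<open>w\<close>. What remains is bookkeeping of powers.\<close>

lemma radial_profile_half_angle:
  fixes \<rho> c s t w :: real and m :: nat
  assumes \<rho>: "0 \<le> \<rho>" "\<rho> < 1" and w: "w > 0" and m: "m \<ge> 1"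
  defines "k \<equiv> kappa \<rho>" and "n \<equiv> m + 2"
  shows "radial_profile n \<rho> c s ((1 - k\<^sup>2 * w\<^sup>2) / (1 + k\<^sup>2 * w\<^sup>2)) (2 * k * w / (1 + k\<^sup>2 * w\<^sup>2) * t) *
       ((2 * k * w / (1 + k\<^sup>2 * w\<^sup>2))\<^sup>2 powr ((real m - 1) / 2)) * (4 * k\<^sup>2 * w / (1 + k\<^sup>2 * w\<^sup>2)\<^sup>2) =
     2 ^ n / ((1 - \<rho>) * (1 + \<rho>) ^ (n - 1)) *
       ((c * (real n - beta n \<rho> - beta n \<rho> * w\<^sup>2) + real n * s * t * w) * w ^ m / denom n \<rho> w)"
proof -
  define D where "D = 1 + k\<^sup>2 * w\<^sup>2"
  define E where "E = 1 + w\<^sup>2"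
  have D: "D > 0" and E: "E > 0" using half_angle_pos by (simp_all add: D_def E_def)
  have k: "k > 0" using \<rho> by (simp add: k_def kappa_pos)
  have k\<rho>: "k * (1 + \<rho>) = 1 - \<rho>" using \<rho> by (simp add: k_def kappa_def)
  define a where "a = (1 - k\<^sup>2 * w\<^sup>2) / D"
  define N where "N = 1 - 2 * \<rho> * a + \<rho>\<^sup>2"
  define Q where "Q = c * (real n - beta n \<rho> - beta n \<rho> * w\<^sup>2) + real n * s * t * w"
  have aD: "a * D = 1 - k\<^sup>2 * w\<^sup>2" using D by (simp add: a_def)
  have k2: "k\<^sup>2 * (1 + \<rho>)\<^sup>2 = (1 - \<rho>)\<^sup>2" using k\<rho> by (simp add: power_mult_distrib[symmetric])
  \<comment> \<open>Here \<open>N\<close> is |y - x|^2. The choice of \<kappa> equalises the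
    coefficients of 1 and w^2, so that \<open>E\<close> splits off.\<close>
  have ND: "N * D = (1 - \<rho>)\<^sup>2 * E"
  proof -
    have "N * D = (1 + \<rho>\<^sup>2) * D - 2 * \<rho> * (a * D)" by (simp add: N_def algebra_simps)
    also have "\<dots> = (1 - \<rho>)\<^sup>2 + k\<^sup>2 * (1 + \<rho>)\<^sup>2 * w\<^sup>2"
      unfolding aD unfolding D_def by (simp add: power2_eq_square algebra_simps)
    also have "\<dots> = (1 - \<rho>)\<^sup>2 * E" unfolding k2 by (simp add: E_def algebra_simps)
    finally show ?thesis .
  qed
  then have N: "N = (1 - \<rho>)\<^sup>2 * E / D" using D by (simp add: field_simps)
  have N0: "N > 0" unfolding N using \<rho> D E by simp
  \<comment> \<open>The factor left after extracting \<open>N powr (- real n / 2 - 1)\<close>; it is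
    cleared of the denominator \<open>D\<close> and compared coefficientwise with
    \<open>Q\<close>.\<close>
  have bracket: "- 2 * N * (\<rho> * c) + real n * (1 - \<rho>\<^sup>2) * (c * a + s * (2 * k * w / D * t) - \<rho> * c) = 2 * (1 - \<rho>)\<^sup>2 * Q / D"
  proof -
    have \<beta>: "2 * beta n \<rho> = real n - (real n - 2) * \<rho>" by (simp add: beta_def)
    have kk: "k\<^sup>2 * (1 + \<rho>) * (1 + \<rho>) = (1 - \<rho>)\<^sup>2" using k2 by (simp add: power2_eq_square mult_ac)
    have A: "(1 - \<rho>\<^sup>2) * (a * D - \<rho> * D) = (1 - \<rho>)\<^sup>2 * (1 + \<rho> - (1 - \<rho>) * w\<^sup>2)"
    proof -
      have "(1 - \<rho>\<^sup>2) * (a * D - \<rho> * D) = (1 - \<rho>) * ((1 + \<rho>) * (1 - \<rho>) - (k\<^sup>2 * (1 + \<rho>) * (1 + \<rho>)) * w\<^sup>2)"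
        unfolding aD unfolding D_def by (simp add: power2_eq_square algebra_simps)
      also have "\<dots> = (1 - \<rho>)\<^sup>2 * (1 + \<rho> - (1 - \<rho>) * w\<^sup>2)"
        unfolding kk by (simp add: power2_eq_square algebra_simps)
      finally show ?thesis .
    qed
    have B: "(1 - \<rho>\<^sup>2) * k = (1 - \<rho>)\<^sup>2"
    proof -
      have "(1 - \<rho>\<^sup>2) * k = (1 - \<rho>) * (k * (1 + \<rho>))" by (simp add: power2_eq_square algebra_simps)
      then show ?thesis unfolding k\<rho> by (simp add: power2_eq_square)
    qed
    have "(- 2 * N * (\<rho> * c) + real n * (1 - \<rho>\<^sup>2) * (c * a + s * (2 * k * w / D * t) - \<rho> * c)) * D
      = - 2 * (N * D) * (\<rho> * c) + real n * c * ((1 - \<rho>\<^sup>2) * (a * D - \<rho> * D)) + 2 * real n * s * w * t * ((1 - \<rho>\<^sup>2) * k)"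
      using D by (simp add: field_simps)
    also have "\<dots> = (1 - \<rho>)\<^sup>2 * (c * (real n * (1 + \<rho> - (1 - \<rho>) * w\<^sup>2) - 2 * \<rho> * E) + 2 * real n * s * w * t)"
      unfolding ND A B by (simp add: algebra_simps)
    also have "real n * (1 + \<rho> - (1 - \<rho>) * w\<^sup>2) - 2 * \<rho> * E = 2 * real n - 2 * beta n \<rho> - 2 * beta n \<rho> * w\<^sup>2"
      unfolding \<beta> E_def by (simp add: algebra_simps)
    also have "(1 - \<rho>)\<^sup>2 * (c * (2 * real n - 2 * beta n \<rho> - 2 * beta n \<rho> * w\<^sup>2) + 2 * real n * s * w * t) = 2 * (1 - \<rho>)\<^sup>2 * Q"
      by (simp add: Q_def algebra_simps)
    finally show ?thesis using D by (simp add: eq_divide_eq)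
  qed
  have N1: "N powr (- real n / 2) = N powr (- real n / 2 - 1) * N"
    using N0 by (simp add: powr_diff)
  have pull: "- 2 * (P * N) * z + A * P * X = P * (- 2 * N * z + A * X)" for P A X z :: real
    by (simp add: algebra_simps)
  have prof: "radial_profile n \<rho> c s a (2 * k * w / D * t) = N powr (- real n / 2 - 1) * (2 * (1 - \<rho>)\<^sup>2 * Q / D)"
    unfolding radial_profile_def N_def[symmetric] bracket[symmetric] N1 pull ..
  define r where "r = 1 - \<rho>"
  have r: "r > 0" using \<rho> by (simp add: r_def)
  have Npow: "N powr (- real n / 2 - 1) = r powr (- (real n + 2)) * E powr (- (real n / 2 + 1)) * D powr (real n / 2 + 1)"
  proof -
    have "N powr (- real n / 2 - 1) = (r powr 2 * E / D) powr (- (real n / 2 + 1))"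
      unfolding N r_def[symmetric] using r by (simp add: powr_numeral)
    also have "\<dots> = (r powr 2) powr (- (real n / 2 + 1)) * E powr (- (real n / 2 + 1)) / D powr (- (real n / 2 + 1))"
      using r D E by (simp add: powr_divide powr_mult)
    also have "(r powr 2) powr (- (real n / 2 + 1)) = r powr (- (real n + 2))"
    proof -
      have "2 * (- (real n / 2 + 1)) = - (real n + 2)" by simp
      then show ?thesis by (simp only: powr_powr)
    qed
    finally have "N powr (- real n / 2 - 1) = r powr (- (real n + 2)) * E powr (- (real n / 2 + 1)) / D powr (- (real n / 2 + 1))" .
    moreover have "X / D powr (- z) = X * D powr z" for X z by (simp add: powr_minus divide_inverse)
    ultimately show ?thesis by (simp only:)
  qed
  have sq: "(2 * k * w / D)\<^sup>2 powr ((real m - 1) / 2) * (4 * k\<^sup>2 * w / D\<^sup>2) = (2 * k / D) ^ (m + 1) * w ^ m"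
  proof -
    let ?z = "2 * k * w / D"
    have z: "?z > 0" using k w D by simp
    have "?z\<^sup>2 powr ((real m - 1) / 2) = ?z powr (2 * ((real m - 1) / 2))"
    proof -
      have "?z\<^sup>2 = ?z powr 2" using z by (simp only: powr_numeral)
      then show ?thesis by (simp only: powr_powr)
    qed
    also have "2 * ((real m - 1) / 2) = real (m - 1)" using m by (simp add: of_nat_diff field_simps)
    also have "?z powr real (m - 1) = ?z ^ (m - 1)" using z by (rule powr_realpow)
    finally have "?z\<^sup>2 powr ((real m - 1) / 2) * (4 * k\<^sup>2 * w / D\<^sup>2) = ?z ^ (m - 1) * (?z * (2 * k / D))"
      by (simp add: power2_eq_square)
    also have "\<dots> = ?z ^ m * (2 * k / D)" using m by (cases m) simp_all
    also have "\<dots> = (2 * k / D) ^ (m + 1) * w ^ m" by (simp add: power_mult_distrib power_divide mult_ac)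
    finally show ?thesis .
  qed
  have kr: "k = r / (1 + \<rho>)" by (simp add: k_def kappa_def r_def)
  have n1: "n - 1 = m + 1" by (simp add: n_def)
  have den: "denom n \<rho> w = E powr (real n / 2 + 1) * D powr (real n / 2 - 1)"
    by (simp add: denom_def E_def D_def k_def)
  have "radial_profile n \<rho> c s a (2 * k * w / D * t) * ((2 * k * w / D)\<^sup>2 powr ((real m - 1) / 2)) * (4 * k\<^sup>2 * w / D\<^sup>2)
     = radial_profile n \<rho> c s a (2 * k * w / D * t) * ((2 * k / D) ^ (m + 1) * w ^ m)"
    unfolding sq[symmetric] by (rule mult.assoc)
  also have "\<dots> = (r powr (- (real n + 2)) * E powr (- (real n / 2 + 1)) * D powr (real n / 2 + 1)) * (2 * r\<^sup>2 * Q / D)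
      * ((2 * k / D) ^ (m + 1) * w ^ m)"
    unfolding prof Npow r_def ..
  \<comment> \<open>Powers are collected by base. With n = m + 2 the exponents of \<open>r\<close>
    sum to -1 and those of \<open>D\<close> to -(n / 2 - 1), the latter matching
    \<open>denom\<close>.\<close>
  also have "\<dots> = (r powr (- (real n + 2)) * r\<^sup>2 * r ^ (m + 1)) * (2 * 2 ^ (m + 1) / (1 + \<rho>) ^ (m + 1)) * Q * w ^ m
       * E powr (- (real n / 2 + 1)) * (D powr (real n / 2 + 1) / D / D ^ (m + 1))"
    unfolding kr by (simp add: power_divide power_mult_distrib mult_ac)
  also have "r powr (- (real n + 2)) * r\<^sup>2 * r ^ (m + 1) = 1 / r"
  proof -
    have "r powr (- (real n + 2)) * r\<^sup>2 * r ^ (m + 1) = r powr (- (real n + 2)) * r powr 2 * r powr real (m + 1)"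
      using r by (simp only: powr_realpow powr_numeral)
    also have "\<dots> = r powr (- 1)" unfolding powr_add[symmetric] n_def by simp
    finally show ?thesis using r by (simp add: powr_minus_divide)
  qed
  also have "D powr (real n / 2 + 1) / D / D ^ (m + 1) = D powr (- (real n / 2 - 1))"
  proof -
    have "D powr (real n / 2 + 1) / D / D ^ (m + 1) = D powr (real n / 2 + 1) / D powr 1 / D powr real (m + 1)"
      using D by (simp only: powr_realpow powr_one)
    also have "\<dots> = D powr (real n / 2 + 1 - 1 - real (m + 1))" by (simp only: powr_diff)
    also have "real n / 2 + 1 - 1 - real (m + 1) = - (real n / 2 - 1)" by (simp add: n_def field_simps)
    finally show ?thesis .
  qed
  also have "1 / r * (2 * 2 ^ (m + 1) / (1 + \<rho>) ^ (m + 1)) * Q * w ^ m * E powr (- (real n / 2 + 1)) * D powr (- (real n / 2 - 1))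
     = 2 ^ n / (r * (1 + \<rho>) ^ (n - 1)) * (Q * w ^ m / denom n \<rho> w)"
  proof -
    have n2: "(2::real) ^ n = 2 * 2 ^ (m + 1)" by (simp add: n_def)
    have "1 / r * (p / q) * Q * z * inverse x * inverse y = p / (r * q) * (Q * z / (x * y))" for p q z x y :: real
      by (simp add: divide_inverse mult_ac)
    then show ?thesis unfolding den n1 n2 powr_minus .
  qed
  finally show ?thesis unfolding a_def D_def Q_def r_def .
qed

lemma denom_pos: "denom n \<rho> w > 0"
  using half_angle_pos by (simp add: denom_def less_imp_neq[symmetric])

lemma denom_measurable [measurable]: "denom n \<rho> \<in> borel_measurable borel"
  unfolding denom_def[abs_def] by measurable

text \<open>The common source of all three formulas: (c, s) is (cos \<tau>, sin \<tau>) in the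
  oblique case, (1, 0) in the radial and (0, 1) in the tangential one.\<close>

proposition optimal_coeff_double_integral:
  fixes u e :: "'a::euclidean_space"
  assumes \<rho>: "0 \<le> \<rho>" "\<rho> < 1" and ue: "norm u = 1" "norm e = 1" "u \<bullet> e = 0"
    and n: "DIM('a) = n" "n = m + 2" "m \<ge> 1"
  shows "optimal_coeff (\<rho> *\<^sub>R u) (c *\<^sub>R u + s *\<^sub>R e)
    (4 * omega m / omega n * (2 ^ (n - 1) / (1 + \<rho>) ^ (n - 1)) *
      enn2real (\<integral>\<^sup>+t. (\<integral>\<^sup>+w. ennreal ((c * (real n - beta n \<rho> - beta n \<rho> * w\<^sup>2) + real n * s * t * w) * w ^ m / denom n \<rho> w)
           * indicator {0..} w \<partial>lborel) *
         ennreal ((1 - t\<^sup>2) powr ((real m - 2) / 2) * indicator {-1<..<1} t) \<partial>lborel))"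
proof -
  define k where "k = kappa \<rho>"
  have k: "k > 0" using \<rho> by (simp add: k_def kappa_pos)
  define W where "W t = ennreal ((1 - t\<^sup>2) powr ((real m - 2) / 2) * indicator {-1<..<1} t)" for t :: real
  define Q where "Q t w = (c * (real n - beta n \<rho> - beta n \<rho> * w\<^sup>2) + real n * s * t * w) * w ^ m / denom n \<rho> w" for t w
  define \<phi> where "\<phi> a b = ennreal (radial_profile n \<rho> c s a b)" for a b
  have \<phi>m: "(\<lambda>p. \<phi> (fst p) (snd p)) \<in> borel_measurable (borel \<Otimes>\<^sub>M borel)"
    unfolding \<phi>_def radial_profile_def by measurable
  have \<phi>m' [measurable (raw)]: "(\<lambda>x. \<phi> (a x) (b x)) \<in> borel_measurable N"
    if [measurable]: "a \<in> borel_measurable N" "b \<in> borel_measurable N" for a b and N :: "'z measure"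
    using measurable_compose[OF measurable_Pair[OF that] \<phi>m] by simp
  have [measurable]: "W \<in> borel_measurable borel" unfolding W_def[abs_def] by measurable
  have [measurable (raw)]: "(\<lambda>x. Q (a x) (b x)) \<in> borel_measurable N"
    if [measurable]: "a \<in> borel_measurable N" "b \<in> borel_measurable N" for a b and N :: "'z measure"
    unfolding Q_def by measurable
  define J where "J = (\<integral>\<^sup>+t. (\<integral>\<^sup>+w. ennreal (Q t w) * indicator {0..} w \<partial>lborel) * W t \<partial>lborel)"
  define C where "C = 2 ^ n / ((1 - \<rho>) * (1 + \<rho>) ^ (n - 1))"
  have C: "C \<ge> 0" using \<rho> by (simp add: C_def)
  have inner: "(\<integral>\<^sup>+a. \<phi> a (sqrt (1 - a\<^sup>2) * t) * ennreal ((1 - a\<^sup>2) powr ((real m - 1) / 2) * indicator {-1<..<1} a) \<partial>lborel)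
     = ennreal C * (\<integral>\<^sup>+w. ennreal (Q t w) * indicator {0..} w \<partial>lborel)" for t
  proof -
    \<comment> \<open>The second argument \<open>z\<close> stands for
      \<open>sqrt (1 - a\<^sup>2)\<close>, in the weight as well as in the component along
      \<open>e\<close>.\<close>
    define F where "F a z = \<phi> a (z * t) * ennreal (z\<^sup>2 powr ((real m - 1) / 2))" for a z
    have Fm: "(\<lambda>p. F (fst p) (snd p)) \<in> borel_measurable (borel \<Otimes>\<^sub>M borel)"
      unfolding F_def by measurable
    have "(\<integral>\<^sup>+a. \<phi> a (sqrt (1 - a\<^sup>2) * t) * ennreal ((1 - a\<^sup>2) powr ((real m - 1) / 2) * indicator {-1<..<1} a) \<partial>lborel)
      = (\<integral>\<^sup>+a. F a (sqrt (1 - a\<^sup>2)) * indicator {-1<..<1} a \<partial>lborel)"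
    proof (rule nn_integral_cong)
      fix a :: real
      have "a\<^sup>2 \<le> 1" if "a \<in> {-1<..<1}" using that by (simp add: abs_square_le_1 abs_le_iff)
      then show "\<phi> a (sqrt (1 - a\<^sup>2) * t) * ennreal ((1 - a\<^sup>2) powr ((real m - 1) / 2) * indicator {-1<..<1} a)
        = F a (sqrt (1 - a\<^sup>2)) * indicator {-1<..<1} a"
        by (simp add: F_def indicator_def)
    qed
    also have "\<dots> = (\<integral>\<^sup>+w. F ((1 - k\<^sup>2 * w\<^sup>2) / (1 + k\<^sup>2 * w\<^sup>2)) (2 * k * w / (1 + k\<^sup>2 * w\<^sup>2)) *
       ennreal (4 * k\<^sup>2 * w / (1 + k\<^sup>2 * w\<^sup>2)\<^sup>2) * indicator {0..} w \<partial>lborel)"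
      by (rule nn_integral_half_angle_substitution[OF Fm k])
    also have "\<dots> = (\<integral>\<^sup>+w. ennreal C * (ennreal (Q t w) * indicator {0..} w) \<partial>lborel)"
    proof (rule nn_integral_cong)
      fix w :: real
      show "F ((1 - k\<^sup>2 * w\<^sup>2) / (1 + k\<^sup>2 * w\<^sup>2)) (2 * k * w / (1 + k\<^sup>2 * w\<^sup>2)) *
       ennreal (4 * k\<^sup>2 * w / (1 + k\<^sup>2 * w\<^sup>2)\<^sup>2) * indicator {0..} w = ennreal C * (ennreal (Q t w) * indicator {0..} w)"
      proof (cases "w > 0")
        case True
        have "ennreal (radial_profile n \<rho> c s ((1 - k\<^sup>2 * w\<^sup>2) / (1 + k\<^sup>2 * w\<^sup>2)) (2 * k * w / (1 + k\<^sup>2 * w\<^sup>2) * t)) *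
            ennreal ((2 * k * w / (1 + k\<^sup>2 * w\<^sup>2))\<^sup>2 powr ((real m - 1) / 2)) * ennreal (4 * k\<^sup>2 * w / (1 + k\<^sup>2 * w\<^sup>2)\<^sup>2)
          = ennreal (C * Q t w)"
          using True radial_profile_half_angle[OF \<rho> True n(3), of c s t]
          unfolding k_def[symmetric] n(2)[symmetric] C_def Q_def
          by (subst ennreal_mult''[symmetric], simp, subst ennreal_mult''[symmetric], simp) simp
        then show ?thesis
          using True C by (simp add: F_def \<phi>_def ennreal_mult')
      next
        case False
        then show ?thesis using n(3) by (cases "w = 0") (auto simp: Q_def power_0_left)
      qed
    qed
    also have "\<dots> = ennreal C * (\<integral>\<^sup>+w. ennreal (Q t w) * indicator {0..} w \<partial>lborel)"
      by (rule nn_integral_cmult) measurable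
    finally show ?thesis .
  qed
  have "(\<integral>\<^sup>+y. ennreal (poisson_grad (\<rho> *\<^sub>R u) y \<bullet> (c *\<^sub>R u + s *\<^sub>R e)) \<partial>sphere_measure) = (\<integral>\<^sup>+y. \<phi> (y \<bullet> u) (y \<bullet> e) \<partial>sphere_measure)"
    by (intro nn_integral_cong) (simp add: \<phi>_def poisson_grad_eq_radial_profile[OF ue] n(1))
  also have "\<dots> = ennreal (omega m / omega (m + 2)) *
    (\<integral>\<^sup>+t. (\<integral>\<^sup>+a. \<phi> a (sqrt (1 - a\<^sup>2) * t) * ennreal ((1 - a\<^sup>2) powr ((real m - 1) / 2) * indicator {-1<..<1} a) \<partial>lborel) * W t \<partial>lborel)"
    unfolding W_def by (rule nn_integral_sphere_two_directions[OF \<phi>m ue]) (use n in simp_all)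
  also have "\<dots> = ennreal (omega m / omega n) * (ennreal C * J)"
    unfolding inner J_def mult.assoc n(2)[symmetric] by (subst nn_integral_cmult) simp_all
  finally have "enn2real (\<integral>\<^sup>+y. ennreal (poisson_grad (\<rho> *\<^sub>R u) y \<bullet> (c *\<^sub>R u + s *\<^sub>R e)) \<partial>sphere_measure)
    = omega m / omega n * (C * enn2real J)"
    using C omega_pos[of m] omega_pos[of n] n by (simp add: enn2real_mult)
  moreover have "(1 - norm (\<rho> *\<^sub>R u)) * (2 * (omega m / omega n * (C * enn2real J)))
    = 4 * omega m / omega n * (2 ^ (n - 1) / (1 + \<rho>) ^ (n - 1)) * enn2real J"
  proof -
    \<comment> \<open>The normalising factor cancels the singularity of \<open>C\<close>. The 2 left
      over from \<open>2 ^ n\<close> and the 2 from the positive part make up the 4 in the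
      statement.\<close>
    have C2: "(1 - \<rho>) * C = 2 * (2 ^ (n - 1) / (1 + \<rho>) ^ (n - 1))"
      using \<rho> n by (simp add: C_def)
    have "(1 - \<rho>) * (2 * (v * (C * j))) = 2 * v * ((1 - \<rho>) * C) * j" for v j :: real
      by (simp add: mult_ac)
    from this[of "omega m / omega n" "enn2real J"]
    have "(1 - \<rho>) * (2 * (omega m / omega n * (C * enn2real J))) = 4 * omega m / omega n * (2 ^ (n - 1) / (1 + \<rho>) ^ (n - 1)) * enn2real J"
      unfolding C2 by simp
    then show ?thesis using ue \<rho> by simp
  qed
  moreover have "\<rho> *\<^sub>R u \<in> ball 0 1" using \<rho> ue by simp
  ultimately show ?thesis
    using optimal_coeff_poisson_pos[of "\<rho> *\<^sub>R u" "c *\<^sub>R u + s *\<^sub>R e"] unfolding J_def Q_def W_def by simp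
qed

subsection \<open>The explicit formulas\<close>

lemma P_fun_quadratic:
  fixes z w \<rho> :: real and n :: nat
  assumes n: "n \<ge> 3" and \<rho>: "0 \<le> \<rho>" "\<rho> \<le> 1" and w: "w \<ge> 0"
  defines "wp \<equiv> (z + sqrt (z\<^sup>2 + 1 - (alpha n \<rho>)\<^sup>2)) / (1 - alpha n \<rho>)"
  shows "wp > 0" and "w \<le> wp \<longleftrightarrow> 0 \<le> real n - beta n \<rho> + real n * z * w - beta n \<rho> * w\<^sup>2"
proof -
  define a where "a = alpha n \<rho>"
  define S where "S = sqrt (z\<^sup>2 + 1 - a\<^sup>2)"
  have a: "0 \<le> a" "a < 1"
  proof -
    show "0 \<le> a" using n \<rho> by (simp add: a_def alpha_def)
    have "(real n - 2) * \<rho> \<le> (real n - 2) * 1" using n \<rho> by (intro mult_left_mono) auto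
    then have "(real n - 2) * \<rho> < real n" by (rule le_less_trans) simp
    then show "a < 1" using n by (simp add: a_def alpha_def divide_less_eq)
  qed
  have a2: "a\<^sup>2 < 1" using a by (simp add: abs_square_less_1)
  have S: "S\<^sup>2 = z\<^sup>2 + 1 - a\<^sup>2" unfolding S_def using a2 zero_le_power2[of z] by (subst real_sqrt_pow2) linarith+
  have Sz: "\<bar>z\<bar> < S"
    unfolding S_def by (rule real_less_rsqrt) (use a2 in simp)
  have wp: "wp = (z + S) / (1 - a)" by (simp add: wp_def S_def a_def)
  show "wp > 0" using Sz a by (simp add: wp)
  define wm where "wm = (z - S) / (1 - a)"
  have wm: "wm < 0" using Sz a by (simp add: wm_def divide_less_0_iff)
  have ab: "real n * (1 - a) = 2 * beta n \<rho>" "real n * (1 + a) = 2 * (real n - beta n \<rho>)"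
    using n by (simp_all add: a_def alpha_def beta_def field_simps)
  have "wp * (1 - a) = z + S" "wm * (1 - a) = z - S" using a by (simp_all add: wp wm_def)
  \<comment> \<open>The quadratic in terms of its roots. Since \<open>S\<close> exceeds |z|, they
    have opposite signs, so on the half-line of nonnegative \<open>w\<close> only the factor
    \<open>wp - w\<close> changes sign.\<close>
  have fact: "2 * (real n - beta n \<rho> + real n * z * w - beta n \<rho> * w\<^sup>2) = real n * (1 - a) * ((wp - w) * (w - wm))"
  proof -
    have "(1 - a) * ((1 - a) * ((wp - w) * (w - wm))) = (wp * (1 - a) - w * (1 - a)) * (w * (1 - a) - wm * (1 - a))"
      by (simp add: algebra_simps)
    also have "\<dots> = (z + S - w * (1 - a)) * (w * (1 - a) - (z - S))"
      by (simp only: \<open>wp * (1 - a) = z + S\<close> \<open>wm * (1 - a) = z - S\<close>)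
    also have "\<dots> = S\<^sup>2 - (z - w * (1 - a))\<^sup>2" by (simp add: power2_eq_square algebra_simps)
    also have "\<dots> = (1 - a) * (1 + a + 2 * z * w - (1 - a) * w\<^sup>2)"
      unfolding S by (simp add: power2_eq_square algebra_simps)
    finally have "(1 - a) * ((wp - w) * (w - wm)) = 1 + a + 2 * z * w - (1 - a) * w\<^sup>2"
      using a by simp
    then have "real n * (1 - a) * ((wp - w) * (w - wm)) = real n * (1 + a + 2 * z * w - (1 - a) * w\<^sup>2)"
      by (simp only: mult.assoc)
    also have "\<dots> = real n * (1 + a) + 2 * real n * z * w - (real n * (1 - a)) * w\<^sup>2"
      by (simp add: algebra_simps)
    finally show ?thesis unfolding ab by simp
  qed
  have "w \<le> wp \<longleftrightarrow> 0 \<le> (wp - w) * (w - wm)"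
    using w wm by (auto simp: zero_le_mult_iff)
  also have "\<dots> \<longleftrightarrow> 0 \<le> real n * (1 - a) * ((wp - w) * (w - wm))"
  proof -
    have "real n * (1 - a) > 0" using n a by simp
    from mult_le_cancel_left_pos[OF this, of 0 "(wp - w) * (w - wm)"] show ?thesis by simp
  qed
  finally show "w \<le> wp \<longleftrightarrow> 0 \<le> real n - beta n \<rho> + real n * z * w - beta n \<rho> * w\<^sup>2"
    unfolding fact[symmetric] zero_le_mult_iff[of 2] by simp
qed

text \<open>Beyond the positive root the numerator is negative and \<open>ennreal\<close> discards
  it, so the half-line integral stops at the upper limit in \<open>P_fun\<close>. Below it the
  integrand is continuous on a compact interval, hence integrable.\<close>

lemma nn_integral_P_fun:
  fixes z \<rho> :: real
  assumes n: "n = m + 2" "m \<ge> 1" and \<rho>: "0 \<le> \<rho>" "\<rho> \<le> 1"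
  shows "(\<integral>\<^sup>+w. ennreal ((real n - beta n \<rho> + real n * z * w - beta n \<rho> * w\<^sup>2) * w ^ m / denom n \<rho> w) * indicator {0..} w \<partial>lborel)
    = ennreal (P_fun n \<rho> z)" and "P_fun n \<rho> z \<ge> 0"
proof -
  define wp where "wp = (z + sqrt (z\<^sup>2 + 1 - (alpha n \<rho>)\<^sup>2)) / (1 - alpha n \<rho>)"
  define q where "q w = (real n - beta n \<rho> + real n * z * w - beta n \<rho> * w\<^sup>2) * w ^ m / denom n \<rho> w" for w
  have n3: "n \<ge> 3" using n by simp
  note wq = P_fun_quadratic(2)[OF n3 \<rho>, where z = z, folded wp_def]
  have cont: "continuous_on {0..wp} q"
    unfolding q_def denom_def using half_angle_pos half_angle_pos(1)[of "kappa \<rho>"]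
    by (intro continuous_intros) (auto simp: less_imp_neq[symmetric])
  have int: "integrable lborel (\<lambda>w. indicator {0..wp} w *\<^sub>R q w)"
    using borel_integrable_atLeastAtMost'[OF cont] by (simp add: set_integrable_def)
  have q0: "0 \<le> q w \<longleftrightarrow> w \<le> wp" if "w > 0" for w
  proof -
    have "w ^ m / denom n \<rho> w > 0" using that denom_pos[of n \<rho> w] by simp
    then show ?thesis
      using wq[of w] that unfolding q_def times_divide_eq_right[symmetric] by (simp only: zero_le_mult_iff) auto
  qed
  have qz: "q 0 = 0" using n by (simp add: q_def power_0_left)
  have P: "P_fun n \<rho> z = (\<integral>w. indicator {0..wp} w *\<^sub>R q w \<partial>lborel)"
    using n by (simp add: P_fun_def set_lebesgue_integral_def wp_def q_def)
  have nonneg: "0 \<le> indicator {0..wp} w *\<^sub>R q w" for w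
    using q0[of w] qz by (cases "w = 0") (auto simp: indicator_def)
  have "(\<integral>\<^sup>+w. ennreal (q w) * indicator {0..} w \<partial>lborel) = (\<integral>\<^sup>+w. ennreal (indicator {0..wp} w *\<^sub>R q w) \<partial>lborel)"
  proof (rule nn_integral_cong)
    fix w :: real
    show "ennreal (q w) * indicator {0..} w = ennreal (indicator {0..wp} w *\<^sub>R q w)"
      using q0[of w] qz by (cases "w = 0") (auto simp: indicator_def ennreal_neg)
  qed
  also have "\<dots> = ennreal (P_fun n \<rho> z)"
    unfolding P by (rule nn_integral_eq_integral[OF int]) (use nonneg in auto)
  finally show "(\<integral>\<^sup>+w. ennreal ((real n - beta n \<rho> + real n * z * w - beta n \<rho> * w\<^sup>2) * w ^ m / denom n \<rho> w) * indicator {0..} w \<partial>lborel)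
    = ennreal (P_fun n \<rho> z)" unfolding q_def .
  show "P_fun n \<rho> z \<ge> 0" unfolding P using nonneg by (intro Bochner_Integration.integral_nonneg) auto
qed

text \<open>The argument \<open>z\<close> enters both the integrand and the limit of integration.
  The truncated form has a fixed domain, and measurability in a parameter follows for it
  directly.\<close>

lemma P_fun_measurable:
  assumes n: "n = m + 2" "m \<ge> 1" and \<rho>: "0 \<le> \<rho>" "\<rho> \<le> 1"
  shows "P_fun n \<rho> \<in> borel_measurable borel"
proof -
  have "P_fun n \<rho> = (\<lambda>z. enn2real (\<integral>\<^sup>+w. ennreal ((real n - beta n \<rho> + real n * z * w - beta n \<rho> * w\<^sup>2) * w ^ m / denom n \<rho> w) * indicator {0..} w \<partial>lborel))"
    by (simp add: nn_integral_P_fun[OF n \<rho>])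
  also have "\<dots> \<in> borel_measurable borel" by measurable
  finally show ?thesis .
qed

lemma nn_integral_symmetric_interval:
  fixes f :: "real \<Rightarrow> ennreal"
  assumes [measurable]: "f \<in> borel_measurable borel"
  shows "(\<integral>\<^sup>+t. f t * indicator {-1<..<1} t \<partial>lborel) = (\<integral>\<^sup>+t. (f t + f (- t)) * indicator {0<..<1} t \<partial>lborel)"
proof -
  have "(\<integral>\<^sup>+t. f t * indicator {-1<..<1} t \<partial>lborel) = (\<integral>\<^sup>+t. f t * indicator {0<..<1} t + f t * indicator {-1<..<0} t \<partial>lborel)"
    by (intro nn_integral_cong_AE eventually_mono[OF AE_lborel_singleton[of 0]]) (auto simp: indicator_def)
  also have "\<dots> = (\<integral>\<^sup>+t. f t * indicator {0<..<1} t \<partial>lborel) + (\<integral>\<^sup>+t. f t * indicator {-1<..<0} t \<partial>lborel)"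
    by (rule nn_integral_add) auto
  also have "(\<integral>\<^sup>+t. f t * indicator {-1<..<0} t \<partial>lborel) = (\<integral>\<^sup>+t. f (- t) * indicator {0<..<1} t \<partial>lborel)"
    by (subst nn_integral_real_affine[where c = "-1" and t = 0]) (auto simp: indicator_def intro!: nn_integral_cong)
  also have "(\<integral>\<^sup>+t. f t * indicator {0<..<1} t \<partial>lborel) + (\<integral>\<^sup>+t. f (- t) * indicator {0<..<1} t \<partial>lborel) =
    (\<integral>\<^sup>+t. (f t + f (- t)) * indicator {0<..<1} t \<partial>lborel)"
    by (simp add: nn_integral_add distrib_right)
  finally show ?thesis .
qed

text \<open>Here \<open>c\<close> is cos \<tau>. Factoring it out leaves the quadratic of
  \<open>P_fun\<close> at z = \<gamma> t, and positivity of \<open>c\<close> lets the factor pass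
  through the truncation. Folding t and -t produces the sum of two values.\<close>

lemma optimal_coeff_oblique:
  fixes u e :: "'a::euclidean_space"
  assumes \<rho>: "0 \<le> \<rho>" "\<rho> < 1" and ue: "norm u = 1" "norm e = 1" "u \<bullet> e = 0"
    and n: "DIM('a) = n" "n \<ge> 3" and c: "c > 0"
  shows "optimal_coeff (\<rho> *\<^sub>R u) (c *\<^sub>R u + (c * \<gamma>) *\<^sub>R e)
    (4 * omega (n - 2) / omega n * (2 ^ (n - 1) / (1 + \<rho>) ^ (n - 1)) * c *
      (LBINT t:{0..1}. (P_fun n \<rho> (\<gamma> * t) + P_fun n \<rho> (- (\<gamma> * t))) / sqrt ((1 - t\<^sup>2) powi (4 - int n))))"
proof -
  define m where "m = n - 2"
  let ?G = "\<lambda>t. (P_fun n \<rho> (\<gamma> * t) + P_fun n \<rho> (- (\<gamma> * t))) / sqrt ((1 - t\<^sup>2) powi (4 - int n))"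
  let ?H = "\<lambda>t. \<integral>\<^sup>+w. ennreal ((c * (real n - beta n \<rho> - beta n \<rho> * w\<^sup>2) + real n * (c * \<gamma>) * t * w) * w ^ m / denom n \<rho> w)
           * indicator {0..} w \<partial>lborel"
  have m: "n = m + 2" "m \<ge> 1" "n - 2 = m" using n by (simp_all add: m_def)
  have \<rho>1: "\<rho> \<le> 1" using \<rho> by simp
  note P = nn_integral_P_fun[OF m(1,2) \<rho>(1) \<rho>1]
  note [measurable] = P_fun_measurable[OF m(1,2) \<rho>(1) \<rho>1]
  define V where "V t = (1 - t\<^sup>2) powr ((real m - 2) / 2)" for t :: real
  have [measurable]: "V \<in> borel_measurable borel" unfolding V_def[abs_def] by measurable
  have V0: "V t \<ge> 0" for t by (simp add: V_def)
  have inner: "?H t = ennreal (c * P_fun n \<rho> (\<gamma> * t))" for t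
  proof -
    have "?H t = (\<integral>\<^sup>+w. ennreal c * (ennreal ((real n - beta n \<rho> + real n * (\<gamma> * t) * w - beta n \<rho> * w\<^sup>2) * w ^ m / denom n \<rho> w)
           * indicator {0..} w) \<partial>lborel)"
    proof (rule nn_integral_cong)
      fix w
      have "(c * (real n - beta n \<rho> - beta n \<rho> * w\<^sup>2) + real n * (c * \<gamma>) * t * w) * w ^ m / denom n \<rho> w
        = c * ((real n - beta n \<rho> + real n * (\<gamma> * t) * w - beta n \<rho> * w\<^sup>2) * w ^ m / denom n \<rho> w)"
        by (simp add: algebra_simps)
      then show "ennreal ((c * (real n - beta n \<rho> - beta n \<rho> * w\<^sup>2) + real n * (c * \<gamma>) * t * w) * w ^ m / denom n \<rho> w)
           * indicator {0..} w = ennreal c * (ennreal ((real n - beta n \<rho> + real n * (\<gamma> * t) * w - beta n \<rho> * w\<^sup>2) * w ^ m / denom n \<rho> w)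
           * indicator {0..} w)"
        using c by (simp only: ennreal_mult'[OF less_imp_le[OF c]] mult.assoc)
    qed
    also have "\<dots> = ennreal c * ennreal (P_fun n \<rho> (\<gamma> * t))"
      by (subst nn_integral_cmult) (simp_all add: P)
    finally show ?thesis using c by (simp add: ennreal_mult')
  qed
  have "(\<integral>\<^sup>+t. ?H t * ennreal ((1 - t\<^sup>2) powr ((real m - 2) / 2) * indicator {-1<..<1} t) \<partial>lborel)
    = (\<integral>\<^sup>+t. (ennreal (c * P_fun n \<rho> (\<gamma> * t)) * ennreal (V t)) * indicator {-1<..<1} t \<partial>lborel)"
    unfolding inner V_def by (intro nn_integral_cong) (simp add: indicator_def)
  also have "\<dots> = (\<integral>\<^sup>+t. (ennreal (c * P_fun n \<rho> (\<gamma> * t)) * ennreal (V t) + ennreal (c * P_fun n \<rho> (\<gamma> * (- t))) * ennreal (V (- t))) * indicator {0<..<1} t \<partial>lborel)"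
    by (rule nn_integral_symmetric_interval) measurable
  also have "\<dots> = (\<integral>\<^sup>+t. ennreal c * ennreal (indicator {0..1} t *\<^sub>R ?G t) \<partial>lborel)"
  \<comment> \<open>The folded integral runs over the open interval and the target over the closed
    one; they differ in the null set of endpoints.\<close>
  proof (rule nn_integral_cong_AE, rule AE_I[of _ _ "{0, 1}"])
    show "emeasure lborel {0, 1::real} = 0" by (simp add: emeasure_lborel_countable)
    have "(ennreal (c * P_fun n \<rho> (\<gamma> * t)) * ennreal (V t) + ennreal (c * P_fun n \<rho> (\<gamma> * (- t))) * ennreal (V (- t))) * indicator {0<..<1} t
       = ennreal c * ennreal (indicator {0..1} t *\<^sub>R ?G t)"
      if "t \<notin> {0, 1}" for t
    proof (cases "t \<in> {0<..<1}")
      case True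
      then have t2: "1 - t\<^sup>2 > 0" by (simp add: abs_square_less_1)
      have "sqrt ((1 - t\<^sup>2) powi (4 - int n)) = (1 - t\<^sup>2) powr ((2 - real m) / 2)"
      proof -
        have "(1 - t\<^sup>2) powi (4 - int n) = (1 - t\<^sup>2) powr (2 - real m)"
          using t2 m by (subst powr_real_of_int'[symmetric]) auto
        then show ?thesis using t2 by (simp add: powr_half_sqrt[symmetric] powr_powr)
      qed
      moreover have "V t = 1 / (1 - t\<^sup>2) powr ((2 - real m) / 2)"
      proof -
        have "(real m - 2) / 2 = - ((2 - real m) / 2)" by (simp add: field_simps)
        then show ?thesis unfolding V_def by (simp only: powr_minus_divide)
      qed
      ultimately have VV: "X / sqrt ((1 - t\<^sup>2) powi (4 - int n)) = X * V t" for X by simp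
      have "ennreal (c * P_fun n \<rho> (\<gamma> * t)) * ennreal (V t) + ennreal (c * P_fun n \<rho> (\<gamma> * (- t))) * ennreal (V (- t))
        = ennreal (c * P_fun n \<rho> (\<gamma> * t) * V t + c * P_fun n \<rho> (- (\<gamma> * t)) * V t)"
        using c P(2) V0 by (simp add: ennreal_plus ennreal_mult'' V_def[of "- t"] V_def[of t, symmetric])
      also have "\<dots> = ennreal c * ennreal ((P_fun n \<rho> (\<gamma> * t) + P_fun n \<rho> (- (\<gamma> * t))) * V t)"
        using c by (subst ennreal_mult'[symmetric]) (simp_all add: algebra_simps)
      finally show ?thesis using True by (simp add: VV)
    qed (use that in \<open>auto simp: indicator_def\<close>)
    then show "{t \<in> space lborel. \<not> (ennreal (c * P_fun n \<rho> (\<gamma> * t)) * ennreal (V t) + ennreal (c * P_fun n \<rho> (\<gamma> * (- t))) * ennreal (V (- t))) * indicator {0<..<1} t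
       = ennreal c * ennreal (indicator {0..1} t *\<^sub>R ?G t)} \<subseteq> {0, 1}"
      by blast
  qed simp
  also have "\<dots> = ennreal c * (\<integral>\<^sup>+t. ennreal (indicator {0..1} t *\<^sub>R ?G t) \<partial>lborel)"
    unfolding power_int_def by (rule nn_integral_cmult) measurable
  finally have "enn2real (\<integral>\<^sup>+t. ?H t * ennreal ((1 - t\<^sup>2) powr ((real m - 2) / 2) * indicator {-1<..<1} t) \<partial>lborel)
    = c * enn2real (\<integral>\<^sup>+t. ennreal (indicator {0..1} t *\<^sub>R ?G t) \<partial>lborel)"
    using c by (simp add: enn2real_mult)
  also have "enn2real (\<integral>\<^sup>+t. ennreal (indicator {0..1} t *\<^sub>R ?G t) \<partial>lborel)
    = (LBINT t:{0..1}. ?G t)"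
    unfolding set_lebesgue_integral_def
  proof (rule integral_eq_nn_integral[symmetric])
    show "(\<lambda>t. indicator {0..1} t *\<^sub>R ?G t) \<in> borel_measurable lborel"
      unfolding power_int_def by measurable
    show "AE t in lborel. 0 \<le> indicator {0..1} t *\<^sub>R ?G t"
    proof (rule AE_I2)
      fix t :: real
      have "(1 - t\<^sup>2) powi (4 - int n) \<ge> 0" if "t \<in> {0..1}"
        using that by (intro zero_le_power_int) (simp add: abs_square_le_1)
      then show "0 \<le> indicator {0..1} t *\<^sub>R ?G t"
        using P(2) by (auto simp: indicator_def intro!: divide_nonneg_nonneg add_nonneg_nonneg)
    qed
  qed
  finally show ?thesis
    using optimal_coeff_double_integral[OF \<rho> ue n(1) m(1,2), of c "c * \<gamma>"] by (simp add: m(3) mult.assoc)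
qed

text \<open>Integrating 1 over the sphere gives 1 as the product of the area quotient, the weight
  integral in c and the one in t. The c-integral is a Beta value, so the remaining product is its
  reciprocal.\<close>

lemma sphere_weight_integral:
  assumes n: "DIM('a::euclidean_space) = n" "n = m + 2" "m \<ge> 1"
  shows "omega m / omega n * enn2real (\<integral>\<^sup>+t. ennreal ((1 - t\<^sup>2) powr ((real m - 2) / 2) * indicator {-1<..<1} t) \<partial>lborel)
    = Gamma (real n / 2) / (sqrt pi * Gamma ((real n - 1) / 2))"
proof -
  let ?v = "\<lambda>c. (1 - c\<^sup>2) powr ((real m - 1) / 2) * indicator {-1<..<1} c"
  define I where "I = (\<integral>\<^sup>+t. ennreal ((1 - t\<^sup>2) powr ((real m - 2) / 2) * indicator {-1<..<1} t) \<partial>lborel)"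
  define B where "B = Beta (1 / 2) (real (m - 1) / 2 + 1)"
  have B: "B = sqrt pi * Gamma ((real n - 1) / 2) / Gamma (real n / 2)"
  proof -
    have e1: "real (m - 1) / 2 + 1 = (real n - 1) / 2" and e2: "1 / 2 + (real n - 1) / 2 = real n / 2"
      using n by (simp_all add: of_nat_diff field_simps)
    show ?thesis unfolding B_def e1 Beta_def e2 by (simp add: Gamma_one_half_real)
  qed
  have G: "Gamma ((real n - 1) / 2) > 0" "Gamma (real n / 2) > 0"
    using n by (auto intro!: Gamma_real_pos)
  then have B0: "B > 0" unfolding B by simp
  have W': "(\<integral>\<^sup>+c. ennreal (?v c) \<partial>lborel) = ennreal B"
  proof -
    have "(\<integral>\<^sup>+c. ennreal (?v c) \<partial>lborel)
      = (\<integral>\<^sup>+x. indicator {-1..1} x * sqrt (1 - x\<^sup>2) ^ (m - 1) \<partial>lborel)"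
    proof (rule nn_integral_cong_AE, rule AE_I[of _ _ "{-1, 1}"])
      show "emeasure lborel {-1, 1::real} = 0" by (simp add: emeasure_lborel_countable)
      have eq: "?v c = indicator {-1..1} c * sqrt (1 - c\<^sup>2) ^ (m - 1)"
        if "c \<notin> {-1, 1}" for c :: real
      proof (cases "c \<in> {-1<..<1}")
        case True
        then have c: "1 - c\<^sup>2 > 0" by (simp add: abs_square_less_1 abs_less_iff)
        have "(1 - c\<^sup>2) powr ((real m - 1) / 2) = ((1 - c\<^sup>2) powr (1 / 2)) powr real (m - 1)"
          using n by (simp add: powr_powr of_nat_diff)
        also have "\<dots> = sqrt (1 - c\<^sup>2) ^ (m - 1)"
          using c by (simp add: powr_half_sqrt powr_realpow)
        finally show ?thesis using True by simp
      qed (use that in \<open>auto simp: indicator_def\<close>)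
      show "{c \<in> space lborel. \<not> ennreal (?v c) = ennreal (indicator {-1..1} c * sqrt (1 - c\<^sup>2) ^ (m - 1))} \<subseteq> {-1, 1}"
        using eq by force
    qed simp
    then show ?thesis using emeasure_cball_aux_integral[of "m - 1"] by (simp add: B_def)
  qed
  have "\<not> card (Basis :: 'a set) \<le> 1" using n by simp
  then obtain i j :: 'a where ij: "i \<in> Basis" "j \<in> Basis" "i \<noteq> j"
    by (metis card_le_Suc0_iff_eq finite_Basis One_nat_def)
  have "(1::ennreal) = (\<integral>\<^sup>+y. 1 \<partial>(sphere_measure :: 'a measure))"
    using emeasure_sphere_measure_space[where 'a = 'a] by simp
  also have "\<dots> = ennreal (omega m / omega (m + 2)) *
    (\<integral>\<^sup>+t. (\<integral>\<^sup>+c. 1 * ennreal (?v c) \<partial>lborel) *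
       ennreal ((1 - t\<^sup>2) powr ((real m - 2) / 2) * indicator {-1<..<1} t) \<partial>lborel)"
    by (rule nn_integral_sphere_two_directions[where \<phi> = "\<lambda>_ _. 1" and u = i and e = j]) (use ij n in \<open>auto simp: inner_not_same_Basis\<close>)
  also have "\<dots> = ennreal (omega m / omega n) * (ennreal B * I)"
    unfolding mult_1 W' I_def n(2)[symmetric] by (subst nn_integral_cmult) simp_all
  finally have "enn2real 1 = enn2real (ennreal (omega m / omega n) * (ennreal B * I))" by simp
  moreover have "enn2real (ennreal a * (ennreal B * I)) = a * (B * enn2real I)" if "a \<ge> 0" for a
    using B0 that by (simp add: enn2real_mult)
  moreover have "omega m / omega n \<ge> 0" using omega_pos[of m] omega_pos[of n] n by simp
  ultimately have "1 = omega m / omega n * (B * enn2real I)" by (metis enn2real_1)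
  moreover have "a * i = 1 / B" if "1 = a * (B * i)" for a i :: real
    using that B0 by (simp add: field_simps)
  ultimately have "omega m / omega n * enn2real I = 1 / B" by blast
  then show ?thesis using G unfolding I_def B by simp
qed

text \<open>The inner integral is independent of t and equals \<open>P_fun n \<rho> 0\<close>, so
  the double integral is a product. Any unit vector orthogonal to \<open>u\<close> can serve as
  \<open>e\<close>.\<close>

lemma optimal_coeff_radial:
  fixes u :: "'a::euclidean_space"
  assumes \<rho>: "0 \<le> \<rho>" "\<rho> < 1" and u: "norm u = 1" and n: "DIM('a) = n" "n \<ge> 3"
  shows "optimal_coeff (\<rho> *\<^sub>R u) u
    (4 / sqrt pi * (Gamma (real n / 2) / Gamma ((real n - 1) / 2)) *
          (2 ^ (n - 1) / (1 + \<rho>) ^ (n - 1)) *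
          (LBINT w:{0..w_bound n \<rho>}.
             beta n \<rho> * ((w_bound n \<rho>)\<^sup>2 - w\<^sup>2) * w ^ (n - 2) / denom n \<rho> w))"
proof -
  define m where "m = n - 2"
  have m: "n = m + 2" "m \<ge> 1" "n - 2 = m" using n by (simp_all add: m_def)
  let ?q = "\<lambda>t w. ennreal ((1 * (real n - beta n \<rho> - beta n \<rho> * w\<^sup>2) + real n * 0 * t * w) * w ^ m / denom n \<rho> w)"
  have \<rho>1: "\<rho> \<le> 1" using \<rho> by simp
  note P = nn_integral_P_fun[OF m(1,2) \<rho>(1) \<rho>1]
  obtain w0 :: 'a where w0: "w0 \<noteq> 0" "orthogonal u w0" using orthogonal_to_vector_exists[of u] n by auto
  define e where "e = sgn w0"
  have e: "norm e = 1" "u \<bullet> e = 0" using w0 by (auto simp: e_def norm_sgn orthogonal_def sgn_div_norm)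
  define W where "W t = ennreal ((1 - t\<^sup>2) powr ((real m - 2) / 2) * indicator {-1<..<1} t)" for t :: real
  have [measurable]: "W \<in> borel_measurable borel" unfolding W_def[abs_def] by measurable
  have lt: "(real n - 2) * \<rho> < real n"
  proof -
    have "(real n - 2) * \<rho> \<le> (real n - 2) * 1" using n \<rho> by (intro mult_left_mono) auto
    then show ?thesis by (rule le_less_trans) simp
  qed
  have "0 \<le> (real n - 2) * \<rho>" using n \<rho> by simp
  then have "0 \<le> real n + (real n - 2) * \<rho>" by simp
  then have \<beta>: "beta n \<rho> > 0" "real n - beta n \<rho> \<ge> 0" using lt by (simp_all add: beta_def field_simps)
  have wb: "w_bound n \<rho> = sqrt ((real n - beta n \<rho>) / beta n \<rho>)"
  proof -
    have e1: "real n + (real n - 2) * \<rho> = 2 * (real n - beta n \<rho>)" and e2: "real n - (real n - 2) * \<rho> = 2 * beta n \<rho>"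
      by (simp_all add: beta_def field_simps)
    show ?thesis unfolding w_bound_def e1 e2 by (simp only: mult_divide_mult_cancel_left_if) simp
  qed
  have wb2: "beta n \<rho> * (w_bound n \<rho>)\<^sup>2 = real n - beta n \<rho>"
    using \<beta> by (simp add: wb)
  \<comment> \<open>At z = 0 the positive root is sqrt (1 - \<alpha>^2) / (1 - \<alpha>) = sqrt ((1
    + \<alpha>) / (1 - \<alpha>)).\<close>
  have up: "(0 + sqrt (0\<^sup>2 + 1 - (alpha n \<rho>)\<^sup>2)) / (1 - alpha n \<rho>) = w_bound n \<rho>"
  proof -
    define a where "a = alpha n \<rho>"
    have a: "0 \<le> a" "a < 1" using lt n \<rho> by (simp_all add: a_def alpha_def divide_less_eq)
    have e1: "real n * (1 - a) = 2 * beta n \<rho>" and e2: "real n * (1 + a) = 2 * (real n - beta n \<rho>)"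
      using n by (simp_all add: a_def alpha_def beta_def field_simps)
    have "(real n - beta n \<rho>) / beta n \<rho> = (real n * (1 + a)) / (real n * (1 - a))"
      unfolding e1 e2 by (simp only: mult_divide_mult_cancel_left_if) simp
    also have "\<dots> = (1 + a) / (1 - a)" using n by simp
    also have "\<dots> = (1 - a\<^sup>2) / (1 - a)\<^sup>2"
    proof -
      have "1 - a\<^sup>2 = (1 + a) * (1 - a)" by (simp add: power2_eq_square algebra_simps)
      then show ?thesis unfolding power2_eq_square[of "1 - a"] using a by simp
    qed
    finally have "w_bound n \<rho> = sqrt (1 - a\<^sup>2) / sqrt ((1 - a)\<^sup>2)" by (simp add: wb real_sqrt_divide)
    then show ?thesis using a by (simp add: a_def)
  qed
  have P0: "P_fun n \<rho> 0 = (LBINT w:{0..w_bound n \<rho>}. beta n \<rho> * ((w_bound n \<rho>)\<^sup>2 - w\<^sup>2) * w ^ (n - 2) / denom n \<rho> w)"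
    unfolding P_fun_def up by (simp add: right_diff_distrib wb2)
  have "(\<integral>\<^sup>+t. (\<integral>\<^sup>+w. ?q t w
           * indicator {0..} w \<partial>lborel) * W t \<partial>lborel) = (\<integral>\<^sup>+t. ennreal (P_fun n \<rho> 0) * W t \<partial>lborel)"
    using P(1)[of 0] by simp
  also have "\<dots> = ennreal (P_fun n \<rho> 0) * (\<integral>\<^sup>+t. W t \<partial>lborel)"
    by (rule nn_integral_cmult) simp
  finally have J: "enn2real (\<integral>\<^sup>+t. (\<integral>\<^sup>+w. ?q t w
           * indicator {0..} w \<partial>lborel) * W t \<partial>lborel) = P_fun n \<rho> 0 * enn2real (\<integral>\<^sup>+t. W t \<partial>lborel)"
    using P(2) by (simp add: enn2real_mult)
  have "4 * omega m / omega n * (2 ^ (n - 1) / (1 + \<rho>) ^ (n - 1)) * (P_fun n \<rho> 0 * enn2real (\<integral>\<^sup>+t. W t \<partial>lborel))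
    = 4 * (omega m / omega n * enn2real (\<integral>\<^sup>+t. W t \<partial>lborel)) * (2 ^ (n - 1) / (1 + \<rho>) ^ (n - 1)) * P_fun n \<rho> 0"
    by (simp add: mult_ac)
  also have "\<dots> = 4 / sqrt pi * (Gamma (real n / 2) / Gamma ((real n - 1) / 2)) * (2 ^ (n - 1) / (1 + \<rho>) ^ (n - 1)) * P_fun n \<rho> 0"
    unfolding W_def sphere_weight_integral[OF n(1) m(1,2)] by simp
  finally show ?thesis
    using optimal_coeff_double_integral[OF \<rho> u e n(1) m(1,2), of 1 0] J unfolding P0 W_def by simp
qed

lemma nn_integral_first_moment_weight:
  assumes m: "m \<ge> 1"
  shows "(\<integral>\<^sup>+t. ennreal t * ennreal ((1 - t\<^sup>2) powr ((real m - 2) / 2) * indicator {-1<..<1} t) \<partial>lborel) = ennreal (1 / real m)"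
proof -
  have hi: "((\<lambda>t. t * (1 - t\<^sup>2) powr ((real m - 2) / 2)) has_integral
     (- ((1 - 1\<^sup>2) powr (real m / 2) / real m) - - ((1 - 0\<^sup>2) powr (real m / 2) / real m))) {0..1}"
  \<comment> \<open>For \<open>m = 1\<close> the integrand is unbounded near 1, so the
    antiderivative is differentiated only in the interior and merely continuous at the
    endpoint.\<close>
  proof (rule fundamental_theorem_of_calculus_interior)
    show "continuous_on {0..1} (\<lambda>t. - ((1 - t\<^sup>2) powr (real m / 2) / real m))"
      using m by (intro continuous_intros continuous_on_powr') (auto simp: abs_square_le_1)
    fix t :: real assume t: "t \<in> {0<..<1}"
    then have t2: "1 - t\<^sup>2 > 0" by (simp add: abs_square_less_1)
    have "((\<lambda>t. - ((1 - t\<^sup>2) powr (real m / 2) / real m)) has_real_derivative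
       - ((real m / 2) * (1 - t\<^sup>2) powr (real m / 2 - 1) * (0 - 2 * t) / real m)) (at t)"
    proof (intro DERIV_minus DERIV_cdivide)
      have "((\<lambda>t. 1 - t\<^sup>2) has_real_derivative (0 - 2 * t)) (at t)"
        by (rule derivative_eq_intros refl)+ simp
      then show "((\<lambda>t. (1 - t\<^sup>2) powr (real m / 2)) has_real_derivative
        (real m / 2) * (1 - t\<^sup>2) powr (real m / 2 - 1) * (0 - 2 * t)) (at t)"
        using DERIV_fun_powr[of "\<lambda>t. 1 - t\<^sup>2" "0 - 2 * t" t "real m / 2"] t2 by simp
    qed
    moreover have "- ((real m / 2) * (1 - t\<^sup>2) powr (real m / 2 - 1) * (0 - 2 * t) / real m) = t * (1 - t\<^sup>2) powr ((real m - 2) / 2)"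
      using m by (simp add: diff_divide_distrib)
    ultimately show "((\<lambda>t. - ((1 - t\<^sup>2) powr (real m / 2) / real m)) has_vector_derivative t * (1 - t\<^sup>2) powr ((real m - 2) / 2)) (at t)"
      by (simp add: has_real_derivative_iff_has_vector_derivative)
  qed simp
  have "(\<integral>\<^sup>+t. ennreal t * ennreal ((1 - t\<^sup>2) powr ((real m - 2) / 2) * indicator {-1<..<1} t) \<partial>lborel)
    = (\<integral>\<^sup>+t. ennreal (t * (1 - t\<^sup>2) powr ((real m - 2) / 2)) * indicator {0..1} t \<partial>lborel)"
  proof (rule nn_integral_cong_AE, rule eventually_mono[OF AE_lborel_singleton[of 1]])
    fix t :: real assume "t \<noteq> 1"
    then show "ennreal t * ennreal ((1 - t\<^sup>2) powr ((real m - 2) / 2) * indicator {-1<..<1} t) =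
      ennreal (t * (1 - t\<^sup>2) powr ((real m - 2) / 2)) * indicator {0..1} t"
      by (cases "0 \<le> t") (auto simp: indicator_def ennreal_mult'' ennreal_neg)
  qed
  also have "\<dots> = ennreal (1 / real m)"
    using nn_integral_has_integral_lebesgue'[OF _ hi] m by simp
  finally show ?thesis .
qed

text \<open>The numerator is \<open>real n * t * w ^ (n - 1)\<close>, whose sign for positive
  \<open>w\<close> is that of t. Truncation thus restricts t rather than w, and the double integral
  factors into a first moment and an integral over the whole half-line.\<close>

lemma optimal_coeff_tangential:
  fixes u e :: "'a::euclidean_space"
  assumes \<rho>: "0 \<le> \<rho>" "\<rho> < 1" and ue: "norm u = 1" "norm e = 1" "u \<bullet> e = 0" and n: "DIM('a) = n" "n \<ge> 3"
  shows "optimal_coeff (\<rho> *\<^sub>R u) e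
    (2 * real n / pi * (2 ^ (n - 1) / (1 + \<rho>) ^ (n - 1)) * (LBINT w:{0..}. w ^ (n - 1) / denom n \<rho> w))"
proof -
  define m where "m = n - 2"
  have m: "n = m + 2" "m \<ge> 1" "n - 1 = m + 1" using n by (simp_all add: m_def)
  let ?q = "\<lambda>t w. (0 * (real n - beta n \<rho> - beta n \<rho> * w\<^sup>2) + real n * 1 * t * w) * w ^ m / denom n \<rho> w"
  define W where "W t = ennreal ((1 - t\<^sup>2) powr ((real m - 2) / 2) * indicator {-1<..<1} t)" for t :: real
  have [measurable]: "W \<in> borel_measurable borel" unfolding W_def[abs_def] by measurable
  define L where "L = (LBINT w:{0..}. w ^ (n - 1) / denom n \<rho> w)"
  define I where "I = (\<integral>\<^sup>+w. ennreal (indicator {0..} w *\<^sub>R (w ^ (n - 1) / denom n \<rho> w)) \<partial>lborel)"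
  have L: "L = enn2real I"
    \<comment> \<open>Nonnegativity and measurability suffice: in case of divergence both sides
      would be 0 by convention.\<close>
    unfolding L_def I_def set_lebesgue_integral_def
    by (rule integral_eq_nn_integral) (auto simp: indicator_def less_imp_le[OF denom_pos])
  have "(\<integral>\<^sup>+t. (\<integral>\<^sup>+w. ennreal (?q t w)
           * indicator {0..} w \<partial>lborel) * W t \<partial>lborel) = (\<integral>\<^sup>+t. (ennreal (real n) * I) * (ennreal t * W t) \<partial>lborel)"
  proof (rule nn_integral_cong)
    fix t :: real
    have "(\<integral>\<^sup>+w. ennreal (?q t w) * indicator {0..} w \<partial>lborel)
      = (\<integral>\<^sup>+w. (ennreal (real n) * ennreal t) * ennreal (indicator {0..} w *\<^sub>R (w ^ (n - 1) / denom n \<rho> w)) \<partial>lborel)"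
    proof (rule nn_integral_cong)
      fix w :: real
      show "ennreal (?q t w) * indicator {0..} w
        = (ennreal (real n) * ennreal t) * ennreal (indicator {0..} w *\<^sub>R (w ^ (n - 1) / denom n \<rho> w))"
      proof (cases "w \<ge> 0")
        case True
        have eq: "?q t w
          = (real n * t) * (w ^ (n - 1) / denom n \<rho> w)" unfolding m(3) by simp
        define v where "v = w ^ (n - 1) / denom n \<rho> w"
        have "v \<ge> 0" using True denom_pos[of n \<rho> w] by (simp add: v_def)
        then show ?thesis
          unfolding eq v_def[symmetric] using True by (simp add: ennreal_mult'' ennreal_mult')
      qed simp
    qed
    also have "\<dots> = (ennreal (real n) * ennreal t) * I"
      unfolding I_def by (rule nn_integral_cmult) measurable
    finally show "(\<integral>\<^sup>+w. ennreal (?q t w) * indicator {0..} w \<partial>lborel) * W t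
      = (ennreal (real n) * I) * (ennreal t * W t)" by (simp add: mult_ac)
  qed
  also have "\<dots> = (ennreal (real n) * I) * ennreal (1 / real m)"
    using nn_integral_first_moment_weight[OF m(2)] by (subst nn_integral_cmult) (simp_all add: W_def)
  finally have J: "enn2real (\<integral>\<^sup>+t. (\<integral>\<^sup>+w. ennreal (?q t w)
           * indicator {0..} w \<partial>lborel) * W t \<partial>lborel) = real n * L / real m"
    by (simp add: enn2real_mult L)
  \<comment> \<open>The areas differ by one Gamma recursion and one factor \<pi>. With the moment
    \<open>1 / real m\<close> this turns 4 into \<open>2 / pi\<close>.\<close>
  have om: "omega m / omega n = real m / (2 * pi)"
  proof -
    have "real m / 2 \<notin> \<int>\<^sub>\<le>\<^sub>0" using m by (auto dest: nonpos_Ints_nonpos)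
    then have G: "Gamma (real m / 2 + 1) = real m / 2 * Gamma (real m / 2)" by (rule Gamma_plus1)
    have e: "real n / 2 = real m / 2 + 1" by (simp add: m(1))
    have "Gamma (real m / 2) > 0" using m by (simp add: Gamma_real_pos)
    then show ?thesis unfolding omega_def e G powr_add by simp
  qed
  have "4 * omega m / omega n * K * (real n * L / real m) = 4 * (omega m / omega n) * K * (real n * L / real m)" for K
    by simp
  also have "\<dots> K = 2 * real n / pi * K * L" for K
    unfolding om using m by simp
  finally have "4 * omega m / omega n * K * (real n * L / real m) = 2 * real n / pi * K * L" for K .
  moreover have "optimal_coeff (\<rho> *\<^sub>R u) (0 *\<^sub>R u + 1 *\<^sub>R e) (4 * omega m / omega n * (2 ^ (n - 1) / (1 + \<rho>) ^ (n - 1)) * (real n * L / real m))"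
    using optimal_coeff_double_integral[OF \<rho> ue n(1) m(1,2), of 0 1] unfolding W_def[symmetric] J .
  ultimately show ?thesis unfolding L_def[symmetric] by (simp only: scaleR_zero_left scaleR_one add_0_left)
qed

theorem theorem2p12:
  fixes x nx l :: "real ^ 'n" and n :: nat and \<rho> \<tau> \<gamma> :: real
  assumes "n = CARD('n)" and "n \<ge> 3"
    and "x \<in> ball 0 1" and "l \<in> sphere 0 1"
    and "norm nx = 1" and "x \<noteq> 0 \<Longrightarrow> nx = x /\<^sub>R norm x"
    and "\<tau> = line_angle nx l" and "\<gamma> = tan \<tau>" and "\<rho> = norm x"
  shows
    "(0 \<le> \<tau> \<and> \<tau> < pi / 2 \<longrightarrow>
       optimal_coeff x l
         (4 * omega (n - 2) / omega n * (2 ^ (n - 1) / (1 + \<rho>) ^ (n - 1)) *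
          (1 / sqrt (1 + \<gamma>\<^sup>2)) *
          (LBINT t:{0..1}. (P_fun n \<rho> (\<gamma> * t) + P_fun n \<rho> (- (\<gamma> * t))) /
             sqrt ((1 - t\<^sup>2) powi (4 - int n)))))
     \<and> optimal_coeff x nx
         (4 / sqrt pi * (Gamma (real n / 2) / Gamma ((real n - 1) / 2)) *
          (2 ^ (n - 1) / (1 + \<rho>) ^ (n - 1)) *
          (LBINT w:{0..w_bound n \<rho>}.
             beta n \<rho> * ((w_bound n \<rho>)\<^sup>2 - w\<^sup>2) * w ^ (n - 2) / denom n \<rho> w))
     \<and> (\<forall>t. norm t = 1 \<and> t \<bullet> nx = 0 \<longrightarrow>
         optimal_coeff x t
           (2 * real n / pi * (2 ^ (n - 1) / (1 + \<rho>) ^ (n - 1)) *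
            (LBINT w:{0..}. w ^ (n - 1) / denom n \<rho> w)))"
proof (intro conjI impI allI)
  let ?C = "4 * omega (n - 2) / omega n * (2 ^ (n - 1) / (1 + \<rho>) ^ (n - 1)) *
          (1 / sqrt (1 + \<gamma>\<^sup>2)) *
          (LBINT t:{0..1}. (P_fun n \<rho> (\<gamma> * t) + P_fun n \<rho> (- (\<gamma> * t))) /
             sqrt ((1 - t\<^sup>2) powi (4 - int n)))"
  have \<rho>: "0 \<le> \<rho>" "\<rho> < 1" using assms(3,9) by simp_all
  \<comment> \<open>This also covers \<open>x = 0\<close>, where \<rho> = 0 and \<open>nx\<close> is
    an arbitrary unit vector.\<close>
  have x: "x = \<rho> *\<^sub>R nx" using assms(6,9) by (cases "x = 0") simp_all
  have n: "DIM(real ^ 'n) = n" using assms(1) by simp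
  have l: "norm l = 1" using assms(4) by simp
  show "optimal_coeff x nx
         (4 / sqrt pi * (Gamma (real n / 2) / Gamma ((real n - 1) / 2)) *
          (2 ^ (n - 1) / (1 + \<rho>) ^ (n - 1)) *
          (LBINT w:{0..w_bound n \<rho>}.
             beta n \<rho> * ((w_bound n \<rho>)\<^sup>2 - w\<^sup>2) * w ^ (n - 2) / denom n \<rho> w))"
    unfolding x by (rule optimal_coeff_radial[OF \<rho> assms(5) n assms(2)])
  show "optimal_coeff x t
           (2 * real n / pi * (2 ^ (n - 1) / (1 + \<rho>) ^ (n - 1)) *
            (LBINT w:{0..}. w ^ (n - 1) / denom n \<rho> w))" if "norm t = 1 \<and> t \<bullet> nx = 0" for t
    unfolding x by (rule optimal_coeff_tangential[OF \<rho> assms(5) _ _ n assms(2)]) (use that in \<open>auto simp: inner_commute\<close>)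
  assume \<tau>: "0 \<le> \<tau> \<and> \<tau> < pi / 2"
  \<comment> \<open>Stated for whichever of \<open>l\<close> and \<open>- l\<close> has a
    nonnegative inner product with \<open>nx\<close>; that product is then cos \<tau>.\<close>
  have oblique: "optimal_coeff x k ?C"
    if k: "norm k = 1" and c: "nx \<bullet> k = \<bar>nx \<bullet> l\<bar>" for k
  proof -
    obtain e s where e: "norm e = 1" "nx \<bullet> e = 0" "k = (nx \<bullet> k) *\<^sub>R nx + s *\<^sub>R e" "s \<ge> 0" "(nx \<bullet> k)\<^sup>2 + s\<^sup>2 = 1"
      using unit_vector_decomposition[OF assms(5) k] n assms(2) by auto
    have c1: "0 \<le> nx \<bullet> k" "nx \<bullet> k \<le> 1"
      using c norm_cauchy_schwarz[of nx k] assms(5) k by auto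
    have cos: "cos \<tau> = nx \<bullet> k" using c c1 by (simp add: assms(7) line_angle_def)
    have pos: "cos \<tau> > 0" using \<tau> by (intro cos_gt_zero_pi) auto
    \<comment> \<open>Both \<open>s\<close> and sin \<tau> are nonnegative, so equality of their
      squares fixes \<open>s\<close>.\<close>
    have sin0: "sin \<tau> \<ge> 0" using \<tau> by (intro sin_ge_zero) auto
    have "s\<^sup>2 = (sin \<tau>)\<^sup>2" using e(5) sin_cos_squared_add[of \<tau>] by (simp add: cos)
    then have "s = sin \<tau>" using e(4) sin0 by (simp add: power2_eq_iff_nonneg)
    then have s: "s = cos \<tau> * \<gamma>" using pos by (simp add: assms(8) tan_def)
    have "1 + \<gamma>\<^sup>2 = (1 / cos \<tau>)\<^sup>2"
      using tan_sec[of \<tau>] pos by (simp add: assms(8) inverse_eq_divide power_divide)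
    then have "sqrt (1 + \<gamma>\<^sup>2) = 1 / cos \<tau>" using pos by simp
    then have sq: "1 / sqrt (1 + \<gamma>\<^sup>2) = cos \<tau>" by simp
    have "k = cos \<tau> *\<^sub>R nx + (cos \<tau> * \<gamma>) *\<^sub>R e" using e(3) by (simp add: cos[symmetric] s[symmetric])
    then show ?thesis
      unfolding x sq using optimal_coeff_oblique[OF \<rho> assms(5) e(1,2) n assms(2) pos, of \<gamma>] by simp
  qed
  show "optimal_coeff x l ?C"
  proof (cases "nx \<bullet> l \<ge> 0")
    case True
    then show ?thesis by (intro oblique l) simp
  next
    case False
    have "optimal_coeff x (- l) ?C"
      using False l by (intro oblique) simp_all
    then show ?thesis by (simp only: optimal_coeff_uminus)
  qed
qed

end
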